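(* Consider the linear model with unpenalized intercept, $y_i=x_i\beta^*+\sigma^*\xi_i$, $i=1,\dots,n$, with $\sigma^*=1$, and the exp-Lasso estimator $(\hat\beta,\hat\sigma)$ with tuning parameter $\lambda$ in which the intercept is not penalized, as described in the context. Let $S^*:=\{j\in\{2,\dots,p\}:\beta^*_j\ne0\}$ and $s^*:=|S^*|\ge1$. Assume: (1) $\xi_1,\xi_2,\dots$ are i.i.d. copies of a random variable $\xi$ with known density $f$ (not depending on $n$), $f>0$ everywhere, $l:=-\log f$ is convex and differentiable with derivative $\dot l$, and $|\mathbb E\, l(\xi)|<\infty$, $\mathbb E(\dot l(\xi))^2<\infty$, $\mathbb E(\dot l(\xi)\xi)^2<\infty$. (2) The $x_i$ are non-random and $\max_{i,j}|x_{i,j}|\le K_{\rm x}$, where $K_{\rm x}\ge1$. (3) There is a function $G>0$ with $\mathbb E G^2(\xi)<\infty$ and $\mathbb E G^2(\xi)\xi^4<\infty$ such that for all $M>0$ small enough, $|\dot l(\xi+y)-\dot l(\xi+\tilde y)|\le G(\xi)|y-\tilde y|$ for all $y,\tilde y$ with $|y|\vee|\tilde y|\le (K_{\rm x}+|\xi|)M$. (4) The function $H(c,d):=\mathbb E\, l(d\xi-c)$, $(c,d)\in\mathbb R\times(0,\infty)$, has for $|c|+|d-1|$ small enough a Hessian $\ddot H(c,d)$ which is continuous there, and $\ddot H(0,1)$ is positive definite. Moreover, with $\mathcal H(c,d):=H(c,d)-\log d$ and $\ddot{\mathcal H}$ its Hessian, for some constant $L_{\rm H}$ and all $|c|+|d-1|$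 small enough, $\|\ddot{\mathcal H}(c,d)-\ddot{\mathcal H}(0,1)\|_\infty\le L_{\rm H}(|c|+|d-1|)$. (5) $p\to\infty$ and $\log p/n\to0$. (6) For some matrix $\Sigma\in\mathbb R^{p\times p}$ with smallest eigenvalue $\Lambda_{\rm x}^2>0$ not depending on $n$, $\max_{j,k}|\hat\Sigma_{j,k}-\Sigma_{j,k}|\lesssim K_{\rm x}^2\sqrt{\log p/n}$. (7) Either $\alpha\in(0,1/2)$ is fixed (not depending on $n$) or $\alpha=1/p$, and $F^{-1}(1-\alpha)\asymp\sqrt{\log p/n}$, where $F$ is the distribution of $\lambda^*$. (8) $s^*\le s_{\max}$, where $1\le s_{\max}\ll\Lambda_{\rm x}^2\sqrt{n/\log p}/K_{\rm x}^2$. (9) $\sum_{i=1}^nx_{i,j}=0$ for $j=2,\dots,p$. (10) $0<\eta<1$, $1-\eta\gtrsim1$, $\eta^2\gg s_{\max}\sqrt{\log p/n}\,K_{\rm x}^2/\Lambda_{\rm x}^2$, $\lambda\asymp\sqrt{\log p/n}$ and $\lambda\ge F^{-1}(1-\alpha)/(1-\eta)$. Then there is a sequence $r_n>0$ with $r_n=\mathcal O(K_{\rm x}^2\lambda s^*/\eta^2)=o(1)$ such that, if moreover the following irrepresentable condition holds with $$\eta_0=\frac{\eta(1-r_n)}{2-\eta(1+r_n)}:$$ $X_{S^*}^TX_{S^*}$ is invertible and for all $\tau_{S^*}\in\mathbb R^{s^*}$ with $\|\tau_{S^*}\|_\infty\le1$, $$\bigl\|X_{-S^*}^TX_{S^*}(X_{S^*}^TX_{S^*})^{-1}\tau_{S^*}\bigr\|_\infty<\eta_0,$$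 then $\hat\beta_{-S^*}=0$ with probability at least $1-\alpha+o(1)$.
   Context: Model: $x_i=(1,x_{i,2},\dots,x_{i,p})\in\mathbb R^p$ is a row vector whose first entry is $1$ (intercept), $y_i=x_i\beta^*+\sigma^*\xi_i$, with $\beta^*\in\mathbb R^p$ an unknown column vector and $\sigma^*>0$. Write $\beta=(\beta_0,\beta_{-0}^T)^T$ where $\beta_0:=\beta_1$ is the intercept and $\beta_{-0}:=(\beta_2,\dots,\beta_p)^T$. $X\in\mathbb R^{n\times p}$ is the matrix with rows $x_i$; $X_{S^*}$ consists of its columns with index in $S^*$ and $X_{-S^*}$ of its columns with index in $\{2,\dots,p\}\setminus S^*$; $\hat\beta_{-S^*}=\{\hat\beta_j:j\in\{2,\dots,p\}\setminus S^*\}$. $\hat\Sigma:=\frac1n\sum_{i=1}^n x_i^Tx_i$. $R_n(\beta,\sigma):=\frac1n\sum_{i=1}^n\bigl[l\bigl(\frac{y_i-x_i\beta}{\sigma}\bigr)+\log\sigma\bigr]$. Exp-Lasso with unpenalized intercept: $(\hat\beta,\hat\sigma)\in\arg\min_{\beta\in\mathbb R^p,\ \sigma>0}\{\exp[R_n(\beta,\sigma)]+\lambda\|\beta_{-0}\|_1\}$. $\lambda^*:=\bigl\|\frac1n\sum_{i=1}^n\dot l(\xi_i)x_i\bigr\|_\infty\exp\bigl[-\frac1n\sum_{i=1}^n\log f(\xi_i)\bigr]$; $F$ is its distribution function and $F^{-1}$ its quantile function. $\|\cdot\|_\infty$ is the maximum absolute entry of a vector or matrix. Asymptotics: limits are for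 $n\to\infty$. The quantities $p,x_i,\beta^*,K_{\rm x},\Sigma,s^*,s_{\max},\alpha,\eta,\lambda$ may depend on $n$; $f$ (and $L_{\rm H}$) does not. For positive sequences, $u\lesssim v$ (equivalently $v\gtrsim u$) means $\limsup u_n/v_n<\infty$; $u\asymp v$ means $u\lesssim v$ and $v\lesssim u$; $u\ll v$ or $v\gg u$ means $u_n/v_n\to0$; $u_n=\mathcal O(v_n)$ means $|u_n|\lesssim v_n$. "For $M$ small enough" means for all $0<M\le M_0$ for some $M_0>0$. *)

theory Defs
  imports
    "HOL-Probability.Probability"
    "HOL-Library.Landau_Symbols"
    "Jordan_Normal_Form.Char_Poly"
    "Jordan_Normal_Form.Gauss_Jordan_Elimination"
    "Jordan_Normal_Form.DL_Submatrix"
begin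

(* "$" is used for the vectors of Jordan_Normal_Form, whose dimension may vary with n. *)
unbundle no vec_syntax

(* Indices are shifted by one: observations are 0, ..., n - 1 and coordinates are 0, ..., p - 1.
   Column 0 of a design matrix is the intercept column. *)

(* Inserting 0 gives the norm 0 to a vector or matrix without entries. *)
definition linf_vec :: "real vec \<Rightarrow> real" where
  "linf_vec v = Max (insert 0 (abs ` set\<^sub>v v))"

definition linf_mat :: "real mat \<Rightarrow> real" where
  "linf_mat A = Max (insert 0 (abs ` elements_mat A))"

definition smallest_eigenvalue :: "real mat \<Rightarrow> real \<Rightarrow> bool" where
  "smallest_eigenvalue A k \<longleftrightarrow> eigenvalue A k \<and> (\<forall>k'. eigenvalue A k' \<longrightarrow> k \<le> k')"

(* Twice Frechet differentiable at z: the gradient g exists near z and has derivative A at z. *)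
definition has_hessian :: "(real^2 \<Rightarrow> real) \<Rightarrow> real^2^2 \<Rightarrow> real^2 \<Rightarrow> bool" where
  "has_hessian F A z \<longleftrightarrow>
     (\<exists>g. (\<forall>\<^sub>F v in nhds z. GDERIV F v :> g v) \<and> (g has_derivative (\<lambda>h. A *v h)) (at z))"

definition hessian :: "(real^2 \<Rightarrow> real) \<Rightarrow> real^2 \<Rightarrow> real^2^2" where
  "hessian F z = (THE A. has_hessian F A z)"

definition linf_mat2 :: "real^2^2 \<Rightarrow> real" where
  "linf_mat2 A = Max {\<bar>vec_nth (vec_nth A i) j\<bar> | i j. True}"

definition positive_definite :: "real^2^2 \<Rightarrow> bool" where
  "positive_definite A \<longleftrightarrow>
     Finite_Cartesian_Product.transpose A = A \<and> (\<forall>v. v \<noteq> 0 \<longrightarrow> inner v (A *v v) > 0)"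

definition noise_law :: "(real \<Rightarrow> real) \<Rightarrow> real measure" where
  "noise_law f = density lborel (\<lambda>t. ennreal (f t))"

(* The loss l = - log f. *)
definition nll :: "(real \<Rightarrow> real) \<Rightarrow> real \<Rightarrow> real" where
  "nll f t = - ln (f t)"

(* A vector z of the plane stands for the pair (c, d). The Bochner integral is 0 for a
   non-integrable integrand; this does not occur for (c, d) near (0, 1) if the derivative of l is
   square integrable (also when multiplied by t) and has a local Lipschitz factor G(t) as in the
   theorem. *)
definition Hfun :: "(real \<Rightarrow> real) \<Rightarrow> real^2 \<Rightarrow> real" where
  "Hfun f z = (\<integral>t. nll f (vec_nth z 2 * t - vec_nth z 1) \<partial>noise_law f)"

definition Hcal :: "(real \<Rightarrow> real) \<Rightarrow> real^2 \<Rightarrow> real" where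
  "Hcal f z = Hfun f z - ln (vec_nth z 2)"

definition dist01 :: "real^2 \<Rightarrow> real" where
  "dist01 z = \<bar>vec_nth z 1\<bar> + \<bar>vec_nth z 2 - 1\<bar>"

definition response :: "real mat \<Rightarrow> real vec \<Rightarrow> real \<Rightarrow> (nat \<Rightarrow> real) \<Rightarrow> real vec" where
  "response X b sig e = vec (dim_row X) (\<lambda>i. (X *\<^sub>v b) $ i + sig * e i)"

definition emp_risk :: "(real \<Rightarrow> real) \<Rightarrow> real mat \<Rightarrow> real vec \<Rightarrow> real vec \<Rightarrow> real \<Rightarrow> real" where
  "emp_risk f X y b sig =
     1 / real (dim_row X) *
       (\<Sum>i<dim_row X. nll f ((y $ i - (X *\<^sub>v b) $ i) / sig) + ln sig)"

definition exp_lasso_objective ::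
  "(real \<Rightarrow> real) \<Rightarrow> real mat \<Rightarrow> real vec \<Rightarrow> real \<Rightarrow> real vec \<times> real \<Rightarrow> real" where
  "exp_lasso_objective f X y lam = (\<lambda>(b, sig).
     exp (emp_risk f X y b sig) + lam * (\<Sum>j\<in>{1..<dim_col X}. \<bar>b $ j\<bar>))"

definition exp_lasso_minimizer ::
  "(real \<Rightarrow> real) \<Rightarrow> real mat \<Rightarrow> real vec \<Rightarrow> real \<Rightarrow> real vec \<times> real \<Rightarrow> bool" where
  "exp_lasso_minimizer f X y lam = is_arg_min (exp_lasso_objective f X y lam)
     (\<lambda>(b, sig). b \<in> carrier_vec (dim_col X) \<and> sig > 0)"

definition sample_cov :: "real mat \<Rightarrow> real mat" where
  "sample_cov X = (1 / real (dim_row X)) \<cdot>\<^sub>m (transpose_mat X * X)"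

(* The maximum runs over all columns of X, the intercept column included. *)
definition lambda_star :: "(real \<Rightarrow> real) \<Rightarrow> real mat \<Rightarrow> (nat \<Rightarrow> real) \<Rightarrow> real" where
  "lambda_star f X e =
     linf_vec (vec (dim_col X)
       (\<lambda>j. 1 / real (dim_row X) * (\<Sum>i<dim_row X. deriv (nll f) (e i) * X $$ (i, j))))
     * exp (- (1 / real (dim_row X) * (\<Sum>i<dim_row X. ln (f (e i)))))"

(* Generalized inverse of the distribution function of a random variable Z on M. *)
definition quantile :: "'a measure \<Rightarrow> ('a \<Rightarrow> real) \<Rightarrow> real \<Rightarrow> real" where
  "quantile M Z u = Inf {t. u \<le> cdf (distr M borel Z) t}"

definition active_set :: "real vec \<Rightarrow> nat set" where
  "active_set b = {j \<in> {1..<dim_vec b}. b $ j \<noteq> 0}"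

(* X_S and X_{-S}: the columns with index in S, resp. the non-intercept columns outside S. *)
definition cols_in :: "real mat \<Rightarrow> nat set \<Rightarrow> real mat" where
  "cols_in X S = submatrix X UNIV S"

definition cols_out :: "real mat \<Rightarrow> nat set \<Rightarrow> real mat" where
  "cols_out X S = submatrix X UNIV ({1..<dim_col X} - S)"

definition irrepresentable :: "real mat \<Rightarrow> nat set \<Rightarrow> real \<Rightarrow> bool" where
  "irrepresentable X S \<eta>0 \<longleftrightarrow>
     (let XS = cols_in X S; XO = cols_out X S; A = transpose_mat XS * XS in
       invertible_mat A \<and>
       (\<forall>\<tau>\<in>carrier_vec (card S). linf_vec \<tau> \<le> 1 \<longrightarrow>
          linf_vec ((transpose_mat XO * XS * the (mat_inverse A)) *\<^sub>v \<tau>) < \<eta>0))"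

end

theory Submission
  imports Defs
begin

text \<open>With \<open>d = 1 / \<sigma>\<close> and \<open>t\<close> the deviation of \<open>(d \<beta>, d)\<close> from \<open>(d \<beta>\<^sup>*, 1)\<close>, the exp-Lasso objective is
  \<open>(exp (risk t) + \<lambda> pen t) / (1 + t p)\<close> with a convex numerator. Its sublevel sets are convex, so it
  suffices to control the gradient of the risk on a small \<open>l1\<close>-ball. There its increments differ from
  their expectation by \<open>K\<^sup>2 m sqrt (ln p / n)\<close> up to a constant, for radius \<open>m\<close>, uniformly and with
  probability tending to one (symmetrization, contraction and truncation), and the expected increments
  are nearly linear by the assumptions on the Hessian of \<open>H\<close>. On the event
  \<open>\<lambda>\<^sup>* \<le> (1 - \<eta>) \<lambda>\<close>, of probability at least \<open>1 - \<alpha>\<close>, the score at the truth is dominated by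
  the penalty. This gives a minimizer in the ball, with \<open>O(s \<lambda> / \<eta>)\<close> error, and reduces its
  stationarity conditions to those of a least squares Lasso with a perturbed score, where the
  irrepresentable condition excludes nonzero coefficients outside \<open>S\<close>.\<close>

subsection \<open>Contraction and symmetrization\<close>

text \<open>The envelope \<open>G u * (1 + |u|)^2\<close> of the score increments is only square
  integrable, so exponential moments need not exist. Truncation at \<open>1 / r\<close> with
  \<open>r = sqrt (ln p / n)\<close> balances two parts: below this level the exponential moment is
  governed by the second moment alone; above it Markov's inequality leaves a truncated second
  moment, which vanishes by dominated convergence. No peeling over radii is needed, since a sublevel
  point outside the ball can be pulled back to its sphere. The radius \<open>m\<close> enters its
  own bound through a term of order \<open>K^2 lam m^2\<close>; the smallness of
  \<open>K^2 lam s / eta^2\<close> absorbs this term, so the choice of \<open>m\<close> is not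
  circular. In the scale direction the mean one of the score cancels the first order effect of the
  denominator \<open>1 + t p\<close>. In the stationarity conditions, centered columns eliminate the
  intercept and the scale, and the remaining error is \<open>C6 y\<close> relative to
  \<open>lam\<close>, where \<open>y = K^2 lam s / eta\<close>. Taking \<open>r_n\<close> as a
  multiple of \<open>y / eta\<close> produces the stated \<open>eta0\<close>; the multiple is
  determined by the lower bound on \<open>1 - eta\<close>.\<close>

text \<open>The exponential is built in because contraction and symmetrization are both carried out
  on exponentials of suprema, one summand at a time. The index set is finite here; countable sets
  are reached later by monotone exhaustion.\<close>

definition max_exp :: "'t set \<Rightarrow> ('t \<Rightarrow> real) \<Rightarrow> real" where
  "max_exp T A = Max ((\<lambda>t. exp (A t)) ` T)"

lemma max_exp_ge: "finite T \<Longrightarrow> t \<in> T \<Longrightarrow> exp (A t) \<le> max_exp T A"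
  by (simp add: max_exp_def)

lemma max_exp_attained:
  assumes "finite T" "T \<noteq> {}"
  obtains t where "t \<in> T" "max_exp T A = exp (A t)" "\<And>u. u \<in> T \<Longrightarrow> A u \<le> A t"
proof -
  have "max_exp T A \<in> (\<lambda>t. exp (A t)) ` T"
    unfolding max_exp_def using assms by (intro Max_in) auto
  then obtain t where t: "t \<in> T" "max_exp T A = exp (A t)" by auto
  moreover have "A u \<le> A t" if "u \<in> T" for u
    using max_exp_ge[OF assms(1) that, of A] t by simp
  ultimately show ?thesis using that by blast
qed

lemma max_exp_nonneg: "finite T \<Longrightarrow> T \<noteq> {} \<Longrightarrow> 0 \<le> max_exp T A"
  by (metis max_exp_attained exp_ge_zero)

lemma max_exp_leI:
  assumes "finite T" "T \<noteq> {}" "\<And>t. t \<in> T \<Longrightarrow> exp (A t) \<le> B"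
  shows "max_exp T A \<le> B"
  using assms by (simp add: max_exp_def)

text \<open>Convexity of \<open>exp\<close>: a longer increment that starts further to the right is
  larger.\<close>

lemma exp_add_le_exp_add:
  fixes a b a' b' :: real
  assumes "0 \<le> b - b'" "b - b' \<le> a' - a" "b' \<le> a"
  shows "exp a + exp b \<le> exp a' + exp b'"
proof -
  have "exp b' * (exp (b - b') - 1) \<le> exp a * (exp (a' - a) - 1)"
    using assms by (intro mult_mono) auto
  thus ?thesis by (simp add: algebra_simps flip: exp_add)
qed

text \<open>The comparison step of the Ledoux--Talagrand contraction principle, for one Rademacher sign.\<close>

lemma max_exp_contraction:
  assumes T: "finite T" "T \<noteq> {}"
    and lip: "\<And>t u. t \<in> T \<Longrightarrow> u \<in> T \<Longrightarrow> \<bar>\<phi> t - \<phi> u\<bar> \<le> \<bar>s t - s u\<bar>"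
    and bd: "\<And>t. t \<in> T \<Longrightarrow> \<bar>\<phi> t\<bar> \<le> \<bar>s t\<bar>"
  shows "max_exp T (\<lambda>t. A t + \<phi> t) + max_exp T (\<lambda>t. A t - \<phi> t)
       \<le> max_exp T (\<lambda>t. A t + s t) + max_exp T (\<lambda>t. A t - s t)"
proof -
  obtain t where t: "t \<in> T" "max_exp T (\<lambda>t. A t + \<phi> t) = exp (A t + \<phi> t)"
    "\<And>u. u \<in> T \<Longrightarrow> A u + \<phi> u \<le> A t + \<phi> t"
    using max_exp_attained[OF T, of "\<lambda>t. A t + \<phi> t"] by blast
  obtain u where u: "u \<in> T" "max_exp T (\<lambda>t. A t - \<phi> t) = exp (A u - \<phi> u)"
    "\<And>t. t \<in> T \<Longrightarrow> A t - \<phi> t \<le> A u - \<phi> u"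
    using max_exp_attained[OF T, of "\<lambda>t. A t - \<phi> t"] by blast
  note l = lip[OF t(1) u(1)] and bt = bd[OF t(1)] and bu = bd[OF u(1)]
  note ot = t(3)[OF u(1)] and ou = u(3)[OF t(1)]
  have R: "exp (A t + s t) + exp (A u - s u) \<le> max_exp T (\<lambda>t. A t + s t) + max_exp T (\<lambda>t. A t - s t)"
      "exp (A u + s u) + exp (A t - s t) \<le> max_exp T (\<lambda>t. A t + s t) + max_exp T (\<lambda>t. A t - s t)"
    using max_exp_ge[OF T(1) t(1), of "\<lambda>t. A t + s t"] max_exp_ge[OF T(1) u(1), of "\<lambda>t. A t - s t"]
      max_exp_ge[OF T(1) t(1), of "\<lambda>t. A t - s t"] max_exp_ge[OF T(1) u(1), of "\<lambda>t. A t + s t"]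
    by auto
  \<comment> \<open>For \<open>s t\<close> and \<open>s u\<close> of equal sign the Lipschitz bound
    compares the increments, and the maximality of \<open>t\<close> and \<open>u\<close> supplies
    the ordering that \<open>exp_add_le_exp_add\<close> requires. For opposite signs the bound on
    \<open>\<phi>\<close> alone works, term by term.\<close>
  consider "s t \<ge> 0" "s u \<ge> 0" "s u \<le> s t" | "s t \<ge> 0" "s u \<ge> 0" "s t \<le> s u"
    | "s t \<le> 0" "s u \<le> 0" "s u \<le> s t" | "s t \<le> 0" "s u \<le> 0" "s t \<le> s u"
    | "s t \<ge> 0" "s u \<le> 0" | "s t \<le> 0" "s u \<ge> 0"
    by linarith
  hence "exp (A t + \<phi> t) + exp (A u - \<phi> u) \<le> exp (A t + s t) + exp (A u - s u) \<or>
      exp (A t + \<phi> t) + exp (A u - \<phi> u) \<le> exp (A u + s u) + exp (A t - s t)"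
  proof cases
    case 1
    have "exp (A t + \<phi> t) + exp (A u - \<phi> u) \<le> exp (A t + s t) + exp (A u - s u)"
      by (rule exp_add_le_exp_add) (use 1 l bt bu ot ou in auto)
    thus ?thesis ..
  next
    case 2
    have "exp (A u - \<phi> u) + exp (A t + \<phi> t) \<le> exp (A u + s u) + exp (A t - s t)"
      by (rule exp_add_le_exp_add) (use 2 l bt bu ot ou in auto)
    thus ?thesis by linarith
  next
    case 3
    have "exp (A u - \<phi> u) + exp (A t + \<phi> t) \<le> exp (A u - s u) + exp (A t + s t)"
      by (rule exp_add_le_exp_add) (use 3 l bt bu ot ou in auto)
    thus ?thesis by linarith
  next
    case 4
    have "exp (A t + \<phi> t) + exp (A u - \<phi> u) \<le> exp (A t - s t) + exp (A u + s u)"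
      by (rule exp_add_le_exp_add) (use 4 l bt bu ot ou in auto)
    thus ?thesis by linarith
  next
    case 5
    have "exp (A t + \<phi> t) \<le> exp (A t + s t)" "exp (A u - \<phi> u) \<le> exp (A u - s u)"
      using 5 bt bu by auto
    thus ?thesis by linarith
  next
    case 6
    have "exp (A t + \<phi> t) \<le> exp (A t - s t)" "exp (A u - \<phi> u) \<le> exp (A u + s u)"
      using 6 bt bu by auto
    thus ?thesis by linarith
  qed
  thus ?thesis using t(2) u(2) R by linarith
qed

lemma borel_measurable_max_exp [measurable (raw)]:
  assumes "finite T" "T \<noteq> {}" "\<And>t. t \<in> T \<Longrightarrow> (\<lambda>w. A w t) \<in> borel_measurable M"
  shows "(\<lambda>w. max_exp T (A w)) \<in> borel_measurable M"
  unfolding max_exp_def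
  using assms by (intro borel_measurable_Max[where f = "\<lambda>t w. exp (A w t)"]) auto

text \<open>Symmetrization of a single summand: convexity of the exponential separates the summand from
  its mean, and Jensen's inequality replaces the mean by an expectation.\<close>

lemma (in prob_space) max_exp_symmetrization:
  assumes T: "finite T" "T \<noteq> {}"
    and \<phi>: "\<And>t. t \<in> T \<Longrightarrow> (\<lambda>w. \<phi> w t) \<in> borel_measurable M"
    and s: "\<And>t. t \<in> T \<Longrightarrow> (\<lambda>w. s w t) \<in> borel_measurable M"
    and lip: "AE w in M. \<forall>t\<in>T. \<forall>u\<in>T. \<bar>\<phi> w t - \<phi> w u\<bar> \<le> \<bar>s w t - s w u\<bar>"
    and bd: "AE w in M. \<forall>t\<in>T. \<bar>\<phi> w t\<bar> \<le> \<bar>s w t\<bar> \<and> \<bar>s w t\<bar> \<le> B"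
  shows "(\<integral>\<^sup>+w. ennreal (max_exp T (\<lambda>t. A t + (\<phi> w t - expectation (\<lambda>w. \<phi> w t)))) \<partial>M)
    \<le> (\<integral>\<^sup>+w. ennreal ((max_exp T (\<lambda>t. A t + 2 * s w t) + max_exp T (\<lambda>t. A t - 2 * s w t)) / 2) \<partial>M)"
proof -
  define E where "E t = expectation (\<lambda>w. \<phi> w t)" for t
  have AEt: "AE w in M. \<bar>\<phi> w t\<bar> \<le> B" if "t \<in> T" for t using bd that by (auto elim!: eventually_mono)
  have int\<phi>: "integrable M (\<lambda>w. \<phi> w t)" if "t \<in> T" for t
    using \<phi>[OF that] AEt[OF that] by (intro integrable_const_bound[where B=B]) auto
  define m where "m w = max_exp T (\<lambda>t. A t - 2 * \<phi> w t)" for w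
  have m_meas[measurable]: "m \<in> borel_measurable M"
    unfolding m_def using T \<phi> by (intro borel_measurable_max_exp) auto
  have p_meas[measurable]: "(\<lambda>w. max_exp T (\<lambda>t. A t + 2 * \<phi> w t)) \<in> borel_measurable M"
    using T \<phi> by (intro borel_measurable_max_exp) auto
  have m_nonneg: "0 \<le> m w" for w by (simp add: m_def max_exp_nonneg[OF T])
  have intm: "integrable M m"
  proof (rule integrable_const_bound)
    show "AE w in M. norm (m w) \<le> max_exp T (\<lambda>t. A t + 2 * B)"
      using bd
    proof eventually_elim
      case (elim w)
      have "m w \<le> max_exp T (\<lambda>t. A t + 2 * B)"
        unfolding m_def
      proof (rule max_exp_leI[OF T])
        fix t assume t: "t \<in> T"
        have "exp (A t - 2 * \<phi> w t) \<le> exp (A t + 2 * B)" using elim t by force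
        also have "\<dots> \<le> max_exp T (\<lambda>t. A t + 2 * B)" by (rule max_exp_ge[OF T(1) t])
        finally show "exp (A t - 2 * \<phi> w t) \<le> max_exp T (\<lambda>t. A t + 2 * B)" .
      qed
      thus ?case using max_exp_nonneg[OF T] by (simp add: m_def)
    qed
  qed simp
  have J: "max_exp T (\<lambda>t. A t - 2 * E t) \<le> expectation m"
  proof (rule max_exp_leI[OF T])
    fix t assume t: "t \<in> T"
    have i2: "integrable M (\<lambda>w. exp (A t - 2 * \<phi> w t))"
    proof (rule integrable_const_bound)
      show "AE w in M. norm (exp (A t - 2 * \<phi> w t)) \<le> exp (A t + 2 * B)"
        using AEt[OF t] by eventually_elim auto
    qed (use \<phi>[OF t] in measurable)
    have "exp (A t - 2 * E t) = exp (expectation (\<lambda>w. A t - 2 * \<phi> w t))"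
      using int\<phi>[OF t] by (simp add: E_def prob_space)
    also have "\<dots> \<le> expectation (\<lambda>w. exp (A t - 2 * \<phi> w t))"
      using int\<phi>[OF t] i2 exp_convex
      by (intro jensens_inequality[where I=UNIV]) auto
    also have "\<dots> \<le> expectation m"
      unfolding m_def
      by (rule integral_mono[OF i2]) (use intm max_exp_ge[OF T(1) t] in \<open>auto simp: m_def[abs_def]\<close>)
    finally show "exp (A t - 2 * E t) \<le> expectation m" .
  qed
  have dist2: "\<bar>2 * a - 2 * b\<bar> = 2 * \<bar>a - b\<bar>" "\<bar>2 * a\<bar> = 2 * \<bar>a\<bar>" for a b :: real
    by (auto simp: abs_if)
  have "(\<integral>\<^sup>+w. ennreal (max_exp T (\<lambda>t. A t + (\<phi> w t - E t))) \<partial>M)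
      \<le> (\<integral>\<^sup>+w. ennreal (max_exp T (\<lambda>t. A t + 2 * \<phi> w t) / 2) + ennreal (expectation m / 2) \<partial>M)"
  proof (rule nn_integral_mono)
    fix w
    have "max_exp T (\<lambda>t. A t + (\<phi> w t - E t)) \<le> max_exp T (\<lambda>t. A t + 2 * \<phi> w t) / 2 + expectation m / 2"
    proof (rule max_exp_leI[OF T])
      fix t assume t: "t \<in> T"
      \<comment> \<open>The offset \<open>A t\<close> goes to both halves. This produces the factor
        2 in front of \<open>s\<close> and avoids an independent copy of \<open>w\<close>.\<close>
      have "exp (A t + (\<phi> w t - E t)) = exp ((1 - 1/2) *\<^sub>R (A t + 2 * \<phi> w t) + (1/2) *\<^sub>R (A t - 2 * E t))"
        by (simp add: field_simps)
      also have "\<dots> \<le> (1 - 1/2) * exp (A t + 2 * \<phi> w t) + (1/2) * exp (A t - 2 * E t)"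
        by (rule convex_onD[OF exp_convex]) auto
      also have "\<dots> \<le> max_exp T (\<lambda>t. A t + 2 * \<phi> w t) / 2 + expectation m / 2"
        using max_exp_ge[OF T(1) t, of "\<lambda>t. A t + 2 * \<phi> w t"] J
          max_exp_ge[OF T(1) t, of "\<lambda>t. A t - 2 * E t"] by simp
      finally show "exp (A t + (\<phi> w t - E t)) \<le> max_exp T (\<lambda>t. A t + 2 * \<phi> w t) / 2 + expectation m / 2" .
    qed
    moreover have "0 \<le> max_exp T (\<lambda>t. A t + 2 * \<phi> w t)" by (rule max_exp_nonneg[OF T])
    moreover have "0 \<le> expectation m"
      by (rule integral_nonneg_AE) (simp add: m_def max_exp_nonneg[OF T])
    ultimately show "ennreal (max_exp T (\<lambda>t. A t + (\<phi> w t - E t)))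
        \<le> ennreal (max_exp T (\<lambda>t. A t + 2 * \<phi> w t) / 2) + ennreal (expectation m / 2)"
      by (simp flip: ennreal_plus)
  qed
  also have "\<dots> = (\<integral>\<^sup>+w. ennreal (max_exp T (\<lambda>t. A t + 2 * \<phi> w t) / 2) \<partial>M) + (\<integral>\<^sup>+w. ennreal (m w / 2) \<partial>M)"
  proof -
    have "(\<integral>\<^sup>+w. ennreal (m w / 2) \<partial>M) = ennreal (expectation m / 2)"
      using nn_integral_eq_integral[of M "\<lambda>w. m w / 2"] intm max_exp_nonneg[OF T]
      by (simp add: m_def[abs_def])
    thus ?thesis by (simp add: nn_integral_add emeasure_space_1)
  qed
  also have "\<dots> = (\<integral>\<^sup>+w. ennreal ((max_exp T (\<lambda>t. A t + 2 * \<phi> w t) + m w) / 2) \<partial>M)"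
    using max_exp_nonneg[OF T] m_nonneg
    by (subst nn_integral_add[symmetric]) (auto simp: add_divide_distrib ennreal_plus intro!: nn_integral_cong)
  \<comment> \<open>Both halves are now integrals over the same \<open>w\<close>, so the plus and
    the minus act as the two values of a Rademacher sign and the contraction applies
    pointwise.\<close>
  also have "\<dots> \<le> (\<integral>\<^sup>+w. ennreal ((max_exp T (\<lambda>t. A t + 2 * s w t) + max_exp T (\<lambda>t. A t - 2 * s w t)) / 2) \<partial>M)"
  proof (rule nn_integral_mono_AE)
    show "AE w in M. ennreal ((max_exp T (\<lambda>t. A t + 2 * \<phi> w t) + m w) / 2)
       \<le> ennreal ((max_exp T (\<lambda>t. A t + 2 * s w t) + max_exp T (\<lambda>t. A t - 2 * s w t)) / 2)"
      using lip bd
    proof eventually_elim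
      case (elim w)
      have "max_exp T (\<lambda>t. A t + 2 * \<phi> w t) + m w
          \<le> max_exp T (\<lambda>t. A t + 2 * s w t) + max_exp T (\<lambda>t. A t - 2 * s w t)"
        unfolding m_def
        by (rule max_exp_contraction[OF T])
          (use elim in \<open>force simp: dist2\<close>)+
      thus ?case by (intro ennreal_leI) simp
    qed
  qed
  finally show ?thesis by (simp add: E_def)
qed

text \<open>A linear functional on an \<open>l1\<close>-ball is at most its largest value at the
  vertices, and the sum over all vertices dominates that value.\<close>

lemma exp_linear_le_sum:
  fixes a t :: "'k \<Rightarrow> real"
  assumes K: "finite K" "K \<noteq> {}" and t: "(\<Sum>k\<in>K. \<bar>t k\<bar>) \<le> m"
  shows "exp (\<Sum>k\<in>K. a k * t k) \<le> (\<Sum>k\<in>K. exp (m * a k) + exp (- m * a k))"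
proof -
  define b where "b = Max ((\<lambda>k. \<bar>a k\<bar>) ` K)"
  have "b \<in> (\<lambda>k. \<bar>a k\<bar>) ` K" unfolding b_def using K by (intro Max_in) auto
  then obtain k0 where k0: "k0 \<in> K" "b = \<bar>a k0\<bar>" by auto
  have "(\<Sum>k\<in>K. a k * t k) \<le> (\<Sum>k\<in>K. b * \<bar>t k\<bar>)"
  proof (rule sum_mono)
    fix k assume k: "k \<in> K"
    have "a k * t k \<le> \<bar>a k\<bar> * \<bar>t k\<bar>" by (metis abs_ge_self abs_mult)
    also have "\<dots> \<le> b * \<bar>t k\<bar>" using K k by (intro mult_right_mono) (auto simp: b_def)
    finally show "a k * t k \<le> b * \<bar>t k\<bar>" .
  qed
  also have "\<dots> \<le> b * m" using t k0 by (simp add: sum_distrib_left[symmetric] mult_left_mono)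
  finally have "exp (\<Sum>k\<in>K. a k * t k) \<le> exp (b * m)" by simp
  also have "\<dots> \<le> exp (m * a k0) + exp (- m * a k0)"
    by (cases "a k0 \<ge> 0") (auto simp: k0 mult.commute)
  also have "\<dots> \<le> (\<Sum>k\<in>K. exp (m * a k) + exp (- m * a k))"
    using K k0 by (intro member_le_sum) auto
  finally show ?thesis .
qed

text \<open>Induction on the number of summands. Symmetrization and contraction replace the last
  summand by plus or minus twice its linear majorant, which is absorbed into the linear offset; the
  offset \<open>a\<close> is therefore arbitrary in the induction. Averaging over the sign turns the
  vertex exponentials into a factor \<open>cosh\<close>, whose mean is at most
  \<open>c\<close>.\<close>

lemma nn_integral_PiM_max_exp_le:
  fixes N :: "real measure" and T :: "('k \<Rightarrow> real) set"
    and \<phi> :: "nat \<Rightarrow> real \<Rightarrow> ('k \<Rightarrow> real) \<Rightarrow> real" and w :: "nat \<Rightarrow> real \<Rightarrow> 'k \<Rightarrow> real"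
  assumes N: "prob_space N" and T: "finite T" "T \<noteq> {}" and K: "finite K" "K \<noteq> {}"
    and Tm: "\<And>t. t \<in> T \<Longrightarrow> (\<Sum>k\<in>K. \<bar>t k\<bar>) \<le> m"
    and \<phi>: "\<And>i t. t \<in> T \<Longrightarrow> (\<lambda>u. \<phi> i u t) \<in> borel_measurable N"
    and w: "\<And>i k. k \<in> K \<Longrightarrow> (\<lambda>u. w i u k) \<in> borel_measurable N"
    and lip: "\<And>i. i < n \<Longrightarrow> AE u in N. \<forall>t\<in>T. \<forall>t'\<in>T.
      \<bar>\<phi> i u t - \<phi> i u t'\<bar> \<le> \<bar>(\<Sum>k\<in>K. w i u k * t k) - (\<Sum>k\<in>K. w i u k * t' k)\<bar>"
    and bd: "\<And>i. i < n \<Longrightarrow> AE u in N. \<forall>t\<in>T.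
      \<bar>\<phi> i u t\<bar> \<le> \<bar>\<Sum>k\<in>K. w i u k * t k\<bar> \<and> \<bar>\<Sum>k\<in>K. w i u k * t k\<bar> \<le> B"
    and c: "\<And>i k. i < n \<Longrightarrow> k \<in> K \<Longrightarrow> (\<integral>\<^sup>+u. ennreal (cosh (2 * m * w i u k)) \<partial>N) \<le> ennreal c"
    and c0: "0 \<le> c"
  shows "(\<integral>\<^sup>+\<omega>. ennreal (max_exp T (\<lambda>t. (\<Sum>k\<in>K. a k * t k)
            + (\<Sum>i<n. \<phi> i (\<omega> i) t - (\<integral>u. \<phi> i u t \<partial>N)))) \<partial>PiM {..<n} (\<lambda>_. N))
       \<le> ennreal ((\<Sum>k\<in>K. exp (m * a k) + exp (- m * a k)) * c ^ n)"
  using lip bd c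
proof (induction n arbitrary: a)
  case 0
  have "max_exp T (\<lambda>t. \<Sum>k\<in>K. a k * t k) \<le> (\<Sum>k\<in>K. exp (m * a k) + exp (- m * a k))"
    using exp_linear_le_sum[OF K Tm] by (intro max_exp_leI[OF T]) auto
  thus ?case by (simp add: PiM_empty nn_integral_count_space_finite ennreal_leI)
next
  case (Suc n)
  interpret N: prob_space N by fact
  interpret product_prob_space "\<lambda>_. N" "UNIV :: nat set" by unfold_locales
  have PN: "pair_sigma_finite (PiM {..<n} (\<lambda>_. N)) N"
    by (rule pair_sigma_finite.intro[OF product_sigma_finite.sigma_finite[OF product_sigma_finite_axioms] N.sigma_finite_measure_axioms]) simp
  have half: "ennreal ((x + y) / 2) = ennreal (1/2) * (ennreal x + ennreal y)"
    if "0 \<le> x" "0 \<le> y" for x y :: real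
  proof -
    have "ennreal ((x + y) / 2) = ennreal (1/2 * (x + y))" by simp
    also have "\<dots> = ennreal (1/2) * ennreal (x + y)" by (rule ennreal_mult') simp
    finally show ?thesis using that by simp
  qed
  have \<phi>c[measurable]: "(\<lambda>\<omega>. \<phi> i (\<omega> i) t) \<in> borel_measurable (PiM J (\<lambda>_. N))"
    if "i \<in> J" "t \<in> T" for i t and J :: "nat set"
    by (rule measurable_compose[OF measurable_component_singleton[OF that(1)] \<phi>[OF that(2)]])
  define D where "D \<omega> t = (\<Sum>i<n. \<phi> i (\<omega> i) t - (\<integral>u. \<phi> i u t \<partial>N))" for \<omega> t
  define s where "s u t = (\<Sum>k\<in>K. w n u k * t k)" for u t
  define F where "F b \<omega> = max_exp T (\<lambda>t. (\<Sum>k\<in>K. b k * t k) + D \<omega> t)" for b \<omega>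
  note [measurable] = \<phi> w
  have IH: "(\<integral>\<^sup>+\<omega>. ennreal (F b \<omega>) \<partial>PiM {..<n} (\<lambda>_. N))
      \<le> ennreal ((\<Sum>k\<in>K. exp (m * b k) + exp (- m * b k)) * c ^ n)" for b
    unfolding F_def D_def by (rule Suc.IH) (use Suc.prems in auto)
  have F_nonneg: "0 \<le> F b \<omega>" for b \<omega> unfolding F_def by (rule max_exp_nonneg[OF T])
  have meas: "(\<lambda>\<omega>. max_exp T (\<lambda>t. (\<Sum>k\<in>K. a k * t k)
            + (\<Sum>i<Suc n. \<phi> i (\<omega> i) t - (\<integral>u. \<phi> i u t \<partial>N))))
        \<in> borel_measurable (PiM (insert n {..<n}) (\<lambda>_. N))"
    by (intro borel_measurable_max_exp[OF T] borel_measurable_add borel_measurable_sum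
         borel_measurable_diff borel_measurable_const \<phi>c) auto
  have Fm: "(\<lambda>z. F (\<lambda>k. a k + v * w n (snd z) k) (fst z)) \<in> borel_measurable (PiM {..<n} (\<lambda>_. N) \<Otimes>\<^sub>M N)" for v
    unfolding F_def D_def
    by (intro borel_measurable_max_exp[OF T] borel_measurable_add borel_measurable_sum
         borel_measurable_diff borel_measurable_const borel_measurable_times
         measurable_compose[OF measurable_snd w]
         measurable_compose[OF measurable_fst \<phi>c]) auto
  have Fm1: "(\<lambda>x. F (\<lambda>k. a k + v * w n y k) x) \<in> borel_measurable (PiM {..<n} (\<lambda>_. N))" for v y
    unfolding F_def D_def
    by (intro borel_measurable_max_exp[OF T] borel_measurable_add borel_measurable_sum
         borel_measurable_diff borel_measurable_const
         \<phi>c) auto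
  have coshm: "(\<lambda>y. ennreal (cosh (2 * m * w n y k))) \<in> borel_measurable N" if "k \<in> K" for k
    unfolding cosh_def using w[OF that] by measurable
  have "(\<integral>\<^sup>+\<omega>. ennreal (max_exp T (\<lambda>t. (\<Sum>k\<in>K. a k * t k)
            + (\<Sum>i<Suc n. \<phi> i (\<omega> i) t - (\<integral>u. \<phi> i u t \<partial>N)))) \<partial>PiM {..<Suc n} (\<lambda>_. N))
    = (\<integral>\<^sup>+x. \<integral>\<^sup>+y. ennreal (max_exp T (\<lambda>t. ((\<Sum>k\<in>K. a k * t k) + D x t)
            + (\<phi> n y t - (\<integral>u. \<phi> n u t \<partial>N)))) \<partial>N \<partial>PiM {..<n} (\<lambda>_. N))"
    using meas unfolding lessThan_Suc
    by (subst product_nn_integral_insert) (auto simp: D_def add_ac intro!: nn_integral_cong)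
  also have "\<dots> \<le> (\<integral>\<^sup>+x. \<integral>\<^sup>+y. ennreal ((max_exp T (\<lambda>t. ((\<Sum>k\<in>K. a k * t k) + D x t) + 2 * s y t)
         + max_exp T (\<lambda>t. ((\<Sum>k\<in>K. a k * t k) + D x t) - 2 * s y t)) / 2) \<partial>N \<partial>PiM {..<n} (\<lambda>_. N))"
    using Suc.prems(1)[of n] Suc.prems(2)[of n]
    by (intro nn_integral_mono N.max_exp_symmetrization[OF T, where B = B]) (auto simp: s_def)
  also have "\<dots> = (\<integral>\<^sup>+x. \<integral>\<^sup>+y. ennreal ((F (\<lambda>k. a k + 2 * w n y k) x + F (\<lambda>k. a k + (-2) * w n y k) x) / 2)
       \<partial>N \<partial>PiM {..<n} (\<lambda>_. N))"
    by (intro nn_integral_cong arg_cong[where f = ennreal] arg_cong2[where f = "\<lambda>x y. (x + y) / 2"])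
      (auto simp: F_def s_def sum.distrib sum_subtractf sum_distrib_left algebra_simps intro!: arg_cong[where f = "max_exp T"])
  \<comment> \<open>With the earlier coordinates integrated first, \<open>y\<close> is frozen and
    the induction hypothesis applies with the offsets \<open>a k + 2 * w n y k\<close> and
    \<open>a k - 2 * w n y k\<close>.\<close>
  also have "\<dots> = (\<integral>\<^sup>+y. \<integral>\<^sup>+x. ennreal ((F (\<lambda>k. a k + 2 * w n y k) x + F (\<lambda>k. a k + (-2) * w n y k) x) / 2)
       \<partial>PiM {..<n} (\<lambda>_. N) \<partial>N)"
    using Fm[of 2] Fm[of "-2"] by (intro pair_sigma_finite.Fubini'[OF PN, symmetric]) (auto simp: split_def)
  also have "\<dots> \<le> (\<integral>\<^sup>+y. ennreal ((\<Sum>k\<in>K. (exp (m * a k) + exp (- m * a k)) * cosh (2 * m * w n y k)) * c ^ n) \<partial>N)"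
  proof (rule nn_integral_mono)
    fix y
    have "(\<integral>\<^sup>+x. ennreal ((F (\<lambda>k. a k + 2 * w n y k) x + F (\<lambda>k. a k + (-2) * w n y k) x) / 2) \<partial>PiM {..<n} (\<lambda>_. N))
       = ennreal (1/2) * ((\<integral>\<^sup>+x. ennreal (F (\<lambda>k. a k + 2 * w n y k) x) \<partial>PiM {..<n} (\<lambda>_. N))
          + (\<integral>\<^sup>+x. ennreal (F (\<lambda>k. a k + (-2) * w n y k) x) \<partial>PiM {..<n} (\<lambda>_. N)))"
      unfolding half[OF F_nonneg F_nonneg]
      using Fm1[of 2] Fm1[of "-2"] by (subst nn_integral_cmult, simp, subst nn_integral_add) simp_all
    also have "\<dots> \<le> ennreal (1/2) * (ennreal ((\<Sum>k\<in>K. exp (m * (a k + 2 * w n y k)) + exp (- m * (a k + 2 * w n y k))) * c ^ n)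
        + ennreal ((\<Sum>k\<in>K. exp (m * (a k + (-2) * w n y k)) + exp (- m * (a k + (-2) * w n y k))) * c ^ n))"
      by (intro mult_left_mono add_mono IH) auto
    also have "\<dots> = ennreal (1/2 * ((\<Sum>k\<in>K. exp (m * (a k + 2 * w n y k)) + exp (- m * (a k + 2 * w n y k)))
        + (\<Sum>k\<in>K. exp (m * (a k + (-2) * w n y k)) + exp (- m * (a k + (-2) * w n y k)))) * c ^ n)"
      using c0 by (subst half[symmetric]) (auto intro!: mult_nonneg_nonneg sum_nonneg arg_cong[where f = ennreal] simp: add_divide_distrib distrib_right)
    also have "1/2 * ((\<Sum>k\<in>K. exp (m * (a k + 2 * w n y k)) + exp (- m * (a k + 2 * w n y k)))
        + (\<Sum>k\<in>K. exp (m * (a k + (-2) * w n y k)) + exp (- m * (a k + (-2) * w n y k))))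
       = (\<Sum>k\<in>K. (exp (m * a k) + exp (- m * a k)) * cosh (2 * m * w n y k))"
      unfolding sum.distrib[symmetric] sum_distrib_left
      by (intro sum.cong) (auto simp: cosh_def field_simps exp_add exp_diff exp_minus)
    finally show "(\<integral>\<^sup>+x. ennreal ((F (\<lambda>k. a k + 2 * w n y k) x + F (\<lambda>k. a k + (-2) * w n y k) x) / 2) \<partial>PiM {..<n} (\<lambda>_. N))
       \<le> ennreal ((\<Sum>k\<in>K. (exp (m * a k) + exp (- m * a k)) * cosh (2 * m * w n y k)) * c ^ n)" .
  qed
  also have "\<dots> = (\<integral>\<^sup>+y. (\<Sum>k\<in>K. ennreal ((exp (m * a k) + exp (- m * a k)) * c ^ n) * ennreal (cosh (2 * m * w n y k))) \<partial>N)"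
    using c0 by (intro nn_integral_cong)
      (auto simp: sum_distrib_right sum_distrib_left ennreal_mult'[symmetric] sum_ennreal mult_ac intro!: arg_cong[where f = ennreal] sum.cong)
  also have "\<dots> = (\<Sum>k\<in>K. ennreal ((exp (m * a k) + exp (- m * a k)) * c ^ n) * (\<integral>\<^sup>+y. ennreal (cosh (2 * m * w n y k)) \<partial>N))"
    using coshm by (subst nn_integral_sum) (auto simp: nn_integral_cmult)
  also have "\<dots> \<le> (\<Sum>k\<in>K. ennreal ((exp (m * a k) + exp (- m * a k)) * c ^ n) * ennreal c)"
    using Suc.prems(3) by (intro sum_mono mult_left_mono) auto
  also have "\<dots> = ennreal ((\<Sum>k\<in>K. exp (m * a k) + exp (- m * a k)) * c ^ Suc n)"
    using c0 by (auto simp: sum_distrib_right sum_distrib_left ennreal_mult'[symmetric] sum_ennreal mult_ac intro!: arg_cong[where f = ennreal] sum.cong)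
  finally show ?case .
qed

subsection \<open>Uniform deviation of score increments\<close>

text \<open>For \<open>t\<close> the deviation of \<open>(d \<beta>, d)\<close> from \<open>(d \<beta>\<^sup>*, 1)\<close>, the residual \<open>d (y\<^sub>i - x\<^sub>i \<beta>)\<close> is
  \<open>\<xi>\<^sub>i + lin p x\<^sub>i \<xi>\<^sub>i t\<close>; index \<open>p\<close> stands for the inverse scale \<open>d\<close>.\<close>

definition feat :: "nat \<Rightarrow> (nat \<Rightarrow> real) \<Rightarrow> real \<Rightarrow> nat \<Rightarrow> real" where
  "feat p x u k = (if k < p then - x k else u)"

definition lin :: "nat \<Rightarrow> (nat \<Rightarrow> real) \<Rightarrow> real \<Rightarrow> (nat \<Rightarrow> real) \<Rightarrow> real" where
  "lin p x u t = (\<Sum>k\<le>p. feat p x u k * t k)"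

text \<open>Vectors with \<open>p + 1\<close> coordinates are functions on \<open>nat\<close> that
  vanish beyond \<open>p\<close>. This accommodates a dimension that varies with \<open>n\<close>,
  and the product topology provides separability and compactness.\<close>

definition l1_ball :: "nat \<Rightarrow> real \<Rightarrow> (nat \<Rightarrow> real) set" where
  "l1_ball p m = {t. (\<forall>k>p. t k = 0) \<and> (\<Sum>k\<le>p. \<bar>t k\<bar>) \<le> m}"

lemma abs_feat_le:
  assumes "\<And>k. k < p \<Longrightarrow> \<bar>x k\<bar> \<le> K" "1 \<le> K"
  shows "\<bar>feat p x u k\<bar> \<le> K * (1 + \<bar>u\<bar>)"
proof -
  have "\<bar>u\<bar> \<le> K * \<bar>u\<bar>" using assms(2) mult_right_mono[of 1 K "\<bar>u\<bar>"] by simp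
  moreover have "0 \<le> K * \<bar>u\<bar>" using assms(2) by simp
  ultimately show ?thesis using assms(1)[of k] assms(2) by (auto simp: feat_def algebra_simps)
qed

lemma lin_diff: "lin p x u t - lin p x u t' = lin p x u (\<lambda>k. t k - t' k)"
  by (simp add: lin_def sum_subtractf algebra_simps)

lemma lin_zero [simp]: "lin p x u (\<lambda>_. 0) = 0"
  by (simp add: lin_def)

lemma lin_eq: "lin p x u t = u * t p - (\<Sum>k<p. x k * t k)"
  unfolding lin_def by (simp add: lessThan_Suc_atMost[symmetric] feat_def sum_negf)

lemma abs_lin_le:
  assumes "\<And>k. k < p \<Longrightarrow> \<bar>x k\<bar> \<le> K" "1 \<le> K"
  shows "\<bar>lin p x u t\<bar> \<le> K * (1 + \<bar>u\<bar>) * (\<Sum>k\<le>p. \<bar>t k\<bar>)"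
proof -
  have "\<bar>lin p x u t\<bar> \<le> (\<Sum>k\<le>p. \<bar>feat p x u k\<bar> * \<bar>t k\<bar>)"
    unfolding lin_def using sum_abs[of "\<lambda>k. feat p x u k * t k" "{..p}"] by (simp add: abs_mult)
  also have "\<dots> \<le> (\<Sum>k\<le>p. K * (1 + \<bar>u\<bar>) * \<bar>t k\<bar>)"
    by (intro sum_mono mult_right_mono abs_feat_le[OF assms]) auto
  finally show ?thesis by (simp add: sum_distrib_left)
qed

lemma borel_measurable_feat [measurable]: "(\<lambda>u. feat p x u k) \<in> borel_measurable borel"
  by (simp add: feat_def)

lemma borel_measurable_lin [measurable]: "(\<lambda>u. lin p x u t) \<in> borel_measurable borel"
  by (simp add: lin_eq)

lemma cosh_le_one_plus_square:
  fixes y :: real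
  assumes "\<bar>y\<bar> \<le> 1"
  shows "cosh y \<le> 1 + y\<^sup>2"
proof -
  have "cosh z \<le> 1 + z\<^sup>2" if "0 \<le> z" "z \<le> 1" for z :: real
  proof -
    have "exp z \<le> 1 + z + z\<^sup>2" using that by (rule exp_bound)
    moreover have "exp (- z) \<le> 1 - z + z\<^sup>2"
    proof -
      have "1 \<le> 1 + z ^ 3" using that by simp
      also have "\<dots> = (1 - z + z\<^sup>2) * (1 + z)" by (simp add: algebra_simps power2_eq_square power3_eq_cube)
      also have "\<dots> \<le> (1 - z + z\<^sup>2) * exp z"
        using that exp_ge_add_one_self[of z] by (intro mult_left_mono) auto
      finally show ?thesis by (simp add: exp_minus field_simps)
    qed
    ultimately show ?thesis by (simp add: cosh_def)
  qed
  from this[of "\<bar>y\<bar>"] assms show ?thesis by simp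
qed

text \<open>The range \<open>(1 + |u|) * M0\<close> does not depend on \<open>n\<close>: for
  predictors bounded by \<open>K\<close> the shift is at most \<open>K * (1 + |u|)\<close> times the
  radius, so that the size of the design enters only through the condition
  \<open>K * m \<le> M0\<close>.\<close>

locale lipschitz_noise = prob_space N for N :: "real measure" +
  fixes h G :: "real \<Rightarrow> real" and M0 :: real
  assumes sets_N [measurable_cong]: "sets N = sets borel"
    and h_meas [measurable]: "h \<in> borel_measurable borel"
    and G_meas [measurable]: "G \<in> borel_measurable borel"
    and G_pos: "0 < G u"
    and M0_pos: "0 < M0"
    and lip_AE: "AE u in N. \<forall>a b. max \<bar>a\<bar> \<bar>b\<bar> \<le> (1 + \<bar>u\<bar>) * M0 \<longrightarrow>
                   \<bar>h (u + a) - h (u + b)\<bar> \<le> G u * \<bar>a - b\<bar>"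
    and envelope_int: "integrable N (\<lambda>u. (G u * (1 + \<bar>u\<bar>)\<^sup>2)\<^sup>2)"
begin

text \<open>One factor \<open>1 + |u|\<close> bounds the feature that multiplies the score, the
  other the shift of its argument.\<close>

definition V :: "real \<Rightarrow> real" where "V u = G u * (1 + \<bar>u\<bar>)\<^sup>2"

definition v :: real where "v = (\<integral>u. (V u)\<^sup>2 \<partial>N)"

definition good :: "real \<Rightarrow> bool" where
  "good u \<longleftrightarrow> (\<forall>a b. max \<bar>a\<bar> \<bar>b\<bar> \<le> (1 + \<bar>u\<bar>) * M0 \<longrightarrow> \<bar>h (u + a) - h (u + b)\<bar> \<le> G u * \<bar>a - b\<bar>)"

definition incr :: "nat \<Rightarrow> (nat \<Rightarrow> real) \<Rightarrow> nat \<Rightarrow> real \<Rightarrow> (nat \<Rightarrow> real) \<Rightarrow> real" where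
  "incr p x j u t = (h (u + lin p x u t) - h u) * feat p x u j"

lemma V_meas [measurable]: "V \<in> borel_measurable borel"
  unfolding V_def[abs_def] by measurable

lemma V_pos: "0 < V u"
  by (simp add: V_def G_pos)

lemma V2_int: "integrable N (\<lambda>u. (V u)\<^sup>2)"
  using envelope_int by (simp add: V_def)

lemma v_nonneg: "0 \<le> v"
  by (simp add: v_def)

lemma AE_good: "AE u in N. good u"
  using lip_AE by (simp add: good_def)

lemma incr_meas [measurable]: "(\<lambda>u. incr p x j u t) \<in> borel_measurable borel"
  unfolding incr_def by measurable

context
  fixes p :: nat and x :: "nat \<Rightarrow> real" and K m :: real
  assumes x: "\<And>k. k < p \<Longrightarrow> \<bar>x k\<bar> \<le> K" and K: "1 \<le> K" and Km: "K * m \<le> M0"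
begin

lemma lin_in_range:
  assumes "t \<in> l1_ball p m"
  shows "\<bar>lin p x u t\<bar> \<le> (1 + \<bar>u\<bar>) * M0"
proof -
  have "\<bar>lin p x u t\<bar> \<le> K * (1 + \<bar>u\<bar>) * (\<Sum>k\<le>p. \<bar>t k\<bar>)" by (rule abs_lin_le[OF x K])
  also have "\<dots> \<le> K * (1 + \<bar>u\<bar>) * m"
    using assms K by (intro mult_left_mono) (auto simp: l1_ball_def)
  also have "\<dots> = (1 + \<bar>u\<bar>) * (K * m)" by simp
  also have "\<dots> \<le> (1 + \<bar>u\<bar>) * M0" using Km by (intro mult_left_mono) auto
  finally show ?thesis .
qed

lemma incr_lipschitz:
  assumes "good u" "t \<in> l1_ball p m" "t' \<in> l1_ball p m"
  shows "\<bar>incr p x j u t - incr p x j u t'\<bar> \<le> G u * \<bar>feat p x u j\<bar> * \<bar>lin p x u t - lin p x u t'\<bar>"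
proof -
  have "\<bar>incr p x j u t - incr p x j u t'\<bar>
      = \<bar>h (u + lin p x u t) - h (u + lin p x u t')\<bar> * \<bar>feat p x u j\<bar>"
    unfolding incr_def by (simp add: abs_mult flip: left_diff_distrib)
  also have "\<dots> \<le> (G u * \<bar>lin p x u t - lin p x u t'\<bar>) * \<bar>feat p x u j\<bar>"
    using assms lin_in_range[OF assms(2), of u] lin_in_range[OF assms(3), of u]
    by (intro mult_right_mono) (auto simp: good_def)
  finally show ?thesis by (simp add: mult_ac)
qed

lemma feat_lin_le: "G u * \<bar>feat p x u j\<bar> * \<bar>lin p x u t\<bar> \<le> K\<^sup>2 * V u * (\<Sum>k\<le>p. \<bar>t k\<bar>)"
proof -
  have "G u * \<bar>feat p x u j\<bar> * \<bar>lin p x u t\<bar>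
      \<le> G u * (K * (1 + \<bar>u\<bar>)) * (K * (1 + \<bar>u\<bar>) * (\<Sum>k\<le>p. \<bar>t k\<bar>))"
    using abs_feat_le[OF x K, where u = u and k = j] abs_lin_le[OF x K, where u = u and t = t] G_pos[of u] K
    by (intro mult_mono mult_nonneg_nonneg) (auto simp: less_imp_le sum_nonneg)
  thus ?thesis by (simp add: V_def power2_eq_square mult_ac)
qed

lemma incr_diff_le:
  assumes "good u" "t \<in> l1_ball p m" "t' \<in> l1_ball p m"
  shows "\<bar>incr p x j u t - incr p x j u t'\<bar> \<le> K\<^sup>2 * V u * (\<Sum>k\<le>p. \<bar>t k - t' k\<bar>)"
  using incr_lipschitz[OF assms, of j] feat_lin_le[of u j "\<lambda>k. t k - t' k"] by (simp add: lin_diff)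

lemma incr_zero [simp]: "incr p x j u (\<lambda>_. 0) = 0"
  by (simp add: incr_def)

lemma incr_le:
  assumes "good u" "t \<in> l1_ball p m"
  shows "\<bar>incr p x j u t\<bar> \<le> G u * \<bar>feat p x u j\<bar> * \<bar>lin p x u t\<bar>"
    "\<bar>incr p x j u t\<bar> \<le> K\<^sup>2 * V u * m"
proof -
  have m: "0 \<le> m" "(\<Sum>k\<le>p. \<bar>t k\<bar>) \<le> m" using assms(2)
    by (auto simp: l1_ball_def intro: order_trans[OF sum_nonneg])
  hence "(\<lambda>_. 0) \<in> l1_ball p m" by (simp add: l1_ball_def)
  from incr_lipschitz[OF assms this, of j]
  show *: "\<bar>incr p x j u t\<bar> \<le> G u * \<bar>feat p x u j\<bar> * \<bar>lin p x u t\<bar>" by simp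
  note *
  also have "\<dots> \<le> K\<^sup>2 * V u * (\<Sum>k\<le>p. \<bar>t k\<bar>)" by (rule feat_lin_le)
  also have "\<dots> \<le> K\<^sup>2 * V u * m" using m V_pos[of u] by (intro mult_left_mono) auto
  finally show "\<bar>incr p x j u t\<bar> \<le> K\<^sup>2 * V u * m" .
qed

end

text \<open>The truncation uses the envelope and not the increment. It is thus the same event for
  all \<open>t\<close> and \<open>j\<close> and preserves the Lipschitz property in
  \<open>t\<close>.\<close>

definition tincr :: "real \<Rightarrow> nat \<Rightarrow> (nat \<Rightarrow> real) \<Rightarrow> nat \<Rightarrow> real \<Rightarrow> (nat \<Rightarrow> real) \<Rightarrow> real" where
  "tincr B p x j u t = incr p x j u t * indicator {u. V u \<le> B} u"

lemma tincr_meas [measurable]: "(\<lambda>u. tincr B p x j u t) \<in> borel_measurable borel"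
  unfolding tincr_def by measurable

text \<open>Chernoff bound. On the truncation event the weights satisfy
  \<open>2 * m * |w| \<le> r * V \<le> 1\<close>, hence \<open>cosh\<close> is at most
  \<open>1 + r^2 * V^2\<close> and \<open>n\<close> summands cost at most
  \<open>exp (n * r^2 * v)\<close>; the threshold contributes \<open>exp (- n * r^2 * c)\<close>.
  The sign \<open>sg\<close> covers both tails.\<close>

lemma emeasure_truncated_deviation:
  fixes x :: "nat \<Rightarrow> nat \<Rightarrow> real" and T :: "(nat \<Rightarrow> real) set"
  assumes T: "finite T" "T \<noteq> {}" "T \<subseteq> l1_ball p m" and m: "0 < m"
    and x: "\<And>i k. i < n \<Longrightarrow> k < p \<Longrightarrow> \<bar>x i k\<bar> \<le> K" and K: "1 \<le> K" and Km: "K * m \<le> M0"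
    and n: "0 < n" and r: "0 < r" "B * r \<le> 1" and B: "0 \<le> B" and sg: "\<bar>sg\<bar> = (1::real)"
  shows "emeasure (PiM {..<n} (\<lambda>_. N)) {\<omega>\<in>space (PiM {..<n} (\<lambda>_. N)). \<exists>t\<in>T.
      2 * K\<^sup>2 * m * c * r < sg * (\<Sum>i<n. tincr B p (x i) j (\<omega> i) t - (\<integral>u. tincr B p (x i) j u t \<partial>N)) / n}
    \<le> ennreal (2 * (real p + 1) * exp (n * r\<^sup>2 * (v - c)))"
proof -
  \<comment> \<open>The Chernoff parameter, normalized so that
    \<open>2 * m * \<mu> * K^2 = r\<close>.\<close>
  define \<mu> where "\<mu> = r / (2 * m * K\<^sup>2)"
  have mu: "0 < \<mu>" using r m K by (simp add: \<mu>_def)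
  have muB: "2 * m * \<mu> * K\<^sup>2 = r" using m K by (simp add: \<mu>_def)
  define \<phi> where "\<phi> i u t = sg * \<mu> * (if i < n then tincr B p (x i) j u t else 0)" for i u t
  define w where "w i u k = \<mu> * (G u * \<bar>feat p (x i) u j\<bar> * feat p (x i) u k * indicator {u. V u \<le> B} u)" for i u k
  have ws: "(\<Sum>k\<le>p. w i u k * t k) = \<mu> * (G u * \<bar>feat p (x i) u j\<bar> * lin p (x i) u t) * indicator {u. V u \<le> B} u" for i u t
    by (simp add: w_def lin_def sum_distrib_left sum_distrib_right mult_ac)
  interpret P: prob_space "PiM {..<n} (\<lambda>_. N)" by (intro prob_space_PiM) unfold_locales
  have \<phi>m[measurable]: "(\<lambda>u. \<phi> i u t) \<in> borel_measurable N" for i t unfolding \<phi>_def by measurable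
  have wm[measurable]: "(\<lambda>u. w i u k) \<in> borel_measurable N" for i k unfolding w_def by measurable
  have "(\<integral>\<^sup>+\<omega>. ennreal (max_exp T (\<lambda>t. (\<Sum>k\<in>{..p}. 0 * t k)
            + (\<Sum>i<n. \<phi> i (\<omega> i) t - (\<integral>u. \<phi> i u t \<partial>N)))) \<partial>PiM {..<n} (\<lambda>_. N))
       \<le> ennreal ((\<Sum>k\<in>{..p}. exp (m * 0) + exp (- m * 0)) * (1 + r\<^sup>2 * v) ^ n)"
  proof (rule nn_integral_PiM_max_exp_le[OF prob_space_axioms T(1,2), where w = w and B = "\<mu> * K\<^sup>2 * B * m"])
    fix t assume "t \<in> T" thus "(\<Sum>k\<le>p. \<bar>t k\<bar>) \<le> m" using T(3) by (auto simp: l1_ball_def)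
  next
    fix i assume i: "i < n"
    note xi = x[OF i]
    show "AE u in N. \<forall>t\<in>T. \<forall>t'\<in>T. \<bar>\<phi> i u t - \<phi> i u t'\<bar> \<le> \<bar>(\<Sum>k\<le>p. w i u k * t k) - (\<Sum>k\<le>p. w i u k * t' k)\<bar>"
      using AE_good
    proof eventually_elim
      case (elim u)
      have "\<bar>\<phi> i u t - \<phi> i u t'\<bar> \<le> \<bar>(\<Sum>k\<le>p. w i u k * t k) - (\<Sum>k\<le>p. w i u k * t' k)\<bar>" if "t \<in> T" "t' \<in> T" for t t'
      proof -
        have tt: "t \<in> l1_ball p m" "t' \<in> l1_ball p m" using that T(3) by auto
        have "\<bar>\<phi> i u t - \<phi> i u t'\<bar> = \<mu> * \<bar>incr p (x i) j u t - incr p (x i) j u t'\<bar> * indicator {u. V u \<le> B} u"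
          using mu sg i by (simp add: \<phi>_def tincr_def abs_mult flip: right_diff_distrib left_diff_distrib)
        also have "\<dots> \<le> \<mu> * (G u * \<bar>feat p (x i) u j\<bar> * \<bar>lin p (x i) u t - lin p (x i) u t'\<bar>) * indicator {u. V u \<le> B} u"
          using incr_lipschitz[OF xi K Km elim tt, where j = j] mu
          by (intro mult_right_mono mult_left_mono) auto
        also have "\<dots> = \<bar>(\<Sum>k\<le>p. w i u k * t k) - (\<Sum>k\<le>p. w i u k * t' k)\<bar>"
          unfolding ws using mu G_pos[of u]
          by (simp add: abs_mult flip: right_diff_distrib left_diff_distrib)
        finally show ?thesis .
      qed
      thus ?case by blast
    qed
    show "AE u in N. \<forall>t\<in>T. \<bar>\<phi> i u t\<bar> \<le> \<bar>\<Sum>k\<le>p. w i u k * t k\<bar> \<and> \<bar>\<Sum>k\<le>p. w i u k * t k\<bar> \<le> \<mu> * K\<^sup>2 * B * m"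
      using AE_good
    proof eventually_elim
      case (elim u)
      have "\<bar>\<phi> i u t\<bar> \<le> \<bar>\<Sum>k\<le>p. w i u k * t k\<bar> \<and> \<bar>\<Sum>k\<le>p. w i u k * t k\<bar> \<le> \<mu> * K\<^sup>2 * B * m" if "t \<in> T" for t
      proof
        have tt: "t \<in> l1_ball p m" using that T(3) by auto
        have a: "\<bar>\<Sum>k\<le>p. w i u k * t k\<bar> = \<mu> * (G u * \<bar>feat p (x i) u j\<bar> * \<bar>lin p (x i) u t\<bar>) * indicator {u. V u \<le> B} u"
          unfolding ws using mu G_pos[of u] by (simp add: abs_mult)
        have "\<bar>\<phi> i u t\<bar> = \<mu> * \<bar>incr p (x i) j u t\<bar> * indicator {u. V u \<le> B} u"
          using mu sg i by (simp add: \<phi>_def tincr_def abs_mult)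
        also have "\<dots> \<le> \<bar>\<Sum>k\<le>p. w i u k * t k\<bar>"
          unfolding a using incr_le(1)[OF xi K Km elim tt, where j = j] mu
          by (intro mult_right_mono mult_left_mono) auto
        finally show "\<bar>\<phi> i u t\<bar> \<le> \<bar>\<Sum>k\<le>p. w i u k * t k\<bar>" .
        have "\<mu> * (G u * \<bar>feat p (x i) u j\<bar> * \<bar>lin p (x i) u t\<bar>) \<le> \<mu> * (K\<^sup>2 * V u * m)"
        proof (rule mult_left_mono)
          have "G u * \<bar>feat p (x i) u j\<bar> * \<bar>lin p (x i) u t\<bar> \<le> K\<^sup>2 * V u * (\<Sum>k\<le>p. \<bar>t k\<bar>)"
            by (rule feat_lin_le[OF xi K Km])
          also have "\<dots> \<le> K\<^sup>2 * V u * m" using tt V_pos[of u] by (intro mult_left_mono) (auto simp: l1_ball_def)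
          finally show "G u * \<bar>feat p (x i) u j\<bar> * \<bar>lin p (x i) u t\<bar> \<le> K\<^sup>2 * V u * m" .
        qed (use mu in auto)
        hence "\<bar>\<Sum>k\<le>p. w i u k * t k\<bar> \<le> \<mu> * (K\<^sup>2 * V u * m) * indicator {u. V u \<le> B} u"
          unfolding a by (intro mult_right_mono) auto
        also have "\<dots> \<le> \<mu> * K\<^sup>2 * B * m" using mu m K B by (auto simp: indicator_def)
        finally show "\<bar>\<Sum>k\<le>p. w i u k * t k\<bar> \<le> \<mu> * K\<^sup>2 * B * m" .
      qed
      thus ?case by blast
    qed
    fix k assume "k \<in> {..p}"
    have "cosh (2 * m * w i u k) \<le> 1 + r\<^sup>2 * (V u)\<^sup>2" for u
    proof (cases "V u \<le> B")
      case True
      have "G u * \<bar>feat p (x i) u j\<bar> * \<bar>feat p (x i) u k\<bar> \<le> G u * (K * (1 + \<bar>u\<bar>)) * (K * (1 + \<bar>u\<bar>))"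
        using abs_feat_le[OF xi K, where u = u and k = j] abs_feat_le[OF xi K, where u = u and k = k] G_pos[of u] K
        by (intro mult_mono mult_nonneg_nonneg) (auto simp: less_imp_le)
      hence "2 * m * \<mu> * (G u * \<bar>feat p (x i) u j\<bar> * \<bar>feat p (x i) u k\<bar>) \<le> 2 * m * \<mu> * (K\<^sup>2 * V u)"
        using m mu by (intro mult_left_mono) (auto simp: V_def power2_eq_square mult_ac)
      also have "\<dots> = r * V u" using muB by (simp add: mult.assoc[symmetric])
      finally have le: "\<bar>2 * m * w i u k\<bar> \<le> r * V u"
        using True m mu G_pos[of u] by (simp add: w_def abs_mult mult_ac)
      also have "\<dots> \<le> r * B" using True r by simp
      finally have "\<bar>2 * m * w i u k\<bar> \<le> 1" using r by (simp add: mult.commute)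
      hence "cosh (2 * m * w i u k) \<le> 1 + (2 * m * w i u k)\<^sup>2" by (rule cosh_le_one_plus_square)
      also have "(2 * m * w i u k)\<^sup>2 \<le> (r * V u)\<^sup>2" using power_mono[OF le, of 2] by simp
      finally show ?thesis by (simp add: power_mult_distrib)
    qed (simp add: w_def)
    hence "(\<integral>\<^sup>+u. ennreal (cosh (2 * m * w i u k)) \<partial>N) \<le> (\<integral>\<^sup>+u. ennreal (1 + r\<^sup>2 * (V u)\<^sup>2) \<partial>N)"
      by (intro nn_integral_mono ennreal_leI)
    also have "\<dots> = ennreal (\<integral>u. 1 + r\<^sup>2 * (V u)\<^sup>2 \<partial>N)"
      using V2_int by (intro nn_integral_eq_integral) auto
    also have "(\<integral>u. 1 + r\<^sup>2 * (V u)\<^sup>2 \<partial>N) = 1 + r\<^sup>2 * v"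
      using V2_int by (simp add: v_def prob_space)
    finally show "(\<integral>\<^sup>+u. ennreal (cosh (2 * m * w i u k)) \<partial>N) \<le> ennreal (1 + r\<^sup>2 * v)" .
  qed (use v_nonneg in auto)
  \<comment> \<open>With offset zero, each of the \<open>p + 1\<close> coordinates contributes its
    two vertices, hence \<open>2 * (p + 1)\<close>.\<close>
  also have "(\<Sum>k\<in>{..p}. exp (m * 0) + exp (- m * 0)) * (1 + r\<^sup>2 * v) ^ n \<le> 2 * (real p + 1) * exp (n * r\<^sup>2 * v)"
  proof -
    have "(1 + r\<^sup>2 * v) ^ n \<le> exp (r\<^sup>2 * v) ^ n" using v_nonneg by (intro power_mono) auto
    also have "\<dots> = exp (n * r\<^sup>2 * v)" by (simp add: exp_of_nat_mult[symmetric] mult_ac)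
    finally have "2 * (real p + 1) * (1 + r\<^sup>2 * v) ^ n \<le> 2 * (real p + 1) * exp (n * r\<^sup>2 * v)"
      by (intro mult_left_mono) auto
    thus ?thesis by (simp add: algebra_simps)
  qed
  finally have I: "(\<integral>\<^sup>+\<omega>. ennreal (max_exp T (\<lambda>t. \<Sum>i<n. \<phi> i (\<omega> i) t - (\<integral>u. \<phi> i u t \<partial>N))) \<partial>PiM {..<n} (\<lambda>_. N))
      \<le> ennreal (2 * (real p + 1) * exp (n * r\<^sup>2 * v))"
    by (simp add: ennreal_leI)
  define F where "F \<omega> = max_exp T (\<lambda>t. \<Sum>i<n. \<phi> i (\<omega> i) t - (\<integral>u. \<phi> i u t \<partial>N))" for \<omega>
  have \<phi>c: "(\<lambda>\<omega>. \<phi> i (\<omega> i) t) \<in> borel_measurable (PiM {..<n} (\<lambda>_. N))" if "i < n" for i t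
  proof -
    have "i \<in> {..<n}" using that by simp
    from measurable_compose[OF measurable_component_singleton[OF this] \<phi>m[of i t]] show ?thesis .
  qed
  have fm[measurable]: "F \<in> borel_measurable (PiM {..<n} (\<lambda>_. N))"
    unfolding F_def
    by (intro borel_measurable_max_exp[OF T(1,2)] borel_measurable_sum borel_measurable_diff
      \<phi>c) auto
  let ?S = "{\<omega>\<in>space (PiM {..<n} (\<lambda>_. N)). \<exists>t\<in>T.
      2 * K\<^sup>2 * m * c * r < sg * (\<Sum>i<n. tincr B p (x i) j (\<omega> i) t - (\<integral>u. tincr B p (x i) j u t \<partial>N)) / n}"
  let ?S' = "{\<omega>\<in>space (PiM {..<n} (\<lambda>_. N)).
      1 \<le> ennreal (exp (- (n * r\<^sup>2 * c))) * ennreal (F \<omega>)}"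
  have sub: "?S \<subseteq> ?S'"
  proof safe
    fix \<omega> t assume t: "t \<in> T"
      and gt: "2 * K\<^sup>2 * m * c * r < sg * (\<Sum>i<n. tincr B p (x i) j (\<omega> i) t - (\<integral>u. tincr B p (x i) j u t \<partial>N)) / n"
    have "n * r\<^sup>2 * c = \<mu> * n * (2 * K\<^sup>2 * m * c * r)"
      using muB[symmetric] by (simp add: power2_eq_square mult_ac)
    also have "\<dots> \<le> \<mu> * n * (sg * (\<Sum>i<n. tincr B p (x i) j (\<omega> i) t - (\<integral>u. tincr B p (x i) j u t \<partial>N)) / n)"
      using gt mu by (intro mult_left_mono) auto
    also have "\<dots> = (\<Sum>i<n. \<phi> i (\<omega> i) t - (\<integral>u. \<phi> i u t \<partial>N))"
    proof -
      have "(\<Sum>i<n. \<phi> i (\<omega> i) t - (\<integral>u. \<phi> i u t \<partial>N))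
          = (\<Sum>i<n. sg * \<mu> * (tincr B p (x i) j (\<omega> i) t - (\<integral>u. tincr B p (x i) j u t \<partial>N)))"
        by (intro sum.cong) (auto simp: \<phi>_def right_diff_distrib)
      thus ?thesis using n by (simp add: sum_distrib_left[symmetric])
    qed
    finally have "exp (n * r\<^sup>2 * c) \<le> F \<omega>"
      unfolding F_def using max_exp_ge[OF T(1) t, of "\<lambda>t. \<Sum>i<n. \<phi> i (\<omega> i) t - (\<integral>u. \<phi> i u t \<partial>N)"]
      by (meson exp_le_cancel_iff order_trans)
    hence "1 \<le> exp (- (n * r\<^sup>2 * c)) * F \<omega>"
      by (simp add: exp_minus field_simps)
    thus "1 \<le> ennreal (exp (- (n * r\<^sup>2 * c))) * ennreal (F \<omega>)"
      by (simp flip: ennreal_mult')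
  qed
  have S'_meas: "?S' \<in> sets (PiM {..<n} (\<lambda>_. N))"
  proof -
    have "(\<lambda>\<omega>. ennreal (exp (- (n * r\<^sup>2 * c))) * ennreal (F \<omega>)) \<in> borel_measurable (PiM {..<n} (\<lambda>_. N))"
      by (intro borel_measurable_times measurable_compose[OF fm]) auto
    from measurable_sets[OF this, of "{1..}"] show ?thesis
      by (auto simp: vimage_def Int_def conj_commute)
  qed
  have "emeasure (PiM {..<n} (\<lambda>_. N)) ?S \<le> emeasure (PiM {..<n} (\<lambda>_. N)) ?S'"
    by (intro emeasure_mono sub S'_meas)
  also have "\<dots> \<le> ennreal (exp (- (n * r\<^sup>2 * c))) * (\<integral>\<^sup>+\<omega>. ennreal (F \<omega>)
       * indicator (space (PiM {..<n} (\<lambda>_. N))) \<omega> \<partial>PiM {..<n} (\<lambda>_. N))"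
    by (intro nn_integral_Markov_inequality borel_measurable_times measurable_compose[OF fm] borel_measurable_indicator) auto
  also have "\<dots> \<le> ennreal (exp (- (n * r\<^sup>2 * c))) * ennreal (2 * (real p + 1) * exp (n * r\<^sup>2 * v))"
    by (intro mult_left_mono order_trans[OF _ I[folded F_def]] nn_integral_mono) (auto simp: indicator_def)
  also have "\<dots> = ennreal (2 * (real p + 1) * exp (n * r\<^sup>2 * (v - c)))"
    by (subst ennreal_mult'[symmetric]) (auto simp: right_diff_distrib exp_diff exp_minus field_simps)
  finally show ?thesis .
qed

end

text \<open>Replaces a union over the ball by a countable one, so that the exceptional event stays
  measurable. Convergence in the product topology is \<open>l1\<close> convergence here, because
  only finitely many coordinates are involved.\<close>

lemma l1_ball_countable_dense:
  obtains T where "countable T" "T \<subseteq> l1_ball p m"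
    "\<And>t e. t \<in> l1_ball p m \<Longrightarrow> 0 < e \<Longrightarrow> \<exists>t'\<in>T. (\<Sum>k\<le>p. \<bar>t k - t' k\<bar>) < e"
proof -
  obtain T :: "(nat \<Rightarrow> real) set" where T: "countable T" "T \<subseteq> l1_ball p m" "l1_ball p m \<subseteq> closure T"
    by (rule separable[of "l1_ball p m"])
  have "\<exists>t'\<in>T. (\<Sum>k\<le>p. \<bar>t k - t' k\<bar>) < e" if t: "t \<in> l1_ball p m" and e: "0 < e" for t e
  proof -
    obtain g where g: "\<And>n. g n \<in> T" "g \<longlonglongrightarrow> t"
    proof -
      have "t \<in> closure T" using t T(3) by blast
      thus ?thesis using that by (auto simp: closure_sequential)
    qed
    have "(\<lambda>n. g n k) \<longlonglongrightarrow> t k" for k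
    proof -
      have "isCont (\<lambda>f :: nat \<Rightarrow> real. f k) t"
        by (rule iffD1[OF continuous_on_eq_continuous_at[OF open_UNIV] continuous_on_product_coordinates, THEN bspec]) simp
      thus ?thesis using g(2) by (rule isCont_tendsto_compose)
    qed
    hence "(\<lambda>n. \<Sum>k\<le>p. \<bar>t k - g n k\<bar>) \<longlonglongrightarrow> (\<Sum>k\<le>p. \<bar>t k - t k\<bar>)"
      by (intro tendsto_intros)
    hence "(\<lambda>n. \<Sum>k\<le>p. \<bar>t k - g n k\<bar>) \<longlonglongrightarrow> 0" by simp
    from order_tendstoD(2)[OF this e] obtain n where "(\<Sum>k\<le>p. \<bar>t k - g n k\<bar>) < e"
      by (auto simp: eventually_sequentially)
    thus ?thesis using g(1) by blast
  qed
  with T(1,2) show ?thesis using that by blast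
qed

context lipschitz_noise
begin

definition tail :: "real \<Rightarrow> real" where
  "tail B = (\<integral>u. (V u)\<^sup>2 * indicator {u. B < V u} u \<partial>N)"

lemma tail_int: "integrable N (\<lambda>u. (V u)\<^sup>2 * indicator {u. B < V u} u)"
  by (rule Bochner_Integration.integrable_bound[OF V2_int]) (auto simp: indicator_def)

lemma tail_le: "tail B \<le> v" and tail_nonneg: "0 \<le> tail B"
proof -
  show "tail B \<le> v" unfolding tail_def v_def
    by (intro integral_mono tail_int V2_int) (auto simp: indicator_def)
  show "0 \<le> tail B" by (simp add: tail_def)
qed

lemma V_int: "integrable N V"
proof (rule Bochner_Integration.integrable_bound[of N "\<lambda>u. 1 + (V u)\<^sup>2"])
  show "AE u in N. norm (V u) \<le> norm (1 + (V u)\<^sup>2)"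
  proof (rule AE_I2)
    fix u
    have "V u \<le> 1 + (V u)\<^sup>2" using zero_le_power2[of "V u - 1"] V_pos[of u]
      by (simp add: power2_eq_square algebra_simps)
    thus "norm (V u) \<le> norm (1 + (V u)\<^sup>2)" using V_pos[of u] by simp
  qed
qed (use V2_int in auto)

text \<open>Above the level \<open>1 / r\<close> one has \<open>V \<le> r * V^2\<close>. The factor
  \<open>r\<close> gained here cancels the threshold \<open>r\<close> in the later application of
  Markov's inequality.\<close>

lemma tail_first_moment:
  assumes r: "0 < r"
  shows "integrable N (\<lambda>u. V u * indicator {u. 1 / r < V u} u)"
    "(\<integral>u. V u * indicator {u. 1 / r < V u} u \<partial>N) \<le> r * tail (1 / r)"
proof -
  show i: "integrable N (\<lambda>u. V u * indicator {u. 1 / r < V u} u)"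
    by (rule Bochner_Integration.integrable_bound[OF V_int]) (auto simp: indicator_def)
  have "(\<integral>u. V u * indicator {u. 1 / r < V u} u \<partial>N) \<le> (\<integral>u. r * ((V u)\<^sup>2 * indicator {u. 1 / r < V u} u) \<partial>N)"
  proof (intro integral_mono i integrable_mult_right tail_int)
    fix u
    show "V u * indicator {u. 1 / r < V u} u \<le> r * ((V u)\<^sup>2 * indicator {u. 1 / r < V u} u)"
    proof (cases "1 / r < V u")
      case True
      hence "1 \<le> r * V u" using r by (simp add: field_simps)
      hence "1 * V u \<le> r * V u * V u" using V_pos[of u] by (intro mult_right_mono) auto
      thus ?thesis using True by (simp add: power2_eq_square mult.assoc)
    qed simp
  qed
  thus "(\<integral>u. V u * indicator {u. 1 / r < V u} u \<partial>N) \<le> r * tail (1 / r)"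
    by (simp add: tail_def)
qed

lemma tail_tendsto:
  assumes r: "r \<longlonglongrightarrow> 0" and rp: "eventually (\<lambda>n::nat. 0 < r n) sequentially"
  shows "(\<lambda>n. tail (1 / r n)) \<longlonglongrightarrow> 0"
proof -
  have "(\<lambda>n. \<integral>u. (V u)\<^sup>2 * indicator {u. 1 / r n < V u} u \<partial>N) \<longlonglongrightarrow> (\<integral>u. 0 \<partial>N)"
  proof (rule integral_dominated_convergence[where w = "\<lambda>u. (V u)\<^sup>2"])
    show "AE u in N. (\<lambda>n. (V u)\<^sup>2 * indicator {u. 1 / r n < V u} u) \<longlonglongrightarrow> 0"
    proof (rule AE_I2)
      fix u
      have "eventually (\<lambda>n. r n < 1 / V u) sequentially"
        using V_pos[of u] by (intro order_tendstoD(2)[OF r]) auto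
      hence "eventually (\<lambda>n. (V u)\<^sup>2 * indicator {u. 1 / r n < V u} u = 0) sequentially"
        using rp
      proof eventually_elim
        case (elim n)
        hence "V u < 1 / r n" using V_pos[of u] by (simp add: field_simps)
        thus ?case by simp
      qed
      thus "(\<lambda>n. (V u)\<^sup>2 * indicator {u. 1 / r n < V u} u) \<longlonglongrightarrow> 0" by (rule tendsto_eventually)
    qed
  qed (use V2_int in \<open>auto simp: indicator_def\<close>)
  thus ?thesis by (simp add: tail_def)
qed

text \<open>In the constant \<open>2 * c + 1 + v\<close>, the part \<open>2 * c\<close> comes from
  the truncated process, 1 from the empirical mean of the truncated-off envelope, and
  \<open>v\<close> from its expectation. The probability has a union bound over \<open>j\<close> and
  both signs, and the tail term from Markov's inequality.\<close>

lemma uniform_deviation: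
  fixes x :: "nat \<Rightarrow> nat \<Rightarrow> real" and n p :: nat and K m r c :: real
  defines "P \<equiv> PiM {..<n} (\<lambda>_. N)"
  assumes m: "0 < m"
    and x: "\<And>i k. i < n \<Longrightarrow> k < p \<Longrightarrow> \<bar>x i k\<bar> \<le> K" and K: "1 \<le> K" and Km: "K * m \<le> M0"
    and n: "0 < n" and r: "0 < r"
  shows "\<exists>E\<in>sets P. emeasure P E \<le> ennreal (4 * (real p + 1)\<^sup>2 * exp (n * r\<^sup>2 * (v - c)) + tail (1 / r)) \<and>
    (\<forall>\<omega>\<in>space P - E. \<forall>t\<in>l1_ball p m. \<forall>j\<le>p.
      \<bar>(\<Sum>i<n. incr p (x i) j (\<omega> i) t - (\<integral>u. incr p (x i) j u t \<partial>N)) / n\<bar> \<le> K\<^sup>2 * m * r * (2 * c + 1 + v))"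
proof -
  define B where "B = 1 / r"
  have B: "0 \<le> B" "B * r \<le> 1" using r by (auto simp: B_def)
  interpret P: prob_space P unfolding P_def by (intro prob_space_PiM) unfold_locales
  obtain T where T: "countable T" "T \<subseteq> l1_ball p m"
    "\<And>t e. t \<in> l1_ball p m \<Longrightarrow> 0 < e \<Longrightarrow> \<exists>t'\<in>T. (\<Sum>k\<le>p. \<bar>t k - t' k\<bar>) < e"
    using l1_ball_countable_dense by blast
  have "(\<lambda>_. 0) \<in> l1_ball p m" using m by (simp add: l1_ball_def)
  from T(3)[OF this, of 1] have Tne: "T \<noteq> {}" by auto
  \<comment> \<open>Finite sets increasing to the countable dense set; the deviation bound passes to
    the limit by continuity from below.\<close>
  define TT where "TT M = from_nat_into T ` {..M}" for M :: nat
  have TT: "finite (TT M)" "TT M \<noteq> {}" "TT M \<subseteq> T" for M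
    using from_nat_into[OF Tne] by (auto simp: TT_def)
  have TT_Un: "(\<Union>M. TT M) = T"
  proof
    show "T \<subseteq> (\<Union>M. TT M)"
    proof
      fix t assume "t \<in> T"
      hence "t = from_nat_into T (to_nat_on T t)" using T(1) by simp
      hence "t \<in> TT (to_nat_on T t)" unfolding TT_def by (intro image_eqI[where x = "to_nat_on T t"]) auto
      thus "t \<in> (\<Union>M. TT M)" by blast
    qed
  qed (use TT in auto)
  have comp: "(\<lambda>\<omega>. g (\<omega> i)) \<in> borel_measurable P" if "g \<in> borel_measurable borel" "i < n" for g :: "real \<Rightarrow> real" and i
  proof -
    have "i \<in> {..<n}" using that by simp
    moreover have "g \<in> borel_measurable N" using that(1) by measurable
    ultimately show ?thesis unfolding P_def
      by (intro measurable_compose[OF measurable_component_singleton[of i]])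
  qed
  define D where "D j \<omega> t = (\<Sum>i<n. tincr B p (x i) j (\<omega> i) t - (\<integral>u. tincr B p (x i) j u t \<partial>N))" for j \<omega> t
  define bad where "bad sg j t = {\<omega>\<in>space P. 2 * K\<^sup>2 * m * c * r < sg * D j \<omega> t / n}" for sg j t
  have bad_meas: "bad sg j t \<in> sets P" for sg j t
  proof -
    have "(\<lambda>\<omega>. sg * D j \<omega> t / n) \<in> borel_measurable P"
      unfolding D_def by (intro borel_measurable_divide borel_measurable_times borel_measurable_const
        borel_measurable_sum borel_measurable_diff comp) auto
    from measurable_sets[OF this, of "{2 * K\<^sup>2 * m * c * r<..}"]
    have "(\<lambda>\<omega>. sg * D j \<omega> t / n) -` {2 * K\<^sup>2 * m * c * r<..} \<inter> space P \<in> sets P" by simp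
    also have "(\<lambda>\<omega>. sg * D j \<omega> t / n) -` {2 * K\<^sup>2 * m * c * r<..} \<inter> space P = bad sg j t"
      unfolding bad_def by blast
    finally show ?thesis .
  qed
  define Bad where "Bad sg j = (\<Union>t\<in>T. bad sg j t)" for sg j
  have Bad_meas: "Bad sg j \<in> sets P" for sg j
    unfolding Bad_def using T(1) bad_meas by blast
  have Bad_le: "emeasure P (Bad sg j) \<le> ennreal (2 * (real p + 1) * exp (n * r\<^sup>2 * (v - c)))"
    if sg: "\<bar>sg\<bar> = 1" for sg j
  proof -
    define BM where "BM M = (\<Union>t\<in>TT M. bad sg j t)" for M
    have BM: "range BM \<subseteq> sets P" "incseq BM" "Bad sg j = (\<Union>M. BM M)"
    proof -
      show "range BM \<subseteq> sets P" using TT(1) bad_meas by (auto simp: BM_def)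
      show "incseq BM" unfolding incseq_def BM_def TT_def by (intro allI impI UN_mono image_mono) auto
      show "Bad sg j = (\<Union>M. BM M)" unfolding Bad_def BM_def TT_Un[symmetric] by blast
    qed
    have "emeasure P (BM M) \<le> ennreal (2 * (real p + 1) * exp (n * r\<^sup>2 * (v - c)))" for M
    proof -
      have "BM M = {\<omega>\<in>space P. \<exists>t\<in>TT M. 2 * K\<^sup>2 * m * c * r < sg * D j \<omega> t / n}"
        by (auto simp: BM_def bad_def)
      moreover have "emeasure P {\<omega>\<in>space P. \<exists>t\<in>TT M. 2 * K\<^sup>2 * m * c * r < sg * D j \<omega> t / n}
          \<le> ennreal (2 * (real p + 1) * exp (n * r\<^sup>2 * (v - c)))"
        unfolding P_def D_def
        by (rule emeasure_truncated_deviation[OF TT(1,2) _ m x K Km n r B(2,1) sg]) (use TT(3) T(2) in auto)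
      ultimately show ?thesis by simp
    qed
    thus ?thesis unfolding BM(3) SUP_emeasure_incseq[OF BM(1,2), symmetric] by (intro SUP_least)
  qed
  define W where "W u = V u * indicator {u. B < V u} u" for u
  have W_meas[measurable]: "W \<in> borel_measurable borel" unfolding W_def[abs_def] by measurable
  have W_nonneg: "0 \<le> W u" for u using V_pos[of u] by (simp add: W_def)
  have W_int: "integrable N W" and W_le: "(\<integral>u. W u \<partial>N) \<le> r * tail B"
    using tail_first_moment[OF r] by (simp_all add: W_def[abs_def] B_def)
  \<comment> \<open>The event that the average of \<open>W\<close> reaches \<open>r\<close>. Its
    mean is at most \<open>r * tail B\<close>, so Markov's inequality gives
    \<open>tail B\<close>.\<close>
  define BadT where "BadT = {\<omega>\<in>space P. 1 \<le> ennreal (1 / (n * r)) * (\<Sum>i<n. ennreal (W (\<omega> i)))}"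
  have Wm: "(\<lambda>\<omega>. \<Sum>i<n. ennreal (W (\<omega> i))) \<in> borel_measurable P"
    by (intro borel_measurable_sum measurable_compose[OF comp measurable_ennreal]) auto
  have BadT_meas: "BadT \<in> sets P"
  proof -
    have "(\<lambda>\<omega>. ennreal (1 / (n * r)) * (\<Sum>i<n. ennreal (W (\<omega> i)))) \<in> borel_measurable P"
    proof -
      have "(\<lambda>y. ennreal (1 / (n * r)) * y) \<in> borel_measurable borel" by measurable
      from measurable_compose[OF Wm this] show ?thesis .
    qed
    from measurable_sets[OF this, of "{1..}"] show ?thesis
      by (auto simp: vimage_def Int_def conj_commute BadT_def)
  qed
  have "emeasure P BadT \<le> ennreal (1 / (n * r)) * (\<integral>\<^sup>+\<omega>. (\<Sum>i<n. ennreal (W (\<omega> i))) * indicator (space P) \<omega> \<partial>P)"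
    unfolding BadT_def using Wm
    by (intro nn_integral_Markov_inequality borel_measurable_times borel_measurable_indicator) auto
  also have "(\<integral>\<^sup>+\<omega>. (\<Sum>i<n. ennreal (W (\<omega> i))) * indicator (space P) \<omega> \<partial>P) = (\<integral>\<^sup>+\<omega>. (\<Sum>i<n. ennreal (W (\<omega> i))) \<partial>P)"
    by (intro nn_integral_cong) auto
  also have "\<dots> = (\<Sum>i<n. \<integral>\<^sup>+\<omega>. ennreal (W (\<omega> i)) \<partial>P)"
    by (intro nn_integral_sum measurable_compose[OF comp measurable_ennreal]) auto
  also have "\<dots> = (\<Sum>i<n. \<integral>\<^sup>+u. ennreal (W u) \<partial>N)"
  proof (rule sum.cong[OF refl])
    fix i assume "i \<in> {..<n}"
    hence "distr P N (\<lambda>\<omega>. \<omega> i) = N" "(\<lambda>\<omega>. \<omega> i) \<in> measurable P N"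
      unfolding P_def by (auto intro!: distr_PiM_component prob_space_axioms)
    moreover have "W \<in> borel_measurable N" by measurable
    ultimately show "(\<integral>\<^sup>+\<omega>. ennreal (W (\<omega> i)) \<partial>P) = (\<integral>\<^sup>+u. ennreal (W u) \<partial>N)"
      using nn_integral_distr[of "\<lambda>\<omega>. \<omega> i" P N "\<lambda>u. ennreal (W u)"] by simp
  qed
  also have "\<dots> = ennreal (n * (\<integral>u. W u \<partial>N))"
    using nn_integral_eq_integral[OF W_int] W_nonneg
    by (simp add: ennreal_mult' ennreal_of_nat_eq_real_of_nat)
  also have "ennreal (1 / (n * r)) * \<dots> = ennreal (1 / r * (\<integral>u. W u \<partial>N))"
    using n r by (subst ennreal_mult'[symmetric]) auto
  also have "\<dots> \<le> ennreal (tail B)"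
    using W_le r by (intro ennreal_leI) (simp add: field_simps)
  finally have BadT_le: "emeasure P BadT \<le> ennreal (tail B)" .
  have "AE \<omega> in P. \<forall>i\<in>{..<n}. good (\<omega> i)"
    unfolding P_def by (intro eventually_ball_finite ballI AE_PiM_component prob_space_axioms AE_good) auto
  \<comment> \<open>The Lipschitz property holds only almost everywhere, so a null set joins the
    exceptional event.\<close>
  then obtain E0 where E0: "E0 \<in> null_sets P" "{\<omega>\<in>space P. \<not> (\<forall>i<n. good (\<omega> i))} \<subseteq> E0"
    by (auto simp: eventually_ae_filter)
  define E where "E = E0 \<union> BadT \<union> (\<Union>j\<le>p. Bad 1 j \<union> Bad (-1) j)"
  have E_meas: "E \<in> sets P" using E0 BadT_meas Bad_meas by (auto simp: E_def)
  have "emeasure P (\<Union>j\<le>p. Bad 1 j \<union> Bad (-1) j) \<le> (\<Sum>j\<le>p. emeasure P (Bad 1 j \<union> Bad (-1) j))"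
    using Bad_meas by (intro emeasure_subadditive_finite) auto
  also have "\<dots> \<le> (\<Sum>j\<le>p. ennreal (4 * (real p + 1) * exp (n * r\<^sup>2 * (v - c))))"
  proof (rule sum_mono)
    fix j
    have "emeasure P (Bad 1 j \<union> Bad (-1) j) \<le> emeasure P (Bad 1 j) + emeasure P (Bad (-1) j)"
      using Bad_meas by (intro emeasure_subadditive)
    also have "\<dots> \<le> ennreal (2 * (real p + 1) * exp (n * r\<^sup>2 * (v - c))) + ennreal (2 * (real p + 1) * exp (n * r\<^sup>2 * (v - c)))"
      by (intro add_mono Bad_le) auto
    also have "\<dots> = ennreal (4 * (real p + 1) * exp (n * r\<^sup>2 * (v - c)))"
      by (simp flip: ennreal_plus)
    finally show "emeasure P (Bad 1 j \<union> Bad (-1) j) \<le> ennreal (4 * (real p + 1) * exp (n * r\<^sup>2 * (v - c)))" .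
  qed
  also have "\<dots> = ennreal (4 * (real p + 1)\<^sup>2 * exp (n * r\<^sup>2 * (v - c)))"
  proof -
    have "(\<Sum>j\<le>p. ennreal (4 * (real p + 1) * exp (n * r\<^sup>2 * (v - c))))
        = ennreal (real (Suc p)) * ennreal (4 * (real p + 1) * exp (n * r\<^sup>2 * (v - c)))"
      by (simp only: sum_constant card_atMost ennreal_of_nat_eq_real_of_nat)
    also have "\<dots> = ennreal (real (Suc p) * (4 * (real p + 1) * exp (n * r\<^sup>2 * (v - c))))"
      by (rule ennreal_mult'[symmetric]) simp
    finally show ?thesis by (simp add: power2_eq_square mult_ac add.commute)
  qed
  finally have U: "emeasure P (\<Union>j\<le>p. Bad 1 j \<union> Bad (-1) j) \<le> ennreal (4 * (real p + 1)\<^sup>2 * exp (n * r\<^sup>2 * (v - c)))" .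
  have "emeasure P E \<le> emeasure P E0 + emeasure P BadT + emeasure P (\<Union>j\<le>p. Bad 1 j \<union> Bad (-1) j)"
    unfolding E_def using E0 BadT_meas Bad_meas
    by (intro order_trans[OF emeasure_subadditive] add_mono emeasure_subadditive) auto
  also have "\<dots> \<le> 0 + ennreal (tail B) + ennreal (4 * (real p + 1)\<^sup>2 * exp (n * r\<^sup>2 * (v - c)))"
    using E0 BadT_le U by (intro add_mono) auto
  also have "\<dots> = ennreal (4 * (real p + 1)\<^sup>2 * exp (n * r\<^sup>2 * (v - c)) + tail (1 / r))"
    using tail_nonneg[of B] by (simp add: B_def add.commute flip: ennreal_plus)
  finally have E_le: "emeasure P E \<le> ennreal (4 * (real p + 1)\<^sup>2 * exp (n * r\<^sup>2 * (v - c)) + tail (1 / r))" .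
  have "\<bar>(\<Sum>i<n. incr p (x i) j (\<omega> i) t - (\<integral>u. incr p (x i) j u t \<partial>N)) / n\<bar> \<le> K\<^sup>2 * m * r * (2 * c + 1 + v)"
    if \<omega>: "\<omega> \<in> space P - E" and t: "t \<in> l1_ball p m" and j: "j \<le> p" for \<omega> t j
  proof -
    have g: "good (\<omega> i)" if "i < n" for i using \<omega> E0 that by (auto simp: E_def)
    have t_diff: "\<bar>tincr B p (x i) j u s - tincr B p (x i) j u s'\<bar> \<le> K\<^sup>2 * B * (\<Sum>k\<le>p. \<bar>s k - s' k\<bar>)"
      if "i < n" "good u" "s \<in> l1_ball p m" "s' \<in> l1_ball p m" for i u s s'
    proof -
      have "\<bar>tincr B p (x i) j u s - tincr B p (x i) j u s'\<bar>
          = \<bar>incr p (x i) j u s - incr p (x i) j u s'\<bar> * indicator {u. V u \<le> B} u"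
        by (simp add: tincr_def abs_mult flip: left_diff_distrib)
      also have "\<dots> \<le> K\<^sup>2 * V u * (\<Sum>k\<le>p. \<bar>s k - s' k\<bar>) * indicator {u. V u \<le> B} u"
        using x[OF that(1)] K Km that(2-4) by (intro mult_right_mono incr_diff_le) auto
      also have "\<dots> \<le> K\<^sup>2 * B * (\<Sum>k\<le>p. \<bar>s k - s' k\<bar>)"
        using B(1) by (auto simp: indicator_def intro!: mult_right_mono mult_left_mono sum_nonneg mult_nonneg_nonneg)
      finally show ?thesis .
    qed
    have t_bound: "\<bar>tincr B p (x i) j u s\<bar> \<le> K\<^sup>2 * V u * m" if "i < n" "good u" "s \<in> l1_ball p m" for i u s
      using incr_le(2)[OF x[OF that(1)] K Km that(2,3), where j = j] V_pos[of u] m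
      by (auto simp: tincr_def indicator_def)
    have i_int: "integrable N (\<lambda>u. incr p (x i) j u s)" if "i < n" "s \<in> l1_ball p m" for i s
    proof (rule Bochner_Integration.integrable_bound[of N "\<lambda>u. K\<^sup>2 * V u * m"])
      show "AE u in N. norm (incr p (x i) j u s) \<le> norm (K\<^sup>2 * V u * m)"
        using AE_good
      proof eventually_elim
        case (elim u)
        have "\<bar>incr p (x i) j u s\<bar> \<le> K\<^sup>2 * V u * m"
          by (rule incr_le(2)[OF x[OF that(1)] K Km elim that(2)])
        thus ?case by simp
      qed
    qed (use V_int in auto)
    have t_int: "integrable N (\<lambda>u. tincr B p (x i) j u s)" if "i < n" "s \<in> l1_ball p m" for i s
      by (rule Bochner_Integration.integrable_bound[OF i_int[OF that]]) (auto simp: tincr_def indicator_def)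
    have e_diff: "\<bar>(\<integral>u. tincr B p (x i) j u s \<partial>N) - (\<integral>u. tincr B p (x i) j u s' \<partial>N)\<bar> \<le> K\<^sup>2 * B * (\<Sum>k\<le>p. \<bar>s k - s' k\<bar>)"
      if "i < n" "s \<in> l1_ball p m" "s' \<in> l1_ball p m" for i s s'
    proof -
      have "\<bar>(\<integral>u. tincr B p (x i) j u s \<partial>N) - (\<integral>u. tincr B p (x i) j u s' \<partial>N)\<bar>
          = \<bar>\<integral>u. tincr B p (x i) j u s - tincr B p (x i) j u s' \<partial>N\<bar>"
        using t_int that by simp
      also have "\<dots> \<le> (\<integral>u. \<bar>tincr B p (x i) j u s - tincr B p (x i) j u s'\<bar> \<partial>N)"
        by (rule integral_abs_bound)
      also have "\<dots> \<le> (\<integral>u. K\<^sup>2 * B * (\<Sum>k\<le>p. \<bar>s k - s' k\<bar>) \<partial>N)"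
      proof (rule integral_mono_AE)
        show "AE u in N. \<bar>tincr B p (x i) j u s - tincr B p (x i) j u s'\<bar> \<le> K\<^sup>2 * B * (\<Sum>k\<le>p. \<bar>s k - s' k\<bar>)"
          using AE_good by eventually_elim (use t_diff that in auto)
      qed (use t_int that in auto)
      finally show ?thesis by (simp add: prob_space)
    qed
    have D_diff: "\<bar>D j \<omega> s - D j \<omega> s'\<bar> \<le> n * (2 * K\<^sup>2 * B * (\<Sum>k\<le>p. \<bar>s k - s' k\<bar>))"
      if "s \<in> l1_ball p m" "s' \<in> l1_ball p m" for s s'
    proof -
      have "\<bar>D j \<omega> s - D j \<omega> s'\<bar> \<le> (\<Sum>i<n. \<bar>(tincr B p (x i) j (\<omega> i) s - (\<integral>u. tincr B p (x i) j u s \<partial>N))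
          - (tincr B p (x i) j (\<omega> i) s' - (\<integral>u. tincr B p (x i) j u s' \<partial>N))\<bar>)"
        unfolding D_def sum_subtractf[symmetric] by (rule sum_abs)
      also have "\<dots> \<le> (\<Sum>i<n. 2 * K\<^sup>2 * B * (\<Sum>k\<le>p. \<bar>s k - s' k\<bar>))"
        using t_diff[OF _ g that] e_diff[OF _ that] by (intro sum_mono) (fastforce simp: abs_le_iff)
      finally show ?thesis by simp
    qed
    have D_T: "\<bar>D j \<omega> s\<bar> / n \<le> 2 * K\<^sup>2 * m * c * r" if "s \<in> T" for s
      using \<omega> that j by (auto simp: E_def Bad_def bad_def not_less abs_if)
    \<comment> \<open>Passage from the dense set to the whole ball: the truncated process is
      Lipschitz in \<open>l1\<close>, with a constant that depends on \<open>B\<close> and can be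
      compensated by the distance to the dense set.\<close>
    have D_le: "\<bar>D j \<omega> t\<bar> / n \<le> 2 * K\<^sup>2 * m * c * r"
    proof (rule field_le_epsilon)
      fix e :: real assume e: "0 < e"
      define L where "L = 2 * K\<^sup>2 * B + 1"
      have L: "0 < L" using B by (simp add: L_def add_nonneg_pos)
      obtain s where s: "s \<in> T" "(\<Sum>k\<le>p. \<bar>t k - s k\<bar>) < e / L"
        using T(3)[OF t, of "e / L"] e L by auto
      have "\<bar>D j \<omega> t - D j \<omega> s\<bar> \<le> n * (2 * K\<^sup>2 * B * (\<Sum>k\<le>p. \<bar>t k - s k\<bar>))"
        using D_diff[OF t] s(1) T(2) by blast
      also have "\<dots> \<le> n * (L * (e / L))"
        using s(2) L B by (intro mult_left_mono mult_mono) (auto simp: L_def sum_nonneg)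
      finally have "\<bar>D j \<omega> t - D j \<omega> s\<bar> / n \<le> e" using n L by (simp add: field_simps)
      moreover have "\<bar>D j \<omega> t\<bar> / n \<le> \<bar>D j \<omega> s\<bar> / n + \<bar>D j \<omega> t - D j \<omega> s\<bar> / n"
        by (simp add: add_divide_distrib[symmetric] divide_right_mono)
      ultimately show "\<bar>D j \<omega> t\<bar> / n \<le> 2 * K\<^sup>2 * m * c * r + e" using D_T[OF s(1)] by linarith
    qed
    have split: "\<bar>incr p (x i) j u t - tincr B p (x i) j u t\<bar> \<le> K\<^sup>2 * m * W u" if "i < n" "good u" for i u
      using incr_le(2)[OF x[OF that(1)] K Km that(2) t, where j = j]
      by (auto simp: tincr_def W_def indicator_def mult_ac)
    have W_sum: "(\<Sum>i<n. W (\<omega> i)) / n \<le> r"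
    proof -
      have "\<omega> \<notin> BadT" "\<omega> \<in> space P" using \<omega> by (auto simp: E_def)
      hence "\<not> 1 \<le> ennreal (1 / (n * r) * (\<Sum>i<n. W (\<omega> i)))"
        using W_nonneg n r ennreal_mult'[of "1 / (n * r)" "\<Sum>i<n. W (\<omega> i)"] by (simp add: BadT_def sum_ennreal)
      hence "1 / (n * r) * (\<Sum>i<n. W (\<omega> i)) < 1" by (simp add: not_le)
      thus ?thesis using n r by (simp add: field_simps)
    qed
    have e_split: "\<bar>(\<integral>u. incr p (x i) j u t \<partial>N) - (\<integral>u. tincr B p (x i) j u t \<partial>N)\<bar> \<le> K\<^sup>2 * m * (r * v)" if "i < n" for i
    proof -
      have "\<bar>(\<integral>u. incr p (x i) j u t \<partial>N) - (\<integral>u. tincr B p (x i) j u t \<partial>N)\<bar>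
          = \<bar>\<integral>u. incr p (x i) j u t - tincr B p (x i) j u t \<partial>N\<bar>"
        using i_int[OF that t] t_int[OF that t] by simp
      also have "\<dots> \<le> (\<integral>u. \<bar>incr p (x i) j u t - tincr B p (x i) j u t\<bar> \<partial>N)"
        by (rule integral_abs_bound)
      also have "\<dots> \<le> (\<integral>u. K\<^sup>2 * m * W u \<partial>N)"
      proof (rule integral_mono_AE)
        show "AE u in N. \<bar>incr p (x i) j u t - tincr B p (x i) j u t\<bar> \<le> K\<^sup>2 * m * W u"
          using AE_good by eventually_elim (use split that in auto)
      qed (use i_int[OF that t] t_int[OF that t] W_int in auto)
      also have "\<dots> = K\<^sup>2 * m * (\<integral>u. W u \<partial>N)" by simp
      also have "\<dots> \<le> K\<^sup>2 * m * (r * v)"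
        using W_le tail_le[of B] r m by (intro mult_left_mono order_trans[OF W_le]) auto
      finally show ?thesis .
    qed
    define R where "R = (\<Sum>i<n. (incr p (x i) j (\<omega> i) t - (\<integral>u. incr p (x i) j u t \<partial>N))
        - (tincr B p (x i) j (\<omega> i) t - (\<integral>u. tincr B p (x i) j u t \<partial>N)))"
    have "\<bar>R\<bar> \<le> (\<Sum>i<n. K\<^sup>2 * m * W (\<omega> i) + K\<^sup>2 * m * (r * v))"
      unfolding R_def
    proof (rule order_trans[OF sum_abs sum_mono])
      fix i assume "i \<in> {..<n}"
      hence "i < n" by simp
      with split[OF this g[OF this]] e_split[of i]
      show "\<bar>(incr p (x i) j (\<omega> i) t - (\<integral>u. incr p (x i) j u t \<partial>N))
        - (tincr B p (x i) j (\<omega> i) t - (\<integral>u. tincr B p (x i) j u t \<partial>N))\<bar> \<le> K\<^sup>2 * m * W (\<omega> i) + K\<^sup>2 * m * (r * v)"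
        by auto
    qed
    hence "\<bar>R\<bar> / n \<le> (\<Sum>i<n. K\<^sup>2 * m * W (\<omega> i) + K\<^sup>2 * m * (r * v)) / n"
      by (intro divide_right_mono) auto
    also have "\<dots> = K\<^sup>2 * m * ((\<Sum>i<n. W (\<omega> i)) / n) + K\<^sup>2 * m * (r * v)"
      using n by (simp add: sum.distrib sum_distrib_left[symmetric] add_divide_distrib)
    also have "\<dots> \<le> K\<^sup>2 * m * r + K\<^sup>2 * m * (r * v)"
      using W_sum m by (intro add_right_mono mult_left_mono) auto
    finally have R_le: "\<bar>R\<bar> / n \<le> K\<^sup>2 * m * r + K\<^sup>2 * m * (r * v)" .
    have "(\<Sum>i<n. incr p (x i) j (\<omega> i) t - (\<integral>u. incr p (x i) j u t \<partial>N)) = D j \<omega> t + R"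
      unfolding D_def R_def sum.distrib[symmetric] by (intro sum.cong) auto
    hence "\<bar>(\<Sum>i<n. incr p (x i) j (\<omega> i) t - (\<integral>u. incr p (x i) j u t \<partial>N)) / n\<bar> \<le> \<bar>D j \<omega> t\<bar> / n + \<bar>R\<bar> / n"
      by (simp add: add_divide_distrib[symmetric] divide_right_mono)
    also have "\<dots> \<le> K\<^sup>2 * m * r * (2 * c + 1 + v)"
      using D_le R_le by (simp add: algebra_simps)
    finally show ?thesis .
  qed
  with E_meas E_le show ?thesis by blast
qed

end

subsection \<open>The expected loss and its gradient\<close>

locale convex_noise =
  fixes f G :: "real \<Rightarrow> real" and M0 :: real
  assumes prob_noise: "prob_space (noise_law f)"
    and f_pos: "\<And>t. f t > 0"
    and l_convex: "convex_on UNIV (nll f)"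
    and l_diff: "\<And>t. nll f differentiable (at t)"
    and l_int: "integrable (noise_law f) (nll f)"
    and ld_int: "integrable (noise_law f) (\<lambda>t. (deriv (nll f) t)\<^sup>2)"
    and ldx_int: "integrable (noise_law f) (\<lambda>t. (deriv (nll f) t * t)\<^sup>2)"
    and G_pos': "\<And>t. G t > 0"
    and G_int: "integrable (noise_law f) (\<lambda>t. (G t)\<^sup>2)"
    and Gx_int: "integrable (noise_law f) (\<lambda>t. (G t)\<^sup>2 * t ^ 4)"
    and M0_pos': "0 < M0"
    and G_lip: "AE t in noise_law f. \<forall>u v. max \<bar>u\<bar> \<bar>v\<bar> \<le> (1 + \<bar>t\<bar>) * M0 \<longrightarrow>
             \<bar>deriv (nll f) (t + u) - deriv (nll f) (t + v)\<bar> \<le> G t * \<bar>u - v\<bar>"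
begin

abbreviation N :: "real measure" where "N \<equiv> noise_law f"

abbreviation h :: "real \<Rightarrow> real" where "h \<equiv> deriv (nll f)"

lemma nll_has_deriv: "(nll f has_field_derivative h t) (at t)"
  using l_diff[of t] by (simp add: DERIV_deriv_iff_real_differentiable)

lemma nll_tangent: "nll f u + h u * (w - u) \<le> nll f w"
  using convex_on_imp_above_tangent[OF l_convex connected_UNIV, of u w "h u"] nll_has_deriv[of u]
  by simp

lemma continuous_nll: "continuous_on A (nll f)"
  using nll_has_deriv DERIV_isCont continuous_at_imp_continuous_on by blast

text \<open>Monotonicity also makes the score Borel measurable.\<close>

lemma h_mono: "mono h"
proof (rule monoI)
  fix u w :: real assume le: "u \<le> w"
  have "0 \<le> (h w - h u) * (w - u)"
    using nll_tangent[of u w] nll_tangent[of w u] by (simp add: algebra_simps)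
  thus "h u \<le> h w" using le by (cases "u = w") (auto simp: zero_le_mult_iff)
qed

lemma f_eq: "f t = exp (- nll f t)"
  by (simp add: nll_def f_pos)

lemma nll_meas [measurable]: "nll f \<in> borel_measurable borel"
  by (rule borel_measurable_continuous_onI[OF continuous_nll])

lemma f_meas [measurable]: "f \<in> borel_measurable borel"
proof -
  have "f = (\<lambda>t. exp (- nll f t))" using f_eq by blast
  thus ?thesis by (metis (no_types) borel_measurable_exp borel_measurable_uminus measurable_compose nll_meas)
qed

lemma sets_noise [measurable_cong]: "sets N = sets borel"
  by (simp add: noise_law_def)

lemma space_noise [simp]: "space N = UNIV"
  by (simp add: noise_law_def)

text \<open>Only \<open>G\<close> squared is known to be measurable; positivity recovers
  \<open>G\<close> as its square root.\<close>

lemma G_meas': "G \<in> borel_measurable borel"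
proof -
  have "(\<lambda>t. (G t)\<^sup>2) \<in> borel_measurable N" using G_int by simp
  hence "(\<lambda>t. sqrt ((G t)\<^sup>2)) \<in> borel_measurable N" by measurable
  moreover have "(\<lambda>t. sqrt ((G t)\<^sup>2)) = G" using G_pos' by (simp add: fun_eq_iff less_imp_le)
  ultimately show ?thesis by (simp add: measurable_def sets_noise)
qed

lemma envelope_int': "integrable N (\<lambda>u. (G u * (1 + \<bar>u\<bar>)\<^sup>2)\<^sup>2)"
proof (rule Bochner_Integration.integrable_bound[of N "\<lambda>u. 8 * (G u)\<^sup>2 + 8 * ((G u)\<^sup>2 * u ^ 4)"])
  show "AE u in N. norm ((G u * (1 + \<bar>u\<bar>)\<^sup>2)\<^sup>2) \<le> norm (8 * (G u)\<^sup>2 + 8 * ((G u)\<^sup>2 * u ^ 4))"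
  proof (rule AE_I2)
    fix u :: real
    have "(1 + \<bar>u\<bar>)\<^sup>2 \<le> 2 * (1 + \<bar>u\<bar>\<^sup>2)"
      using zero_le_power2[of "1 - \<bar>u\<bar>"] by (simp add: power2_eq_square algebra_simps)
    hence "((1 + \<bar>u\<bar>)\<^sup>2)\<^sup>2 \<le> (2 * (1 + \<bar>u\<bar>\<^sup>2))\<^sup>2" by (intro power_mono) auto
    also have "\<dots> \<le> 8 * (1 + (\<bar>u\<bar>\<^sup>2)\<^sup>2)"
      using zero_le_power2[of "1 - \<bar>u\<bar>\<^sup>2"] by (simp add: power2_eq_square algebra_simps)
    also have "\<dots> = 8 * (1 + u ^ 4)" by (simp add: power_mult[symmetric] flip: power_abs)
    finally have "(G u)\<^sup>2 * ((1 + \<bar>u\<bar>)\<^sup>2)\<^sup>2 \<le> (G u)\<^sup>2 * (8 * (1 + u ^ 4))" by (intro mult_left_mono) auto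
    thus "norm ((G u * (1 + \<bar>u\<bar>)\<^sup>2)\<^sup>2) \<le> norm (8 * (G u)\<^sup>2 + 8 * ((G u)\<^sup>2 * u ^ 4))"
      by (simp add: power_mult_distrib algebra_simps)
  qed
  show "(\<lambda>u. (G u * (1 + \<bar>u\<bar>)\<^sup>2)\<^sup>2) \<in> borel_measurable N" using G_meas' by measurable
qed (use G_int Gx_int in auto)

sublocale lipschitz_noise N h G M0
proof -
  interpret prob_space N by (rule prob_noise)
  show "lipschitz_noise N h G M0"
    by unfold_locales
      (use sets_noise borel_measurable_mono[OF h_mono] G_meas' G_pos' M0_pos' G_lip envelope_int' in auto)
qed

lemma integrable_of_square:
  fixes g :: "real \<Rightarrow> real"
  assumes [measurable]: "g \<in> borel_measurable borel" and "integrable N (\<lambda>t. (g t)\<^sup>2)"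
  shows "integrable N g"
proof (rule Bochner_Integration.integrable_bound[of N "\<lambda>t. 1 + (g t)\<^sup>2"])
  show "AE t in N. norm (g t) \<le> norm (1 + (g t)\<^sup>2)"
  proof (rule AE_I2)
    fix t
    show "norm (g t) \<le> norm (1 + (g t)\<^sup>2)"
      using zero_le_power2[of "\<bar>g t\<bar> - 1"] by (simp add: power2_diff)
  qed
qed (use assms in auto)

lemma h_int: "integrable N h" and ht_int: "integrable N (\<lambda>t. h t * t)"
  using ld_int ldx_int by (auto intro!: integrable_of_square)

lemma perturbation_range:
  assumes "\<bar>c\<bar> + \<bar>\<tau>\<bar> \<le> M0"
  shows "\<bar>\<tau> * t - c\<bar> \<le> (1 + \<bar>t\<bar>) * (\<bar>c\<bar> + \<bar>\<tau>\<bar>)" "\<bar>\<tau> * t - c\<bar> \<le> (1 + \<bar>t\<bar>) * M0"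
proof -
  have "\<bar>\<tau> * t - c\<bar> \<le> \<bar>\<tau>\<bar> * \<bar>t\<bar> + \<bar>c\<bar>" by (metis abs_mult abs_triangle_ineq4)
  also have "\<dots> \<le> (1 + \<bar>t\<bar>) * (\<bar>c\<bar> + \<bar>\<tau>\<bar>)" by (simp add: algebra_simps)
  finally show *: "\<bar>\<tau> * t - c\<bar> \<le> (1 + \<bar>t\<bar>) * (\<bar>c\<bar> + \<bar>\<tau>\<bar>)" .
  also have "\<dots> \<le> (1 + \<bar>t\<bar>) * M0" using assms by (intro mult_left_mono) auto
  finally show "\<bar>\<tau> * t - c\<bar> \<le> (1 + \<bar>t\<bar>) * M0" .
qed

lemma h_perturbed:
  assumes "good t" "\<bar>c\<bar> + \<bar>\<tau>\<bar> \<le> M0"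
  shows "\<bar>h (t + (\<tau> * t - c)) - h t\<bar> * (1 + \<bar>t\<bar>) \<le> V t * (\<bar>c\<bar> + \<bar>\<tau>\<bar>)"
proof -
  have "\<bar>h (t + (\<tau> * t - c)) - h (t + 0)\<bar> \<le> G t * \<bar>(\<tau> * t - c) - 0\<bar>"
    using assms(1)[unfolded good_def, rule_format, of "\<tau> * t - c" 0]
      perturbation_range(2)[OF assms(2), of t] M0_pos by auto
  also have "\<dots> \<le> G t * ((1 + \<bar>t\<bar>) * (\<bar>c\<bar> + \<bar>\<tau>\<bar>))"
    using perturbation_range(1)[OF assms(2), of t] G_pos[of t] by (intro mult_left_mono) auto
  finally have "\<bar>h (t + (\<tau> * t - c)) - h t\<bar> * (1 + \<bar>t\<bar>) \<le> G t * ((1 + \<bar>t\<bar>) * (\<bar>c\<bar> + \<bar>\<tau>\<bar>)) * (1 + \<bar>t\<bar>)"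
    by (intro mult_right_mono) auto
  thus ?thesis by (simp add: V_def power2_eq_square mult_ac)
qed

text \<open>Minus the expected score and the expected score times the noise, at location \<open>c\<close> and
  inverse scale \<open>1 + \<tau>\<close>; these are the components of the gradient of \<open>Hfun f\<close>.\<close>

definition hc :: "real \<Rightarrow> real \<Rightarrow> real" where
  "hc c \<tau> = - (\<integral>t. h (t + (\<tau> * t - c)) \<partial>N)"

definition hd :: "real \<Rightarrow> real \<Rightarrow> real" where
  "hd c \<tau> = (\<integral>t. h (t + (\<tau> * t - c)) * t \<partial>N)"

context
  fixes c \<tau> :: real
  assumes ct: "\<bar>c\<bar> + \<bar>\<tau>\<bar> \<le> M0"
begin

lemma h_perturbed_diff_int:
  "integrable N (\<lambda>t. \<bar>h (t + (\<tau> * t - c)) - h t\<bar> * (1 + \<bar>t\<bar>))"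
  "(\<integral>t. \<bar>h (t + (\<tau> * t - c)) - h t\<bar> * (1 + \<bar>t\<bar>) \<partial>N) \<le> (\<integral>t. V t \<partial>N) * (\<bar>c\<bar> + \<bar>\<tau>\<bar>)"
proof -
  have ae: "AE t in N. \<bar>h (t + (\<tau> * t - c)) - h t\<bar> * (1 + \<bar>t\<bar>) \<le> V t * (\<bar>c\<bar> + \<bar>\<tau>\<bar>)"
    using AE_good by eventually_elim (rule h_perturbed[OF _ ct])
  have i: "integrable N (\<lambda>t. V t * (\<bar>c\<bar> + \<bar>\<tau>\<bar>))" using V_int by simp
  show *: "integrable N (\<lambda>t. \<bar>h (t + (\<tau> * t - c)) - h t\<bar> * (1 + \<bar>t\<bar>))"
    by (rule Bochner_Integration.integrable_bound[OF i]) (use ae in \<open>auto elim!: eventually_mono\<close>)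
  show "(\<integral>t. \<bar>h (t + (\<tau> * t - c)) - h t\<bar> * (1 + \<bar>t\<bar>) \<partial>N) \<le> (\<integral>t. V t \<partial>N) * (\<bar>c\<bar> + \<bar>\<tau>\<bar>)"
    using integral_mono_AE[OF * i ae] by simp
qed

lemma h_diff_int: "integrable N (\<lambda>t. h (t + (\<tau> * t - c)) - h t)"
  by (rule Bochner_Integration.integrable_bound[OF h_perturbed_diff_int(1)]) (auto simp: mult_le_cancel_left1)

lemma ht_diff_int: "integrable N (\<lambda>t. (h (t + (\<tau> * t - c)) - h t) * t)"
  by (rule Bochner_Integration.integrable_bound[OF h_perturbed_diff_int(1)])
    (auto simp: abs_mult mult_left_mono)

lemma h_perturbed_int: "integrable N (\<lambda>t. h (t + (\<tau> * t - c)))"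
  using Bochner_Integration.integrable_add[OF h_diff_int h_int] by simp

lemma ht_perturbed_int: "integrable N (\<lambda>t. h (t + (\<tau> * t - c)) * t)"
  using Bochner_Integration.integrable_add[OF ht_diff_int ht_int] by (simp add: algebra_simps)

lemma hd_lipschitz_at_origin: "\<bar>hd c \<tau> - hd 0 0\<bar> \<le> (\<integral>t. V t \<partial>N) * (\<bar>c\<bar> + \<bar>\<tau>\<bar>)"
proof -
  have "\<bar>hd c \<tau> - hd 0 0\<bar> = \<bar>\<integral>t. (h (t + (\<tau> * t - c)) - h t) * t \<partial>N\<bar>"
    using ht_perturbed_int ht_int by (simp add: hd_def left_diff_distrib)
  also have "\<dots> \<le> (\<integral>t. \<bar>(h (t + (\<tau> * t - c)) - h t) * t\<bar> \<partial>N)" by (rule integral_abs_bound)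
  also have "\<dots> \<le> (\<integral>t. \<bar>h (t + (\<tau> * t - c)) - h t\<bar> * (1 + \<bar>t\<bar>) \<partial>N)"
    using ht_diff_int h_perturbed_diff_int(1)
    by (intro integral_mono integrable_abs) (auto simp: abs_mult mult_left_mono)
  also note h_perturbed_diff_int(2)
  finally show ?thesis .
qed

text \<open>The tangent inequalities at both end points enclose the increment of the loss between
  two multiples of the shift. Near the truth \<open>Hfun\<close> is therefore a genuine expectation
  and not the default value 0 of the integral.\<close>

lemma nll_perturbed_int: "integrable N (\<lambda>t. nll f (t + (\<tau> * t - c)))"
proof -
  define s where "s t = \<tau> * t - c" for t
  have "integrable N (\<lambda>t. nll f (t + s t) - nll f t)"
  proof (rule Bochner_Integration.integrable_bound[of N "\<lambda>t. M0 * (2 * \<bar>h t\<bar> + 2 * \<bar>h t * t\<bar> + \<bar>h (t + (\<tau> * t - c)) - h t\<bar> * (1 + \<bar>t\<bar>))"])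
    show "AE t in N. norm (nll f (t + s t) - nll f t) \<le> norm (M0 * (2 * \<bar>h t\<bar> + 2 * \<bar>h t * t\<bar> + \<bar>h (t + (\<tau> * t - c)) - h t\<bar> * (1 + \<bar>t\<bar>)))"
    proof (rule AE_I2)
      fix t
      have "\<bar>nll f (t + s t) - nll f t\<bar> \<le> \<bar>s t\<bar> * (\<bar>h t\<bar> + \<bar>h (t + s t)\<bar>)"
      proof -
        have "h t * s t \<le> nll f (t + s t) - nll f t" "nll f (t + s t) - nll f t \<le> h (t + s t) * s t"
          using nll_tangent[of t "t + s t"] nll_tangent[of "t + s t" t] by (auto simp: algebra_simps)
        moreover have "\<bar>h t * s t\<bar> \<le> \<bar>s t\<bar> * (\<bar>h t\<bar> + \<bar>h (t + s t)\<bar>)" "\<bar>h (t + s t) * s t\<bar> \<le> \<bar>s t\<bar> * (\<bar>h t\<bar> + \<bar>h (t + s t)\<bar>)"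
          by (simp_all add: abs_mult algebra_simps)
        ultimately show ?thesis by linarith
      qed
      also have "\<dots> \<le> ((1 + \<bar>t\<bar>) * M0) * (2 * \<bar>h t\<bar> + \<bar>h (t + s t) - h t\<bar>)"
        using perturbation_range(2)[OF ct, of t] M0_pos by (intro mult_mono) (auto simp: s_def)
      finally show "norm (nll f (t + s t) - nll f t) \<le> norm (M0 * (2 * \<bar>h t\<bar> + 2 * \<bar>h t * t\<bar> + \<bar>h (t + (\<tau> * t - c)) - h t\<bar> * (1 + \<bar>t\<bar>)))"
        using M0_pos by (simp add: s_def algebra_simps abs_mult)
    qed
  qed (use h_int ht_int h_perturbed_diff_int(1) in \<open>auto simp: s_def\<close>)
  from Bochner_Integration.integrable_add[OF this l_int] show ?thesis by (simp add: s_def)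
qed

end

lemma Hfun_eq: "Hfun f (vector [c, 1 + \<tau>]) = (\<integral>t. nll f (t + (\<tau> * t - c)) \<partial>N)"
  unfolding Hfun_def by (intro Bochner_Integration.integral_cong) (auto simp: algebra_simps)

text \<open>The pointwise tangent inequality is integrated, which avoids differentiation under the
  integral sign.\<close>

lemma Hfun_subgradient:
  assumes "\<bar>c\<bar> + \<bar>\<tau>\<bar> \<le> M0" "\<bar>c'\<bar> + \<bar>\<tau>'\<bar> \<le> M0"
  shows "Hfun f (vector [c, 1 + \<tau>]) + hc c \<tau> * (c' - c) + hd c \<tau> * (\<tau>' - \<tau>) \<le> Hfun f (vector [c', 1 + \<tau>'])"
proof -
  note i = h_perturbed_int[OF assms(1)] ht_perturbed_int[OF assms(1)] nll_perturbed_int[OF assms(1)]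
    nll_perturbed_int[OF assms(2)]
  have "Hfun f (vector [c, 1 + \<tau>]) + hc c \<tau> * (c' - c) + hd c \<tau> * (\<tau>' - \<tau>)
      = (\<integral>t. nll f (t + (\<tau> * t - c)) - h (t + (\<tau> * t - c)) * (c' - c) + h (t + (\<tau> * t - c)) * t * (\<tau>' - \<tau>) \<partial>N)"
    using i by (simp add: Hfun_eq hc_def hd_def)
  also have "\<dots> \<le> (\<integral>t. nll f (t + (\<tau>' * t - c')) \<partial>N)"
  proof (rule integral_mono)
    fix t
    show "nll f (t + (\<tau> * t - c)) - h (t + (\<tau> * t - c)) * (c' - c) + h (t + (\<tau> * t - c)) * t * (\<tau>' - \<tau>)
      \<le> nll f (t + (\<tau>' * t - c'))"
      using nll_tangent[of "t + (\<tau> * t - c)" "t + (\<tau>' * t - c')"] by (simp add: algebra_simps)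
  qed (use i in auto)
  finally show ?thesis by (simp add: Hfun_eq)
qed

text \<open>Gibbs' inequality. It makes \<open>d = 1\<close> a minimizer of \<open>H 0 d - ln d\<close>, whence \<open>hd 0 0 = 1\<close>.\<close>

lemma ln_le_Hfun_rescale:
  assumes "\<bar>\<tau>\<bar> \<le> M0" "-1 < \<tau>"
  shows "ln (1 + \<tau>) \<le> Hfun f (vector [0, 1 + \<tau>]) - Hfun f (vector [0, 1])"
proof -
  have d: "0 < 1 + \<tau>" using assms by simp
  \<comment> \<open>The likelihood ratio of the rescaled density against \<open>f\<close>, which has
    mean one under the noise law.\<close>
  define g where "g t = (1 + \<tau>) * f ((1 + \<tau>) * t) / f t" for t
  have [measurable]: "g \<in> borel_measurable borel" unfolding g_def by measurable
  have g_pos: "0 < g t" for t using d f_pos by (simp add: g_def)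
  have f1: "(\<integral>\<^sup>+t. ennreal (f t) \<partial>lborel) = 1"
    using emeasure_space_1 by (simp add: noise_law_def emeasure_density)
  have "(\<integral>\<^sup>+t. ennreal (g t) \<partial>N) = (\<integral>\<^sup>+t. ennreal (f t) * ennreal (g t) \<partial>lborel)"
    unfolding noise_law_def by (subst nn_integral_density) auto
  also have "\<dots> = (\<integral>\<^sup>+t. ennreal (1 + \<tau>) * ennreal (f (0 + (1 + \<tau>) * t)) \<partial>lborel)"
    using f_pos d by (intro nn_integral_cong) (simp add: g_def less_imp_le less_imp_neq[symmetric] flip: ennreal_mult')
  also have "\<dots> = ennreal (1 + \<tau>) * (\<integral>\<^sup>+t. ennreal (f (0 + (1 + \<tau>) * t)) \<partial>lborel)"
    by (rule nn_integral_cmult) measurable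
  also have "\<dots> = (\<integral>\<^sup>+t. ennreal (f t) \<partial>lborel)"
    using d by (subst nn_integral_real_affine[of _ "1 + \<tau>" 0]) auto
  finally have g1: "(\<integral>\<^sup>+t. ennreal (g t) \<partial>N) = 1" using f1 by simp
  have g_int: "integrable N g"
    by (rule integrableI_nonneg) (use g1 g_pos in \<open>auto simp: less_imp_le\<close>)
  have g_E: "(\<integral>t. g t \<partial>N) = 1"
    using g1 g_pos by (subst integral_eq_nn_integral) (auto simp: less_imp_le)
  have i1: "integrable N (\<lambda>t. nll f (t + (\<tau> * t - 0)))"
    using nll_perturbed_int[of 0 \<tau>] assms by simp
  have "0 \<le> (\<integral>t. (nll f (t + (\<tau> * t - 0)) - nll f t - ln (1 + \<tau>)) - (1 - g t) \<partial>N)"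
  proof (rule Bochner_Integration.integral_nonneg)
    fix t
    have "ln (g t) \<le> g t - 1" using g_pos by (rule ln_le_minus_one)
    moreover have "ln (g t) = ln (1 + \<tau>) - nll f (t + (\<tau> * t - 0)) + nll f t"
    proof -
      have "ln (g t) = ln (1 + \<tau>) + ln (f ((1 + \<tau>) * t)) - ln (f t)"
        using d f_pos[of t] f_pos[of "(1 + \<tau>) * t"]
        by (simp only: g_def ln_divide_pos ln_mult_pos mult_pos_pos)
      thus ?thesis by (simp add: nll_def distrib_right)
    qed
    ultimately show "0 \<le> (nll f (t + (\<tau> * t - 0)) - nll f t - ln (1 + \<tau>)) - (1 - g t)" by simp
  qed
  also have "\<dots> = Hfun f (vector [0, 1 + \<tau>]) - Hfun f (vector [0, 1]) - ln (1 + \<tau>)"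
    using i1 l_int g_int g_E Hfun_eq[of 0 \<tau>] Hfun_eq[of 0 0] prob_space by simp
  finally show ?thesis by simp
qed

text \<open>Gibbs' inequality and the subgradient at \<open>(0, 1 + \<tau>)\<close> give
  \<open>ln (1 + \<tau>) \<le> \<tau> * hd 0 \<tau>\<close>. Division by positive and by negative
  \<open>\<tau>\<close> gives opposite bounds on \<open>hd 0 \<tau>\<close>, and the Lipschitz bound
  at the origin transfers them to \<open>hd 0 0\<close>.\<close>

lemma hd_origin: "hd 0 0 = 1"
proof -
  define C where "C = (\<integral>t. V t \<partial>N)"
  have C: "0 \<le> C" unfolding C_def by (intro Bochner_Integration.integral_nonneg) (simp add: V_pos less_imp_le)
  have key: "ln (1 + \<tau>) \<le> \<tau> * hd 0 \<tau>" if "\<bar>\<tau>\<bar> \<le> M0" "-1 < \<tau>" for \<tau>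
    using ln_le_Hfun_rescale[OF that] Hfun_subgradient[of 0 \<tau> 0 0] that M0_pos
    by (simp add: algebra_simps)
  define \<tau>0 where "\<tau>0 = min M0 (1/2)"
  have \<tau>0: "0 < \<tau>0" "\<tau>0 \<le> M0" "\<tau>0 \<le> 1/2" using M0_pos by (auto simp: \<tau>0_def)
  have up: "\<bar>hd 0 0 - 1\<bar> \<le> (C + 2) * \<tau>" if \<tau>: "0 < \<tau>" "\<tau> \<le> \<tau>0" for \<tau>
  proof -
    have "\<tau> * (1 - \<tau>) \<le> ln (1 + \<tau>)"
      using ln_one_plus_pos_lower_bound[of \<tau>] \<tau> \<tau>0 by (simp add: power2_eq_square algebra_simps)
    also have "\<dots> \<le> \<tau> * hd 0 \<tau>" using key[of \<tau>] \<tau> \<tau>0 by simp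
    finally have 1: "1 - \<tau> \<le> hd 0 \<tau>" using \<tau> by simp
    have "- (\<tau> * (1 + 2 * \<tau>)) \<le> ln (1 - \<tau>)"
      using ln_one_minus_pos_lower_bound[of \<tau>] \<tau> \<tau>0 by (simp add: power2_eq_square algebra_simps)
    also have "\<dots> \<le> - (\<tau> * hd 0 (- \<tau>))" using key[of "- \<tau>"] \<tau> \<tau>0 by simp
    finally have 2: "hd 0 (- \<tau>) \<le> 1 + 2 * \<tau>" using \<tau> by simp
    have "\<bar>hd 0 \<tau> - hd 0 0\<bar> \<le> C * \<tau>" "\<bar>hd 0 (- \<tau>) - hd 0 0\<bar> \<le> C * \<tau>"
      using hd_lipschitz_at_origin[of 0 \<tau>] hd_lipschitz_at_origin[of 0 "- \<tau>"] \<tau> \<tau>0 by (simp_all add: C_def)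
    with 1 2 have "hd 0 0 - 1 \<le> C * \<tau> + 2 * \<tau>" "1 - hd 0 0 \<le> C * \<tau> + 2 * \<tau>" using \<tau> by linarith+
    thus ?thesis by (simp add: abs_if algebra_simps)
  qed
  have "\<bar>hd 0 0 - 1\<bar> \<le> 0 + e" if e: "0 < e" for e
  proof -
    define \<tau> where "\<tau> = min \<tau>0 (e / (C + 2))"
    have t: "0 < \<tau>" "\<tau> \<le> \<tau>0" "\<tau> \<le> e / (C + 2)" using \<tau>0 e C by (auto simp: \<tau>_def)
    have "\<bar>hd 0 0 - 1\<bar> \<le> (C + 2) * \<tau>" by (rule up[OF t(1,2)])
    also have "\<dots> \<le> (C + 2) * (e / (C + 2))" using t C by (intro mult_left_mono) auto
    finally show ?thesis using C by simp
  qed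
  hence "\<bar>hd 0 0 - 1\<bar> \<le> 0" by (rule field_le_epsilon)
  thus ?thesis by simp
qed

end

section \<open>Hessians and the second order expansion of the expected loss\<close>

lemma GDERIV_unique: "GDERIV F z :> a \<Longrightarrow> GDERIV F z :> b \<Longrightarrow> a = b"
proof -
  assume "GDERIV F z :> a" "GDERIV F z :> b"
  hence "(\<lambda>h. inner h a) = (\<lambda>h. inner h b)"
    unfolding gderiv_def by (rule has_derivative_unique)
  hence "inner (a - b) a = inner (a - b) b" by metis
  hence "inner (a - b) (a - b) = 0" by (simp add: inner_diff_right)
  thus "a = b" by simp
qed

lemma has_derivative_gradient_eventually_eq:
  assumes "(g has_derivative D) (at z)" "\<forall>\<^sub>F v in nhds z. GDERIV F v :> g v" "\<forall>\<^sub>F v in nhds z. GDERIV F v :> g' v"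
  shows "(g' has_derivative D) (at z)"
proof -
  have ev: "\<forall>\<^sub>F v in nhds z. g v = g' v"
    using assms(2,3) by eventually_elim (rule GDERIV_unique)
  have "\<forall>\<^sub>F v in at z within UNIV. g v = g' v"
    using ev by (simp add: eventually_at_filter eventually_mono)
  moreover have "g z = g' z" using ev by (rule eventually_nhds_x_imp_x)
  ultimately show ?thesis
    by (rule has_derivative_transform_eventually[OF assms(1)]) simp
qed

text \<open>Justifies the definite description in \<open>hessian\<close>.\<close>

lemma has_hessian_unique:
  assumes "has_hessian F A z" "has_hessian F B z"
  shows "A = B"
proof -
  obtain g where g: "\<forall>\<^sub>F v in nhds z. GDERIV F v :> g v" "(g has_derivative (\<lambda>h. A *v h)) (at z)"
    using assms(1) by (auto simp: has_hessian_def)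
  obtain g' where g': "\<forall>\<^sub>F v in nhds z. GDERIV F v :> g' v" "(g' has_derivative (\<lambda>h. B *v h)) (at z)"
    using assms(2) by (auto simp: has_hessian_def)
  have "(g' has_derivative (\<lambda>h. A *v h)) (at z)"
    by (rule has_derivative_gradient_eventually_eq[OF g(2) g(1) g'(1)])
  hence "(\<lambda>h. A *v h) = (\<lambda>h. B *v h)" using g'(2) by (rule has_derivative_unique)
  thus ?thesis by (simp add: matrix_eq fun_eq_iff)
qed

lemma hessian_eqI: "has_hessian F A z \<Longrightarrow> hessian F z = A"
  unfolding hessian_def by (rule the_equality) (auto intro: has_hessian_unique)

lemma abs_entry_le_linf_mat2: "\<bar>vec_nth (vec_nth A i) j\<bar> \<le> linf_mat2 A"
proof -
  have "{\<bar>vec_nth (vec_nth A i) j\<bar> | i j. True} = (\<lambda>(i, j). \<bar>vec_nth (vec_nth A i) j\<bar>) ` UNIV"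
    by auto
  hence "finite {\<bar>vec_nth (vec_nth A i) j\<bar> | i j. True}" by simp
  thus ?thesis unfolding linf_mat2_def by (intro Max_ge) auto
qed

lemma matrix_vector_mult_2:
  fixes A :: "real^2^2"
  shows "vec_nth (A *v w) i = vec_nth (vec_nth A i) 1 * vec_nth w 1 + vec_nth (vec_nth A i) 2 * vec_nth w 2"
  by (simp add: matrix_vector_mult_def sum_2)

text \<open>The Hessian of \<open>- ln d\<close>, by which the Hessians of \<open>Hcal f\<close> and
  \<open>Hfun f\<close> differ.\<close>

definition log_hessian :: "real^2 \<Rightarrow> real^2^2" where
  "log_hessian z = vector [vector [0, 0], vector [0, 1 / (vec_nth z 2)\<^sup>2]]"

lemma has_hessian_Hcal:
  assumes "has_hessian (Hfun f) A z" "0 < vec_nth z 2"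
  shows "has_hessian (Hcal f) (A + log_hessian z) z"
proof -
  obtain g where g: "\<forall>\<^sub>F v in nhds z. GDERIV (Hfun f) v :> g v" "(g has_derivative (\<lambda>h. A *v h)) (at z)"
    using assms(1) by (auto simp: has_hessian_def)
  have nth2: "((\<lambda>v :: real^2. vec_nth v 2) has_derivative (\<lambda>v. vec_nth v 2)) (at w)" for w
    by (rule bounded_linear_imp_has_derivative[OF bounded_linear_vec_nth])
  have "open {v :: real^2. 0 < vec_nth v 2}"
    by (intro open_Collect_less continuous_intros)
  hence ev: "\<forall>\<^sub>F v in nhds z. 0 < vec_nth v 2"
    using assms(2) eventually_nhds_in_open[of "{v :: real^2. 0 < vec_nth v 2}" z] by simp
  have "\<forall>\<^sub>F v in nhds z. GDERIV (Hcal f) v :> g v - vector [0, 1 / vec_nth v 2]"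
    using g(1) ev
  proof eventually_elim
    case (elim v)
    have "((\<lambda>v. ln (vec_nth v 2)) has_derivative (\<lambda>h. vec_nth h 2 * inverse (vec_nth v 2))) (at v)"
      using elim(2) by (auto intro!: derivative_eq_intros nth2 simp: field_simps)
    from has_derivative_diff[OF elim(1)[unfolded gderiv_def] this] show ?case
      unfolding gderiv_def Hcal_def
      by (rule has_derivative_eq_rhs)
        (simp add: fun_eq_iff inner_diff_right inner_vec_def sum_2 inverse_eq_divide algebra_simps)
  qed
  moreover have "((\<lambda>v. g v - vector [0, 1 / vec_nth v 2]) has_derivative (\<lambda>h. (A + log_hessian z) *v h)) (at z)"
  proof -
    have axis: "vector [0, x] = x *\<^sub>R (axis 2 1 :: real^2)" for x :: real
      by (simp add: Finite_Cartesian_Product.vec_eq_iff forall_2 axis_def)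
    have "((\<lambda>v. (1 / vec_nth v 2) *\<^sub>R (axis 2 1 :: real^2)) has_derivative
        (\<lambda>h. (- vec_nth h 2 / (vec_nth z 2)\<^sup>2) *\<^sub>R axis 2 1)) (at z)"
      using assms(2) by (auto intro!: derivative_eq_intros nth2 simp: power2_eq_square field_simps)
    hence "((\<lambda>v. vector [0, 1 / vec_nth v 2] :: real^2) has_derivative
        (\<lambda>h. vector [0, - vec_nth h 2 / (vec_nth z 2)\<^sup>2])) (at z)"
      unfolding axis .
    from has_derivative_diff[OF g(2) this] show ?thesis
      by (rule has_derivative_eq_rhs)
        (auto simp: fun_eq_iff Finite_Cartesian_Product.vec_eq_iff forall_2 matrix_vector_mult_2 log_hessian_def algebra_simps)
  qed
  ultimately show ?thesis
    unfolding has_hessian_def by (intro exI[of _ "\<lambda>v. g v - vector [0, 1 / vec_nth v 2]"] conjI)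
qed

locale smooth_noise = convex_noise +
  fixes LH :: real
  assumes H_hessian: "\<exists>\<delta>>0. (\<forall>z. dist01 z < \<delta> \<longrightarrow> (\<exists>A. has_hessian (Hfun f) A z)) \<and>
          continuous_on {z. dist01 z < \<delta>} (hessian (Hfun f))"
    and H_posdef: "positive_definite (hessian (Hfun f) (vector [0, 1]))"
    and H_lip: "\<exists>\<delta>>0. \<forall>z. dist01 z < \<delta> \<longrightarrow>
          linf_mat2 (hessian (Hcal f) z - hessian (Hcal f) (vector [0, 1])) \<le> LH * dist01 z"
begin

definition gr :: "real^2 \<Rightarrow> real^2" where
  "gr z = vector [hc (vec_nth z 1) (vec_nth z 2 - 1), hd (vec_nth z 1) (vec_nth z 2 - 1)]"

lemma open_dist01: "open {z. dist01 z < \<delta>}"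
  unfolding dist01_def by (intro open_Collect_less continuous_intros)

text \<open>By the subgradient inequality, \<open>z\<close> minimizes \<open>Hfun f\<close> minus
  the linear function given by \<open>gr z\<close> on a neighbourhood, so an existing gradient must
  be \<open>gr z\<close>.\<close>

lemma GDERIV_Hfun_eq:
  assumes "dist01 z < M0" "GDERIV (Hfun f) z :> g"
  shows "g = gr z"
proof -
  have eta: "vector [vec_nth v 1, vec_nth v 2] = v" for v :: "real^2"
    by (simp add: Finite_Cartesian_Product.vec_eq_iff forall_2)
  define \<psi> where "\<psi> v = Hfun f v - inner v (gr z)" for v
  have "(\<psi> has_derivative (\<lambda>h. inner h g - inner h (gr z))) (at z)"
    using assms(2) unfolding \<psi>_def gderiv_def by (intro derivative_intros)
  moreover have "\<forall>v\<in>{v. dist01 v < M0}. \<psi> z \<le> \<psi> v"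
  proof
    fix v :: "real^2" assume "v \<in> {v. dist01 v < M0}"
    hence "Hfun f z + hc (vec_nth z 1) (vec_nth z 2 - 1) * (vec_nth v 1 - vec_nth z 1)
       + hd (vec_nth z 1) (vec_nth z 2 - 1) * (vec_nth v 2 - 1 - (vec_nth z 2 - 1)) \<le> Hfun f v"
      using Hfun_subgradient[of "vec_nth z 1" "vec_nth z 2 - 1" "vec_nth v 1" "vec_nth v 2 - 1"] assms(1)
      by (simp add: dist01_def eta)
    thus "\<psi> z \<le> \<psi> v"
      by (simp add: \<psi>_def gr_def inner_vec_def sum_2 algebra_simps)
  qed
  ultimately have "(\<lambda>h. inner h g - inner h (gr z)) = (\<lambda>v. 0)"
    using differential_zero_maxmin[of z "{v. dist01 v < M0}" \<psi>] open_dist01 assms(1) by blast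
  hence "inner (g - gr z) g - inner (g - gr z) (gr z) = 0" by metis
  hence "inner (g - gr z) (g - gr z) = 0" by (simp add: inner_diff_right)
  thus ?thesis by simp
qed

lemma gr_has_derivative:
  assumes "dist01 z < M0" "has_hessian (Hfun f) A z"
  shows "(gr has_derivative (\<lambda>h. A *v h)) (at z)"
proof -
  obtain g where g: "\<forall>\<^sub>F v in nhds z. GDERIV (Hfun f) v :> g v" "(g has_derivative (\<lambda>h. A *v h)) (at z)"
    using assms(2) by (auto simp: has_hessian_def)
  have "\<forall>\<^sub>F v in nhds z. dist01 v < M0"
    using eventually_nhds_in_open[OF open_dist01] assms(1) by simp
  with g(1) have "\<forall>\<^sub>F v in nhds z. GDERIV (Hfun f) v :> gr v"
  proof eventually_elim
    case (elim v)
    with GDERIV_Hfun_eq[of v "g v"] show ?case by simp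
  qed
  thus ?thesis by (rule has_derivative_gradient_eventually_eq[OF g(2) g(1)])
qed

text \<open>The Lipschitz assumption concerns \<open>Hcal f\<close>. For \<open>d\<close> between
  1/2 and 3/2 the logarithmic part changes by at most \<open>|1 - d| * (5/2) / (1/4)\<close>, which
  explains the additional 10 in the constant.\<close>

lemma hessian_lipschitz:
  obtains \<rho> L where "0 < \<rho>" "\<rho> < M0" "0 \<le> L"
    "\<And>z. dist01 z \<le> \<rho> \<Longrightarrow> has_hessian (Hfun f) (hessian (Hfun f) z) z"
    "\<And>z i j. dist01 z \<le> \<rho> \<Longrightarrow>
       \<bar>vec_nth (vec_nth (hessian (Hfun f) z) i) j - vec_nth (vec_nth (hessian (Hfun f) (vector [0, 1])) i) j\<bar> \<le> L * dist01 z"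
proof -
  obtain \<delta>1 where d1: "0 < \<delta>1" "\<And>z. dist01 z < \<delta>1 \<Longrightarrow> \<exists>A. has_hessian (Hfun f) A z"
    using H_hessian by blast
  obtain \<delta>2 where d2: "0 < \<delta>2" "\<And>z. dist01 z < \<delta>2 \<Longrightarrow>
      linf_mat2 (hessian (Hcal f) z - hessian (Hcal f) (vector [0, 1])) \<le> LH * dist01 z"
    using H_lip by blast
  define \<rho> where "\<rho> = min (min \<delta>1 \<delta>2) (min M0 1) / 2"
  have \<rho>: "0 < \<rho>" "\<rho> < \<delta>1" "\<rho> < \<delta>2" "\<rho> < M0" "\<rho> \<le> 1/2"
    using d1(1) d2(1) M0_pos by (auto simp: \<rho>_def)
  have hh: "has_hessian (Hfun f) (hessian (Hfun f) z) z" if "dist01 z \<le> \<rho>" for z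
    using d1(2)[of z] that \<rho> hessian_eqI by fastforce
  have zero: "dist01 (vector [0, 1]) = 0" by (simp add: dist01_def)
  have lip: "\<bar>vec_nth (vec_nth (hessian (Hfun f) z) i) j - vec_nth (vec_nth (hessian (Hfun f) (vector [0, 1])) i) j\<bar>
      \<le> (\<bar>LH\<bar> + 10) * dist01 z" if z: "dist01 z \<le> \<rho>" for z i j
  proof -
    have z2: "\<bar>vec_nth z 2 - 1\<bar> \<le> dist01 z" "\<bar>vec_nth z 2 - 1\<bar> \<le> 1/2"
      using z \<rho>(5) unfolding dist01_def by linarith+
    have dz: "0 \<le> dist01 z" by (simp add: dist01_def)
    define d where "d = vec_nth z 2"
    have d: "1/2 \<le> d" "d \<le> 3/2" using z2(2) unfolding d_def by linarith+
    have cal: "hessian (Hcal f) z = hessian (Hfun f) z + log_hessian z"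
      using d by (intro hessian_eqI has_hessian_Hcal hh z) (auto simp: d_def)
    have cal0: "hessian (Hcal f) (vector [0, 1]) = hessian (Hfun f) (vector [0, 1]) + log_hessian (vector [0, 1])"
      using \<rho> zero by (intro hessian_eqI has_hessian_Hcal hh) auto
    have "\<bar>vec_nth (vec_nth (hessian (Hcal f) z - hessian (Hcal f) (vector [0, 1])) i) j\<bar> \<le> \<bar>LH\<bar> * dist01 z"
      using abs_entry_le_linf_mat2[of "hessian (Hcal f) z - hessian (Hcal f) (vector [0, 1])" i j] d2(2)[of z] z \<rho>
        mult_right_mono[OF abs_ge_self[of LH] dz] by linarith
    moreover have "\<bar>vec_nth (vec_nth (log_hessian z - log_hessian (vector [0, 1])) i) j\<bar> \<le> 10 * dist01 z"
    proof -
      have "\<bar>1 / d\<^sup>2 - 1\<bar> = \<bar>1 - d\<bar> * (1 + d) / d\<^sup>2"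
      proof -
        have "1 / d\<^sup>2 - 1 = (1 - d) * (1 + d) / d\<^sup>2"
          using d by (simp add: power2_eq_square field_simps)
        thus ?thesis using d by (simp add: abs_mult)
      qed
      also have "\<dots> \<le> \<bar>1 - d\<bar> * (5/2) / (1/2)\<^sup>2"
        using d by (intro frac_le mult_mono power_mono) auto
      also have "\<dots> \<le> 10 * dist01 z" using z2(1) by (simp add: d_def power2_eq_square abs_minus_commute)
      finally have "\<bar>1 / d\<^sup>2 - 1\<bar> \<le> 10 * dist01 z" .
      thus ?thesis using dz exhaust_2[of i] exhaust_2[of j] by (auto simp: log_hessian_def d_def)
    qed
    ultimately show ?thesis unfolding cal cal0 by (simp add: algebra_simps)
  qed
  from \<rho>(1,4) hh lip show ?thesis by (intro that[of \<rho> "\<bar>LH\<bar> + 10"]) auto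
qed

text \<open>Mean value theorem for \<open>gr\<close> along the segment from the truth. The Lipschitz
  Hessian makes the remainder quadratic.\<close>

lemma gradient_expansion:
  obtains h11 h12 h22 a L \<rho> :: real where "0 < a" "0 < h11" "0 \<le> L" "0 < \<rho>" "\<rho> < M0"
    "\<And>c \<tau>. a * (c\<^sup>2 + \<tau>\<^sup>2) \<le> h11 * c\<^sup>2 + 2 * h12 * c * \<tau> + h22 * \<tau>\<^sup>2"
    "\<And>c \<tau>. \<bar>c\<bar> + \<bar>\<tau>\<bar> \<le> \<rho> \<Longrightarrow> \<bar>hc c \<tau> - hc 0 0 - (h11 * c + h12 * \<tau>)\<bar> \<le> L * (\<bar>c\<bar> + \<bar>\<tau>\<bar>)\<^sup>2"
    "\<And>c \<tau>. \<bar>c\<bar> + \<bar>\<tau>\<bar> \<le> \<rho> \<Longrightarrow> \<bar>hd c \<tau> - hd 0 0 - (h12 * c + h22 * \<tau>)\<bar> \<le> L * (\<bar>c\<bar> + \<bar>\<tau>\<bar>)\<^sup>2"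
proof -
  obtain \<rho> L where \<rho>: "0 < \<rho>" "\<rho> < M0" and L: "0 \<le> L"
    and hh: "\<And>z. dist01 z \<le> \<rho> \<Longrightarrow> has_hessian (Hfun f) (hessian (Hfun f) z) z"
    and lip: "\<And>z i j. dist01 z \<le> \<rho> \<Longrightarrow>
       \<bar>vec_nth (vec_nth (hessian (Hfun f) z) i) j - vec_nth (vec_nth (hessian (Hfun f) (vector [0, 1])) i) j\<bar> \<le> L * dist01 z"
    using hessian_lipschitz by metis
  define A where "A z = hessian (Hfun f) z" for z
  define z0 :: "real^2" where "z0 = vector [0, 1]"
  define h11 where "h11 = vec_nth (vec_nth (A z0) 1) 1"
  define h12 where "h12 = vec_nth (vec_nth (A z0) 1) 2"
  define h22 where "h22 = vec_nth (vec_nth (A z0) 2) 2"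
  have h21: "vec_nth (vec_nth (A z0) 2) 1 = h12"
  proof -
    have "vec_nth (vec_nth (Finite_Cartesian_Product.transpose (A z0)) 1) 2 = vec_nth (vec_nth (A z0) 1) 2"
      using H_posdef by (simp add: positive_definite_def A_def z0_def)
    thus ?thesis by (simp add: Finite_Cartesian_Product.transpose_def h12_def)
  qed
  have pd: "0 < h11 * c\<^sup>2 + 2 * h12 * c * \<tau> + h22 * \<tau>\<^sup>2" if "c \<noteq> 0 \<or> \<tau> \<noteq> 0" for c \<tau>
  proof -
    have "(vector [c, \<tau>] :: real^2) \<noteq> 0" using that by (auto simp: Finite_Cartesian_Product.vec_eq_iff forall_2)
    hence "0 < inner (vector [c, \<tau>]) (A z0 *v vector [c, \<tau>])"
      using H_posdef by (auto simp: positive_definite_def A_def z0_def)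
    thus ?thesis
      by (simp add: inner_vec_def sum_2 matrix_vector_mult_2 h21 h11_def[symmetric] h12_def[symmetric]
          h22_def[symmetric] power2_eq_square algebra_simps)
  qed
  have h11: "0 < h11" and h22: "0 < h22" using pd[of 1 0] pd[of 0 1] by auto
  define D where "D = h11 * h22 - h12\<^sup>2"
  have "0 < h11 * D"
    using pd[of "- h12" h11] h11 by (simp add: D_def power2_eq_square algebra_simps)
  hence D: "0 < D" using h11 by (simp add: zero_less_mult_iff)
  \<comment> \<open>Determinant over trace, a lower bound for the smallest eigenvalue of a positive
    definite 2 by 2 matrix.\<close>
  define a where "a = D / (h11 + h22)"
  have a: "0 < a" using D h11 h22 by (simp add: a_def)
  have quad: "a * (c\<^sup>2 + \<tau>\<^sup>2) \<le> h11 * c\<^sup>2 + 2 * h12 * c * \<tau> + h22 * \<tau>\<^sup>2" for c \<tau>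
  proof -
    \<comment> \<open>The Cayley-Hamilton identity, paired with \<open>(c, \<tau>)\<close>: trace
      times the quadratic form minus determinant times the squared norm is the squared norm of the
      image vector.\<close>
    have "(h11 + h22) * (h11 * c\<^sup>2 + 2 * h12 * c * \<tau> + h22 * \<tau>\<^sup>2) - D * (c\<^sup>2 + \<tau>\<^sup>2)
        = (h11 * c + h12 * \<tau>)\<^sup>2 + (h12 * c + h22 * \<tau>)\<^sup>2"
      by (simp add: D_def power2_eq_square algebra_simps)
    hence "D * (c\<^sup>2 + \<tau>\<^sup>2) \<le> (h11 + h22) * (h11 * c\<^sup>2 + 2 * h12 * c * \<tau> + h22 * \<tau>\<^sup>2)"
      by (smt (verit) zero_le_power2)
    thus ?thesis using h11 h22 by (simp add: a_def field_simps)
  qed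
  have exp: "\<bar>vec_nth (gr z) i - vec_nth (gr z0) i - vec_nth (A z0 *v (z - z0)) i\<bar> \<le> L * (dist01 z)\<^sup>2"
    if z: "dist01 z \<le> \<rho>" for z i
  proof -
    define w where "w = z - z0"
    have dw: "dist01 (z0 + s *\<^sub>R w) = s * dist01 z" if "0 \<le> s" for s
      using that by (simp add: dist01_def w_def z0_def abs_mult distrib_left flip: right_diff_distrib)
    have der: "((\<lambda>s. vec_nth (gr (z0 + s *\<^sub>R w)) i) has_field_derivative vec_nth (A (z0 + s *\<^sub>R w) *v w) i) (at s)"
      if s: "0 \<le> s" "s \<le> 1" for s
    proof -
      have dd: "0 \<le> dist01 z" by (simp add: dist01_def)
      have "dist01 (z0 + s *\<^sub>R w) \<le> \<rho>"
        using dw[OF s(1)] z s mult_left_le_one_le[OF dd s(1,2)] by simp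
      hence "(gr has_derivative (\<lambda>h. A (z0 + s *\<^sub>R w) *v h)) (at (z0 + s *\<^sub>R w))"
        unfolding A_def using \<rho> by (intro gr_has_derivative hh) auto
      moreover have "((\<lambda>s. z0 + s *\<^sub>R w) has_derivative (\<lambda>h. h *\<^sub>R w)) (at s)"
        by (auto intro!: derivative_eq_intros)
      ultimately have "((\<lambda>s. gr (z0 + s *\<^sub>R w)) has_derivative (\<lambda>h. A (z0 + s *\<^sub>R w) *v (h *\<^sub>R w))) (at s)"
        using has_derivative_compose[of "\<lambda>s. z0 + s *\<^sub>R w" "\<lambda>h. h *\<^sub>R w" s UNIV gr] by simp
      hence "((\<lambda>s. vec_nth (gr (z0 + s *\<^sub>R w)) i) has_derivative (\<lambda>h. vec_nth (A (z0 + s *\<^sub>R w) *v (h *\<^sub>R w)) i)) (at s)"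
        by (rule bounded_linear.has_derivative[OF bounded_linear_vec_nth])
      thus ?thesis
        unfolding has_field_derivative_def
        by (rule has_derivative_eq_rhs) (simp add: fun_eq_iff matrix_vector_mult_2 algebra_simps)
    qed
    obtain s where s: "0 < s" "s < 1"
      "vec_nth (gr (z0 + 1 *\<^sub>R w)) i - vec_nth (gr (z0 + 0 *\<^sub>R w)) i = (1 - 0) * vec_nth (A (z0 + s *\<^sub>R w) *v w) i"
      using MVT2[of 0 1 "\<lambda>s. vec_nth (gr (z0 + s *\<^sub>R w)) i" "\<lambda>s. vec_nth (A (z0 + s *\<^sub>R w) *v w) i"] der by auto
    have dz: "0 \<le> dist01 z" by (simp add: dist01_def)
    have sz: "s * dist01 z \<le> dist01 z" using s dz by (simp add: mult_left_le_one_le)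
    define E where "E j = vec_nth (vec_nth (A (z0 + s *\<^sub>R w)) i) j - vec_nth (vec_nth (A z0) i) j" for j
    have E: "\<bar>E j\<bar> \<le> L * dist01 z" for j
    proof -
      have "\<bar>E j\<bar> \<le> L * dist01 (z0 + s *\<^sub>R w)"
        unfolding E_def A_def z0_def using dw[of s] s z sz by (intro lip) (simp add: z0_def)
      also have "\<dots> \<le> L * dist01 z" using dw[of s] s sz L by (intro mult_left_mono) auto
      finally show ?thesis .
    qed
    have "vec_nth (gr z) i - vec_nth (gr z0) i - vec_nth (A z0 *v (z - z0)) i = E 1 * vec_nth w 1 + E 2 * vec_nth w 2"
      using s(3) by (simp add: w_def E_def matrix_vector_mult_2 algebra_simps)
    hence "\<bar>vec_nth (gr z) i - vec_nth (gr z0) i - vec_nth (A z0 *v (z - z0)) i\<bar>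
        \<le> \<bar>E 1\<bar> * \<bar>vec_nth w 1\<bar> + \<bar>E 2\<bar> * \<bar>vec_nth w 2\<bar>"
      by (metis abs_mult abs_triangle_ineq)
    also have "\<dots> \<le> L * dist01 z * \<bar>vec_nth w 1\<bar> + L * dist01 z * \<bar>vec_nth w 2\<bar>"
      by (intro add_mono mult_right_mono E) auto
    also have "\<dots> = L * (dist01 z)\<^sup>2"
      by (simp add: w_def z0_def dist01_def power2_eq_square algebra_simps)
    finally show ?thesis .
  qed
  have e1: "\<bar>hc c \<tau> - hc 0 0 - (h11 * c + h12 * \<tau>)\<bar> \<le> L * (\<bar>c\<bar> + \<bar>\<tau>\<bar>)\<^sup>2"
    and e2: "\<bar>hd c \<tau> - hd 0 0 - (h12 * c + h22 * \<tau>)\<bar> \<le> L * (\<bar>c\<bar> + \<bar>\<tau>\<bar>)\<^sup>2"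
    if "\<bar>c\<bar> + \<bar>\<tau>\<bar> \<le> \<rho>" for c \<tau>
    using exp[of "vector [c, 1 + \<tau>]" 1] exp[of "vector [c, 1 + \<tau>]" 2] that
    by (simp_all add: dist01_def gr_def z0_def[symmetric] matrix_vector_mult_2 h21 h11_def[symmetric]
        h12_def[symmetric] h22_def[symmetric]) (simp_all add: z0_def)
  show ?thesis
    by (rule that[OF a h11 L \<rho> quad e1 e2])
qed

end

subsection \<open>The reparametrized exp-Lasso\<close>

text \<open>A closed subset of a product of compact intervals, compact by Tychonoff's
  theorem.\<close>

lemma compact_l1_ball: "compact (l1_ball p m)"
proof -
  define box :: "nat \<Rightarrow> real set" where "box k = (if k \<le> p then {-m..m} else {0})" for k
  have "compactin (product_topology (\<lambda>_. euclidean) UNIV) (PiE UNIV box)"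
    unfolding compactin_PiE by (auto simp: box_def compactin_euclidean_iff)
  hence "compact (PiE UNIV box)"
    by (simp add: euclidean_product_topology compactin_euclidean_iff)
  moreover have "closed {t :: nat \<Rightarrow> real. (\<Sum>k\<le>p. \<bar>t k\<bar>) \<le> m}"
    by (intro closed_Collect_le continuous_intros continuous_on_product_coordinates)
  moreover have "l1_ball p m = PiE UNIV box \<inter> {t. (\<Sum>k\<le>p. \<bar>t k\<bar>) \<le> m}"
  proof -
    have bd: "t k \<le> m" "- m \<le> t k" if "(\<Sum>k\<le>p. \<bar>t k\<bar>) \<le> m" "k \<le> p" for t :: "nat \<Rightarrow> real" and k
      using member_le_sum[of k "{..p}" "\<lambda>k. \<bar>t k\<bar>"] that by auto
    show ?thesis by (auto simp: l1_ball_def box_def PiE_iff bd split: if_splits)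
  qed
  ultimately show ?thesis by (simp add: compact_Int_closed)
qed

text \<open>One-dimensional optimality condition in which \<open>z\<close> is a subgradient of the
  absolute value. Each violated inequality for \<open>D\<close> yields a small step that decreases
  the penalized function; the step must not cross the kink at \<open>- c\<close>.\<close>

lemma l1_penalty_stationary:
  fixes F :: "real \<Rightarrow> real"
  assumes lam: "0 < lam" and D: "(F has_field_derivative D) (at y0)"
    and min: "\<And>y. F y0 + lam * \<bar>c + y0\<bar> \<le> F y + lam * \<bar>c + y\<bar>"
  shows "\<exists>z. \<bar>z\<bar> \<le> 1 \<and> z * (c + y0) = \<bar>c + y0\<bar> \<and> D = - lam * z"
proof -
  have Dp: "((\<lambda>y. F y + lam * y) has_field_derivative D + lam) (at y0)"
    and Dm: "((\<lambda>y. F y - lam * y) has_field_derivative D - lam) (at y0)"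
    using D by (auto intro!: derivative_eq_intros)
  have 1: "- lam \<le> D"
  proof (rule ccontr)
    assume "\<not> - lam \<le> D"
    then obtain d where d: "0 < d" "\<And>h. 0 < h \<Longrightarrow> h < d \<Longrightarrow> F (y0 + h) + lam * (y0 + h) < F y0 + lam * y0"
      using DERIV_neg_dec_right[OF Dp] by auto
    have "lam * \<bar>c + (y0 + d/2)\<bar> \<le> lam * (\<bar>c + y0\<bar> + d/2)"
      using lam d(1) by (intro mult_left_mono) auto
    with d(2)[of "d/2"] d(1) min[of "y0 + d/2"] show False by (simp add: algebra_simps)
  qed
  have 2: "D \<le> lam"
  proof (rule ccontr)
    assume "\<not> D \<le> lam"
    then obtain d where d: "0 < d" "\<And>h. 0 < h \<Longrightarrow> h < d \<Longrightarrow> F (y0 - h) - lam * (y0 - h) < F y0 - lam * y0"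
      using DERIV_pos_inc_left[OF Dm] by auto
    have "lam * \<bar>c + (y0 - d/2)\<bar> \<le> lam * (\<bar>c + y0\<bar> + d/2)"
      using lam d(1) by (intro mult_left_mono) auto
    with d(2)[of "d/2"] d(1) min[of "y0 - d/2"] show False by (simp add: algebra_simps)
  qed
  have 3: "D \<le> - lam" if c: "0 < c + y0"
  proof (rule ccontr)
    assume "\<not> D \<le> - lam"
    then obtain d where d: "0 < d" "\<And>h. 0 < h \<Longrightarrow> h < d \<Longrightarrow> F (y0 - h) + lam * (y0 - h) < F y0 + lam * y0"
      using DERIV_pos_inc_left[OF Dp] by auto
    obtain k where k: "0 < k" "k < d" "k \<le> c + y0"
      using d(1) c by (intro that[of "min (d/2) (c + y0)"]) auto
    have "\<bar>c + (y0 - k)\<bar> = c + (y0 - k)" "\<bar>c + y0\<bar> = c + y0" using c k by auto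
    with d(2)[OF k(1,2)] min[of "y0 - k"] show False by (simp add: algebra_simps)
  qed
  have 4: "lam \<le> D" if c: "c + y0 < 0"
  proof (rule ccontr)
    assume "\<not> lam \<le> D"
    then obtain d where d: "0 < d" "\<And>h. 0 < h \<Longrightarrow> h < d \<Longrightarrow> F (y0 + h) - lam * (y0 + h) < F y0 - lam * y0"
      using DERIV_neg_dec_right[OF Dm] by auto
    obtain k where k: "0 < k" "k < d" "k \<le> - (c + y0)"
      using d(1) c by (intro that[of "min (d/2) (- (c + y0))"]) auto
    have "\<bar>c + (y0 + k)\<bar> = - (c + (y0 + k))" "\<bar>c + y0\<bar> = - (c + y0)" using c k by auto
    with d(2)[OF k(1,2)] min[of "y0 + k"] show False by (simp add: algebra_simps)
  qed
  show ?thesis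
  proof (intro exI[of _ "- D / lam"] conjI)
    show "\<bar>- D / lam\<bar> \<le> 1" using 1 2 lam by (auto simp: abs_le_iff field_simps)
    show "D = - lam * (- D / lam)" using lam by simp
    show "- D / lam * (c + y0) = \<bar>c + y0\<bar>"
      using 1 2 3 4 lam by (cases "c + y0" "0::real" rule: linorder_cases) auto
  qed
qed

text \<open>The estimation problem in the parameters \<open>(d \<beta> - d \<beta>\<^sup>*, d - 1)\<close>, where \<open>d = 1 / \<sigma>\<close>: coordinate
  \<open>p\<close> of \<open>t\<close> is \<open>d - 1\<close>. In these coordinates the empirical risk is \<open>risk t - ln (1 + t p)\<close> and the
  objective is the quotient of a convex function by the linear function \<open>1 + t p\<close>, so that its
  sublevel sets are convex.\<close>

locale lasso_sample =
  fixes l h :: "real \<Rightarrow> real" and n p :: nat and x :: "nat \<Rightarrow> nat \<Rightarrow> real"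
    and e b :: "nat \<Rightarrow> real" and lam :: real
  assumes n_pos: "0 < n" and p_pos: "0 < p" and lam_pos: "0 < lam"
    and l_tangent: "l u + h u * (w - u) \<le> l w"
    and l_deriv: "(l has_field_derivative h u) (at u)"
begin

definition risk :: "(nat \<Rightarrow> real) \<Rightarrow> real" where
  "risk t = (\<Sum>i<n. l (e i + lin p (x i) (e i) t)) / n"

definition grad :: "(nat \<Rightarrow> real) \<Rightarrow> nat \<Rightarrow> real" where
  "grad t j = (\<Sum>i<n. h (e i + lin p (x i) (e i) t) * feat p (x i) (e i) j) / n"

text \<open>The summands are the coordinates of \<open>d * \<beta>\<close>, so this is the
  \<open>l1\<close> norm of the penalized coefficients multiplied by \<open>d\<close>.\<close>

definition pen :: "(nat \<Rightarrow> real) \<Rightarrow> real" where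
  "pen t = (\<Sum>j\<in>{1..<p}. \<bar>(1 + t p) * b j + t j\<bar>)"

definition obj :: "(nat \<Rightarrow> real) \<Rightarrow> real" where
  "obj t = (exp (risk t) + lam * pen t) / (1 + t p)"

definition S :: "nat set" where "S = {j\<in>{1..<p}. b j \<noteq> 0}"

definition norm1 :: "(nat \<Rightarrow> real) \<Rightarrow> real" where "norm1 t = (\<Sum>k\<le>p. \<bar>t k\<bar>)"

definition xt :: "nat \<Rightarrow> (nat \<Rightarrow> real) \<Rightarrow> real" where "xt i t = (\<Sum>k<p. x i k * t k)"

definition vX :: "(nat \<Rightarrow> real) \<Rightarrow> real" where "vX t = (\<Sum>i<n. (xt i t)\<^sup>2) / n"

text \<open>The random factor \<open>exp (mean loss of the noise)\<close> that also appears in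
  \<open>lambda_star\<close>.\<close>

definition e0 :: real where "e0 = exp (risk (\<lambda>_. 0))"

definition admissible :: "(nat \<Rightarrow> real) set" where
  "admissible = {t. (\<forall>k>p. t k = 0) \<and> 0 < 1 + t p}"

lemma sum_atMost_p: "(\<Sum>k\<le>p. F k) = (\<Sum>k<p. F k) + (F p :: real)"
  by (simp add: lessThan_Suc_atMost[symmetric])

lemma sum_lessThan_p: "(\<Sum>k<p. F k) = F 0 + (\<Sum>j\<in>S. F j) + (\<Sum>j\<in>{1..<p} - S. F j :: real)"
proof -
  have "{..<p} = insert 0 {1..<p}" using p_pos by auto
  hence "(\<Sum>k<p. F k) = F 0 + (\<Sum>j\<in>{1..<p}. F j)" by simp
  also have "(\<Sum>j\<in>{1..<p}. F j) = (\<Sum>j\<in>{1..<p} - S. F j) + (\<Sum>j\<in>S. F j)"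
    by (rule sum.subset_diff) (auto simp: S_def)
  finally show ?thesis by simp
qed

lemma risk_tangent: "risk t + (\<Sum>j\<le>p. grad t j * (t' j - t j)) \<le> risk t'"
proof -
  have "(\<Sum>j\<le>p. grad t j * (t' j - t j))
      = (\<Sum>j\<le>p. \<Sum>i<n. h (e i + lin p (x i) (e i) t) * feat p (x i) (e i) j * (t' j - t j)) / n"
    by (simp add: grad_def sum_distrib_right sum_divide_distrib)
  also have "\<dots> = (\<Sum>i<n. h (e i + lin p (x i) (e i) t) * lin p (x i) (e i) (\<lambda>k. t' k - t k)) / n"
  proof -
    have "(\<Sum>j\<le>p. v * feat p (x i) (e i) j * (t' j - t j)) = v * lin p (x i) (e i) (\<lambda>k. t' k - t k)" for v i
      by (simp add: lin_def sum_distrib_left mult.assoc)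
    thus ?thesis by (subst sum.swap) simp
  qed
  finally have "risk t + (\<Sum>j\<le>p. grad t j * (t' j - t j))
     = (\<Sum>i<n. l (e i + lin p (x i) (e i) t) + h (e i + lin p (x i) (e i) t) *
         (lin p (x i) (e i) t' - lin p (x i) (e i) t)) / n"
    by (simp add: risk_def sum.distrib add_divide_distrib lin_diff)
  also have "\<dots> \<le> risk t'"
    unfolding risk_def
  proof (intro divide_right_mono sum_mono)
    fix i
    show "l (e i + lin p (x i) (e i) t) + h (e i + lin p (x i) (e i) t) *
         (lin p (x i) (e i) t' - lin p (x i) (e i) t) \<le> l (e i + lin p (x i) (e i) t')"
      using l_tangent[of "e i + lin p (x i) (e i) t" "e i + lin p (x i) (e i) t'"] by simp
  qed simp
  finally show ?thesis .
qed

lemma risk_convex_ray: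
  assumes "0 \<le> u" "u \<le> 1"
  shows "risk (\<lambda>k. u * t k) \<le> u * risk t + (1 - u) * risk (\<lambda>_. 0)"
proof -
  define D where "D = (\<Sum>j\<le>p. grad (\<lambda>k. u * t k) j * t j)"
  have "risk (\<lambda>k. u * t k) + (1 - u) * D \<le> risk t"
    using risk_tangent[of "\<lambda>k. u * t k" t]
    by (simp add: D_def sum_distrib_left algebra_simps)
  hence "u * (risk (\<lambda>k. u * t k) + (1 - u) * D) \<le> u * risk t" using assms by (intro mult_left_mono)
  moreover have "risk (\<lambda>k. u * t k) - u * D \<le> risk (\<lambda>_. 0)"
    using risk_tangent[of "\<lambda>k. u * t k" "\<lambda>_. 0"]
    by (simp add: D_def sum_distrib_left sum_negf algebra_simps)
  hence "(1 - u) * (risk (\<lambda>k. u * t k) - u * D) \<le> (1 - u) * risk (\<lambda>_. 0)"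
    using assms by (intro mult_left_mono) auto
  ultimately show ?thesis by (simp add: algebra_simps)
qed

lemma pen_zero: "pen (\<lambda>_. 0) = (\<Sum>j\<in>{1..<p}. \<bar>b j\<bar>)"
  by (simp add: pen_def)

lemma obj_zero: "obj (\<lambda>_. 0) = e0 + lam * pen (\<lambda>_. 0)"
  by (simp add: obj_def e0_def)

lemma pen_ray:
  assumes "0 \<le> u" "u \<le> 1"
  shows "pen (\<lambda>k. u * t k) \<le> u * pen t + (1 - u) * pen (\<lambda>_. 0)"
proof -
  have "pen (\<lambda>k. u * t k) \<le> (\<Sum>j\<in>{1..<p}. u * \<bar>(1 + t p) * b j + t j\<bar> + (1 - u) * \<bar>b j\<bar>)"
    unfolding pen_def
  proof (rule sum_mono)
    fix j
    have "(1 + u * t p) * b j + u * t j = u * ((1 + t p) * b j + t j) + (1 - u) * b j"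
      by (simp add: algebra_simps)
    hence "\<bar>(1 + u * t p) * b j + u * t j\<bar> \<le> \<bar>u * ((1 + t p) * b j + t j)\<bar> + \<bar>(1 - u) * b j\<bar>"
      by (metis abs_triangle_ineq)
    thus "\<bar>(1 + u * t p) * b j + u * t j\<bar> \<le> u * \<bar>(1 + t p) * b j + t j\<bar> + (1 - u) * \<bar>b j\<bar>"
      using assms by (simp add: abs_mult)
  qed
  thus ?thesis by (simp add: pen_def sum.distrib sum_distrib_left)
qed

lemma obj_ray:
  assumes u: "0 \<le> u" "u \<le> 1" and t: "0 < 1 + t p" "obj t \<le> obj (\<lambda>_. 0)"
  shows "0 < 1 + u * t p" "obj (\<lambda>k. u * t k) \<le> obj (\<lambda>_. 0)"
proof -
  show pos: "0 < 1 + u * t p"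
  proof -
    have "1 + u * t p = u * (1 + t p) + (1 - u)" by (simp add: algebra_simps)
    moreover have "0 < u * (1 + t p) + (1 - u)"
      using u t by (cases "u = 1") (auto intro!: add_nonneg_pos mult_nonneg_nonneg)
    ultimately show ?thesis by simp
  qed
  have "exp (risk (\<lambda>k. u * t k)) \<le> exp (u * risk t + (1 - u) * risk (\<lambda>_. 0))"
    using risk_convex_ray[OF u] by simp
  also have "\<dots> \<le> u * exp (risk t) + (1 - u) * e0"
    using convex_onD[OF exp_convex, of u "risk (\<lambda>_. 0)" "risk t"] u
    by (simp add: e0_def add.commute)
  finally have "exp (risk (\<lambda>k. u * t k)) + lam * pen (\<lambda>k. u * t k)
      \<le> u * (exp (risk t) + lam * pen t) + (1 - u) * obj (\<lambda>_. 0)"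
    using mult_left_mono[OF pen_ray[OF u, of t], of lam] lam_pos
    by (simp add: obj_zero algebra_simps)
  also have "\<dots> \<le> u * ((1 + t p) * obj (\<lambda>_. 0)) + (1 - u) * obj (\<lambda>_. 0)"
    using t u by (intro add_right_mono mult_left_mono) (auto simp: obj_def[of t] field_simps)
  also have "\<dots> = obj (\<lambda>_. 0) * (1 + u * t p)" by (simp add: algebra_simps)
  finally show "obj (\<lambda>k. u * t k) \<le> obj (\<lambda>_. 0)"
    using pos unfolding obj_def[of "\<lambda>k. u * t k"] by (simp add: divide_le_eq)
qed

text \<open>The bound \<open>exp y \<ge> 1 + y\<close> for the risk increment reduces the sublevel
  condition to a linear one, in which \<open>e0 * t p\<close> from the denominator cancels against
  the mean one of the score in the scale direction. Coordinates outside \<open>S\<close> enter the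
  penalty with a positive sign, and the margin \<open>\<eta>\<close> of the score leaves
  \<open>\<eta> * lam\<close> times their norm.\<close>

lemma basic_inequality:
  assumes t: "0 < 1 + t p" "obj t \<le> obj (\<lambda>_. 0)"
    and score: "\<And>j. j < p \<Longrightarrow> e0 * \<bar>grad (\<lambda>_. 0) j\<bar> \<le> (1 - \<eta>) * lam"
    and score_p: "\<bar>grad (\<lambda>_. 0) p - 1\<bar> \<le> r"
    and mono: "a1 * (vX t + (t p)\<^sup>2) - \<epsilon> \<le> (\<Sum>j\<le>p. (grad (\<lambda>k. 1/2 * t k) j - grad (\<lambda>_. 0) j) * t j)"
    and \<eta>: "0 \<le> \<eta>"
  shows "\<eta> * lam * (\<Sum>j\<in>{1..<p} - S. \<bar>t j\<bar>) + e0 * (a1 / 2) * (vX t + (t p)\<^sup>2)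
     \<le> 2 * lam * (\<bar>t 0\<bar> + (\<Sum>j\<in>S. \<bar>t j\<bar>)) + e0 * r * \<bar>t p\<bar> + e0 * (\<epsilon> / 2)"
proof -
  define th where "th = (\<lambda>k. 1/2 * t k)"
  have th: "th k = 1/2 * t k" for k by (simp add: th_def)
  note mono = mono[folded th_def]
  define \<tau> where "\<tau> = t p"
  define NS where "NS = (\<Sum>j\<in>S. \<bar>t j\<bar>)"
  define NN where "NN = (\<Sum>j\<in>{1..<p} - S. \<bar>t j\<bar>)"
  define DL where "DL = risk t - risk (\<lambda>_. 0)"
  have e0: "0 < e0" by (simp add: e0_def)
  have le: "exp (risk t) + lam * pen t \<le> (1 + \<tau>) * (e0 + lam * pen (\<lambda>_. 0))"
    using t by (simp add: obj_def[of t] obj_zero \<tau>_def field_simps)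
  have "exp (risk t) = e0 * exp DL" by (simp add: e0_def DL_def flip: exp_add)
  hence ex: "e0 * (1 + DL) \<le> exp (risk t)" using e0 exp_ge_add_one_self[of DL] by simp
  have pen: "(1 + \<tau>) * pen (\<lambda>_. 0) - NS + NN \<le> pen t"
  proof -
    have sp: "(\<Sum>j\<in>{1..<p}. F j) = (\<Sum>j\<in>{1..<p} - S. F j) + (\<Sum>j\<in>S. F j)" for F :: "nat \<Rightarrow> real"
      by (rule sum.subset_diff) (auto simp: S_def)
    have "(\<Sum>j\<in>S. (1 + \<tau>) * \<bar>b j\<bar> - \<bar>t j\<bar>) \<le> (\<Sum>j\<in>S. \<bar>(1 + t p) * b j + t j\<bar>)"
    proof (rule sum_mono)
      fix j
      have "\<bar>(1 + \<tau>) * b j\<bar> = (1 + \<tau>) * \<bar>b j\<bar>" using t(1) by (simp add: abs_mult \<tau>_def)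
      thus "(1 + \<tau>) * \<bar>b j\<bar> - \<bar>t j\<bar> \<le> \<bar>(1 + t p) * b j + t j\<bar>" by (simp add: \<tau>_def)
    qed
    moreover have "(\<Sum>j\<in>{1..<p} - S. \<bar>(1 + t p) * b j + t j\<bar>) = NN"
      unfolding NN_def by (intro sum.cong) (auto simp: S_def)
    moreover have "(\<Sum>j\<in>{1..<p} - S. \<bar>b j\<bar>) = 0" by (intro sum.neutral) (auto simp: S_def)
    ultimately show ?thesis
      unfolding pen_def pen_zero sp by (simp add: NS_def sum_subtractf sum_distrib_left)
  qed
  have "e0 * (1 + DL) + lam * ((1 + \<tau>) * pen (\<lambda>_. 0) - NS + NN) \<le> (1 + \<tau>) * (e0 + lam * pen (\<lambda>_. 0))"
    using le ex mult_left_mono[OF pen, of lam] lam_pos by linarith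
  hence main: "e0 * (DL - \<tau>) + lam * (NN - NS) \<le> 0" by (simp add: algebra_simps)
  define S0 S1 SD where "S0 = (\<Sum>j\<le>p. grad (\<lambda>_. 0) j * t j)" and "S1 = (\<Sum>j\<le>p. grad th j * t j)"
    and "SD = (\<Sum>j\<le>p. (grad th j - grad (\<lambda>_. 0) j) * t j)"
  have SD: "SD = S1 - S0" by (simp add: SD_def S1_def S0_def left_diff_distrib sum_subtractf)
  \<comment> \<open>Tangent inequalities from 0 to the midpoint \<open>th\<close> and from there to
    \<open>t\<close>. Their sum gains half of the gradient increment at the midpoint over the linear
    bound, without any second derivative of the loss.\<close>
  have "risk (\<lambda>_. 0) + S0 / 2 \<le> risk th"
    using risk_tangent[of "\<lambda>_. 0" th] by (simp add: th S0_def sum_divide_distrib[symmetric])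
  moreover have "risk th + S1 / 2 \<le> risk t"
  proof -
    have "grad th j * (t j - th j) = grad th j * t j / 2" for j
      by (simp add: th)
    thus ?thesis using risk_tangent[of th t] by (simp only: sum_divide_distrib S1_def)
  qed
  moreover define Y where "Y = a1 * (vX t + \<tau>\<^sup>2) - \<epsilon>"
  moreover have "Y \<le> SD"
    using mono by (simp add: SD_def \<tau>_def Y_def)
  ultimately have "S0 + 1/2 * Y \<le> DL"
    using SD unfolding DL_def by linarith
  hence DL1: "(\<Sum>j\<le>p. grad (\<lambda>_. 0) j * t j) + 1/2 * (a1 * (vX t + \<tau>\<^sup>2) - \<epsilon>) \<le> DL"
    by (simp only: S0_def Y_def)
  have "- ((1 - \<eta>) * lam * (\<bar>t 0\<bar> + NS + NN)) \<le> e0 * (\<Sum>j<p. grad (\<lambda>_. 0) j * t j)"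
  proof -
    have "(\<Sum>j<p. - ((1 - \<eta>) * lam * \<bar>t j\<bar>)) \<le> (\<Sum>j<p. e0 * (grad (\<lambda>_. 0) j * t j))"
    proof (rule sum_mono)
      fix j assume "j \<in> {..<p}"
      hence "e0 * \<bar>grad (\<lambda>_. 0) j\<bar> * \<bar>t j\<bar> \<le> (1 - \<eta>) * lam * \<bar>t j\<bar>"
        using score by (intro mult_right_mono) auto
      moreover have "\<bar>e0 * (grad (\<lambda>_. 0) j * t j)\<bar> = e0 * \<bar>grad (\<lambda>_. 0) j\<bar> * \<bar>t j\<bar>"
        using e0 by (simp add: abs_mult)
      ultimately show "- ((1 - \<eta>) * lam * \<bar>t j\<bar>) \<le> e0 * (grad (\<lambda>_. 0) j * t j)" by linarith
    qed
    moreover have "(\<Sum>j<p. - ((1 - \<eta>) * lam * \<bar>t j\<bar>)) = - ((1 - \<eta>) * lam * (\<Sum>j<p. \<bar>t j\<bar>))"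
      by (simp only: sum_negf sum_distrib_left)
    moreover have "(\<Sum>j<p. e0 * (grad (\<lambda>_. 0) j * t j)) = e0 * (\<Sum>j<p. grad (\<lambda>_. 0) j * t j)"
      by (simp only: sum_distrib_left)
    moreover have "(\<Sum>j<p. \<bar>t j\<bar>) = \<bar>t 0\<bar> + NS + NN"
      unfolding sum_lessThan_p NS_def NN_def ..
    ultimately show ?thesis by simp
  qed
  moreover have "e0 * (\<tau> - r * \<bar>\<tau>\<bar>) \<le> e0 * (grad (\<lambda>_. 0) p * \<tau>)"
  proof -
    have "\<bar>(grad (\<lambda>_. 0) p - 1) * \<tau>\<bar> \<le> r * \<bar>\<tau>\<bar>"
      using score_p by (simp add: abs_mult mult_right_mono)
    hence "\<tau> - r * \<bar>\<tau>\<bar> \<le> grad (\<lambda>_. 0) p * \<tau>" by (simp add: algebra_simps abs_le_iff)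
    thus ?thesis using e0 by simp
  qed
  ultimately have "- ((1 - \<eta>) * lam * (\<bar>t 0\<bar> + NS + NN)) + e0 * (\<tau> - r * \<bar>\<tau>\<bar>)
      \<le> e0 * (\<Sum>j\<le>p. grad (\<lambda>_. 0) j * t j)"
    unfolding sum_atMost_p by (simp add: \<tau>_def distrib_left)
  moreover define a2 \<epsilon>2 W where "a2 = a1 / 2" and "\<epsilon>2 = \<epsilon> / 2" and "W = vX t + \<tau>\<^sup>2"
  moreover have "e0 * ((\<Sum>j\<le>p. grad (\<lambda>_. 0) j * t j) + (a2 * W - \<epsilon>2)) \<le> e0 * DL"
    using DL1 e0 by (intro mult_left_mono) (auto simp: a2_def \<epsilon>2_def W_def diff_divide_distrib)
  ultimately have "\<eta> * lam * NN + e0 * a2 * W + \<eta> * (lam * (\<bar>t 0\<bar> + NS)) + lam * \<bar>t 0\<bar>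
     \<le> 2 * lam * (\<bar>t 0\<bar> + NS) + e0 * r * \<bar>\<tau>\<bar> + e0 * \<epsilon>2"
    using main by (simp add: algebra_simps)
  moreover have "0 \<le> \<eta> * (lam * (\<bar>t 0\<bar> + NS))" "0 \<le> lam * \<bar>t 0\<bar>"
    using \<eta> lam_pos by (auto simp: NS_def sum_nonneg)
  ultimately show ?thesis unfolding NS_def NN_def \<tau>_def a2_def \<epsilon>2_def W_def by linarith
qed

lemma continuous_on_obj:
  assumes "\<And>t. t \<in> A \<Longrightarrow> 0 < 1 + t p"
  shows "continuous_on A obj"
proof -
  have co: "continuous_on A (\<lambda>t :: nat \<Rightarrow> real. t k)" for k
    by (rule continuous_on_subset[OF continuous_on_product_coordinates]) simp
  have cl: "continuous_on UNIV l"
    using l_deriv DERIV_isCont continuous_at_imp_continuous_on by blast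
  have "continuous_on A (\<lambda>t. l (e i + lin p (x i) (e i) t))" for i
    unfolding lin_def
    by (rule continuous_on_compose2[OF cl]) (auto intro!: continuous_intros co)
  moreover have "1 + t p \<noteq> 0" if "t \<in> A" for t using assms[OF that] by simp
  ultimately show ?thesis
    unfolding obj_def[abs_def] risk_def pen_def using n_pos
    by (intro continuous_intros co) auto
qed

text \<open>A sublevel point outside the ball, shrunk towards 0 until its norm is exactly
  \<open>m\<close>, stays in the sublevel set by \<open>obj_ray\<close>. This contradicts the strict
  inequality in \<open>loc\<close>.\<close>

lemma sublevel_in_ball:
  assumes loc: "\<And>t. t \<in> l1_ball p m \<Longrightarrow> 0 < 1 + t p \<Longrightarrow> obj t \<le> obj (\<lambda>_. 0) \<Longrightarrow> norm1 t < m"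
    and m: "0 < m" and t: "t \<in> admissible" "obj t \<le> obj (\<lambda>_. 0)"
  shows "t \<in> l1_ball p m"
proof (rule ccontr)
  assume "t \<notin> l1_ball p m"
  hence gt: "m < norm1 t" using t(1) by (auto simp: l1_ball_def admissible_def norm1_def)
  define u where "u = m / norm1 t"
  have u: "0 \<le> u" "u \<le> 1" using gt m by (auto simp: u_def)
  have n: "norm1 (\<lambda>k. u * t k) = m"
  proof -
    have "norm1 (\<lambda>k. u * t k) = u * norm1 t"
      using u by (simp add: norm1_def abs_mult sum_distrib_left)
    thus ?thesis using gt m by (simp add: u_def)
  qed
  have "(\<lambda>k. u * t k) \<in> l1_ball p m"
    using n t(1) by (simp add: l1_ball_def norm1_def admissible_def)
  hence "norm1 (\<lambda>k. u * t k) < m"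
    using obj_ray[OF u _ t(2)] t(1) by (intro loc) (auto simp: admissible_def)
  thus False using n by simp
qed

text \<open>The minimum over the compact ball is global, since all admissible points outside the
  ball have a value above that of 0. The condition \<open>m < 1\<close> keeps the denominator
  positive on the ball.\<close>

lemma minimizer_exists:
  assumes loc: "\<And>t. t \<in> l1_ball p m \<Longrightarrow> 0 < 1 + t p \<Longrightarrow> obj t \<le> obj (\<lambda>_. 0) \<Longrightarrow> norm1 t < m"
    and m: "0 < m" "m < 1"
  shows "\<exists>t\<in>admissible. \<forall>t'\<in>admissible. obj t \<le> obj t'"
proof -
  have pos: "0 < 1 + t p" if "t \<in> l1_ball p m" for t
  proof -
    have "\<bar>t p\<bar> \<le> (\<Sum>k\<le>p. \<bar>t k\<bar>)" by (rule member_le_sum) auto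
    thus ?thesis using that m by (auto simp: l1_ball_def)
  qed
  have z: "(\<lambda>_. 0) \<in> l1_ball p m" using m by (simp add: l1_ball_def)
  have co: "continuous_on (l1_ball p m) obj" by (rule continuous_on_obj) (rule pos)
  obtain t where t: "t \<in> l1_ball p m" "\<forall>t'\<in>l1_ball p m. obj t \<le> obj t'"
    using continuous_attains_inf[OF compact_l1_ball _ co] z by blast
  have "obj t \<le> obj t'" if "t' \<in> admissible" for t'
  proof (cases "obj t' \<le> obj (\<lambda>_. 0)")
    case True
    thus ?thesis using t(2) sublevel_in_ball[OF loc m(1) that] by blast
  next
    case False
    thus ?thesis using t(2) z by force
  qed
  moreover have "t \<in> admissible" using t(1) pos by (auto simp: admissible_def l1_ball_def)
  ultimately show ?thesis by blast
qed

text \<open>A change of a coordinate \<open>j < p\<close> leaves the denominator fixed, so the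
  quotient form disappears and the penalty reduces to one absolute value.\<close>

lemma minimizer_stationary:
  assumes t: "t \<in> admissible" "\<And>t'. t' \<in> admissible \<Longrightarrow> obj t \<le> obj t'" and j: "1 \<le> j" "j < p"
  shows "\<exists>z. \<bar>z\<bar> \<le> 1 \<and> z * ((1 + t p) * b j + t j) = \<bar>(1 + t p) * b j + t j\<bar> \<and>
    exp (risk t) * grad t j = - lam * z"
proof (rule l1_penalty_stationary[OF lam_pos])
  define F where "F y = exp (risk (t(j := y)))" for y
  have lin_upd: "lin p (x i) u (t(j := y)) = lin p (x i) u t + feat p (x i) u j * (y - t j)" for i u y
  proof -
    have "lin p (x i) u (t(j := y)) - lin p (x i) u t = (\<Sum>k\<le>p. if k = j then feat p (x i) u k * (y - t j) else 0)"
      unfolding lin_diff unfolding lin_def by (intro sum.cong) auto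
    also have "\<dots> = feat p (x i) u j * (y - t j)" using j by simp
    finally show ?thesis by simp
  qed
  have "((\<lambda>y. l (e i + lin p (x i) (e i) (t(j := y)))) has_field_derivative
      h (e i + lin p (x i) (e i) t) * feat p (x i) (e i) j) (at (t j))" for i
  proof -
    have "((\<lambda>y. e i + lin p (x i) (e i) (t(j := y))) has_field_derivative feat p (x i) (e i) j) (at (t j))"
      unfolding lin_upd by (auto intro!: derivative_eq_intros)
    moreover have "(l has_field_derivative h (e i + lin p (x i) (e i) t)) (at (e i + lin p (x i) (e i) (t(j := t j))))"
      using l_deriv by simp
    ultimately show ?thesis by (rule DERIV_chain2[rotated])
  qed
  hence "((\<lambda>y. risk (t(j := y))) has_field_derivative grad t j) (at (t j))"
    unfolding risk_def grad_def by (intro DERIV_cdivide DERIV_sum) auto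
  thus "((\<lambda>y. exp (risk (t(j := y)))) has_field_derivative exp (risk t) * grad t j) (at (t j))"
    by (auto intro!: derivative_eq_intros)
  fix y
  have adm: "t(j := y) \<in> admissible" using t(1) j by (auto simp: admissible_def)
  have pos: "0 < 1 + t p" using t(1) by (simp add: admissible_def)
  have "exp (risk t) + lam * pen t \<le> exp (risk (t(j := y))) + lam * pen (t(j := y))"
    using t(2)[OF adm] pos j by (simp add: obj_def divide_le_cancel)
  moreover have "pen (t(j := y)) - pen t = \<bar>(1 + t p) * b j + y\<bar> - \<bar>(1 + t p) * b j + t j\<bar>"
  proof -
    have "pen (t(j := y)) - pen t = (\<Sum>k\<in>{1..<p}. if k = j then \<bar>(1 + t p) * b k + y\<bar> - \<bar>(1 + t p) * b k + t k\<bar> else 0)"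
      unfolding pen_def sum_subtractf[symmetric] using j by (intro sum.cong) auto
    thus ?thesis using j by simp
  qed
  hence "lam * pen (t(j := y)) = lam * pen t + lam * \<bar>(1 + t p) * b j + y\<bar> - lam * \<bar>(1 + t p) * b j + t j\<bar>"
  proof -
    assume "pen (t(j := y)) - pen t = \<bar>(1 + t p) * b j + y\<bar> - \<bar>(1 + t p) * b j + t j\<bar>"
    hence "pen (t(j := y)) = pen t + \<bar>(1 + t p) * b j + y\<bar> - \<bar>(1 + t p) * b j + t j\<bar>" by simp
    thus ?thesis by (simp only: right_diff_distrib distrib_left)
  qed
  ultimately show "exp (risk (t(j := t j))) + lam * \<bar>(1 + t p) * b j + t j\<bar>
      \<le> exp (risk (t(j := y))) + lam * \<bar>(1 + t p) * b j + y\<bar>" by simp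
qed

end

subsection \<open>Localization and sign of the minimizer\<close>

lemma young:
  fixes u w c :: real
  assumes "0 < c"
  shows "u * w \<le> c / 2 * u\<^sup>2 + w\<^sup>2 / (2 * c)"
proof -
  have "0 \<le> (c * u - w)\<^sup>2 / (2 * c)" using assms by simp
  also have "\<dots> = c / 2 * u\<^sup>2 + w\<^sup>2 / (2 * c) - u * w"
    using assms by (simp add: power2_eq_square field_simps)
  finally show ?thesis by simp
qed

text \<open>Half of \<open>A * vx\<close> is converted by \<open>eig\<close> into
  \<open>A / 2 * \<Lambda>2 * T2\<close>; one half of that absorbs \<open>2 * lam * NS\<close> by
  Young's inequality and \<open>cs\<close>, the other half survives. Half of the scale term absorbs
  \<open>B1 * lam * |\<tau>|\<close>.\<close>

lemma rate_arithmetic: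
  fixes A :: real
  assumes main: "\<eta> * lam * NN + A * (vx + \<tau>\<^sup>2) \<le> 2 * lam * NS + B1 * lam * \<bar>\<tau>\<bar> + B2 * W"
    and eig: "\<Lambda>2 * T2 - B4 * W \<le> vx" and cs: "NS\<^sup>2 \<le> 2 * s * T2"
    and A: "0 < A" and \<Lambda>2: "0 < \<Lambda>2" and s: "1 \<le> s"
  shows "\<eta> * lam * NN + A / 2 * (vx + \<tau>\<^sup>2) + A / 4 * \<Lambda>2 * T2
     \<le> (8 / (A * \<Lambda>2) + B1\<^sup>2 / (2 * A)) * (lam\<^sup>2 * s) + (B2 + A * B4 / 2) * W"
proof -
  have c: "0 < A * \<Lambda>2 / (4 * s)" using A \<Lambda>2 s by simp
  have "NS * (2 * lam) \<le> A * \<Lambda>2 / (4 * s) / 2 * NS\<^sup>2 + (2 * lam)\<^sup>2 / (2 * (A * \<Lambda>2 / (4 * s)))"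
    by (rule young[OF c])
  also have "A * \<Lambda>2 / (4 * s) / 2 * NS\<^sup>2 \<le> A * \<Lambda>2 / (4 * s) / 2 * (2 * s * T2)"
    using cs c by (intro mult_left_mono) auto
  also have "A * \<Lambda>2 / (4 * s) / 2 * (2 * s * T2) = A / 4 * \<Lambda>2 * T2" using s by simp
  also have "(2 * lam)\<^sup>2 / (2 * (A * \<Lambda>2 / (4 * s))) = 8 / (A * \<Lambda>2) * (lam\<^sup>2 * s)"
    using A \<Lambda>2 s by (simp add: power2_eq_square field_simps)
  finally have 1: "2 * lam * NS \<le> A / 4 * \<Lambda>2 * T2 + 8 / (A * \<Lambda>2) * (lam\<^sup>2 * s)" by (simp add: mult.commute)
  have "\<bar>\<tau>\<bar> * (B1 * lam) \<le> A / 2 * \<bar>\<tau>\<bar>\<^sup>2 + (B1 * lam)\<^sup>2 / (2 * A)" by (rule young[OF A])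
  also have "(B1 * lam)\<^sup>2 / (2 * A) = B1\<^sup>2 / (2 * A) * (lam\<^sup>2 * 1)" by (simp add: power_mult_distrib)
  also have "\<dots> \<le> B1\<^sup>2 / (2 * A) * (lam\<^sup>2 * s)" using s A by (intro mult_left_mono) auto
  finally have 2: "B1 * lam * \<bar>\<tau>\<bar> \<le> A / 2 * \<tau>\<^sup>2 + B1\<^sup>2 / (2 * A) * (lam\<^sup>2 * s)" by (simp add: mult.commute)
  have "A / 2 * (\<Lambda>2 * T2 - B4 * W) \<le> A / 2 * vx" using eig A by (intro mult_left_mono) auto
  hence 3: "A / 2 * \<Lambda>2 * T2 - A * B4 / 2 * W \<le> A / 2 * vx" by (simp add: algebra_simps)
  have 4: "A / 2 * \<Lambda>2 * T2 = 2 * (A / 4 * \<Lambda>2 * T2)" by simp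
  show ?thesis
    using main 1 2 3 4 by (simp add: distrib_left distrib_right)
qed

lemma abs_exp_minus_one_le:
  fixes y :: real
  assumes "\<bar>y\<bar> \<le> 1"
  shows "\<bar>exp y - 1\<bar> \<le> 2 * \<bar>y\<bar>"
proof (cases "0 \<le> y")
  case True
  have "exp y \<le> 1 + y + y\<^sup>2" using True assms by (intro exp_bound) auto
  moreover have "y\<^sup>2 \<le> y" using True assms by (simp add: power2_eq_square mult_left_le)
  ultimately show ?thesis using True by simp
next
  case False
  hence "exp y \<le> 1" "1 + y \<le> exp y" by auto
  thus ?thesis using False by linarith
qed

lemma sum_abs_squared_le:
  fixes t :: "nat \<Rightarrow> real"
  assumes "finite I"
  shows "(\<Sum>j\<in>I. \<bar>t j\<bar>)\<^sup>2 \<le> card I * (\<Sum>j\<in>I. (t j)\<^sup>2)"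
  using Cauchy_Schwarz_ineq_sum[of "\<lambda>_. 1" "\<lambda>j. \<bar>t j\<bar>" I] by simp

text \<open>All constants are formed here from quantities that depend neither on \<open>n\<close>
  nor on the noise. \<open>Cd\<close> and \<open>Cs\<close> come from the deviation and covariance
  bounds, \<open>cr\<close> from \<open>sqrt (ln p / n) \<le> cr * lam\<close>, and
  \<open>elo\<close>, \<open>ehi\<close> enclose \<open>e0\<close>.\<close>

locale lasso_constants =
  fixes h11 h12 h22 a Lc \<rho> Cd Cs cr \<Lambda>2 elo ehi :: real
  assumes const_bounds: "0 < h11" "0 < a" "0 \<le> Lc" "0 \<le> Cd" "0 \<le> Cs" "0 \<le> cr" "0 < \<Lambda>2" "0 < elo" "elo \<le> ehi"
begin

text \<open>The curvature \<open>a / 4\<close> of the gradient increments, halved in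
  \<open>basic_inequality\<close> and multiplied by the lower bound of \<open>e0\<close>.\<close>

definition A :: real where "A = elo * a / 8"
definition C4 :: real where "C4 = 8 / (A * \<Lambda>2) + (ehi * cr)\<^sup>2 / (2 * A) + 1"
definition B3 :: real where "B3 = ehi * Cd * cr / 2 + A * (Cs * cr) / 2"
definition C7 :: real where "C7 = 2 * C4 / A"
text \<open>The first three terms bound the \<open>l1\<close> errors outside \<open>S\<close>, on
  \<open>S\<close> together with the intercept, and in the scale; the final 1 makes the localization
  strict.\<close>

definition kr :: real where "kr = C4 + sqrt (8 * C4 / (A * \<Lambda>2)) + sqrt C7 + 1"
definition C8 :: real where "C8 = \<bar>h11\<bar> + 2 * \<bar>h12\<bar> + \<bar>h22\<bar> + Lc * \<bar>\<rho>\<bar>"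
text \<open>\<open>C5\<close> controls the change of the risk at the minimizer, and
  \<open>C6\<close> the total relative perturbation of the Lasso score.\<close>

definition C5 :: real where "C5 = kr / elo + 2 * sqrt C7 + Cd * cr * kr\<^sup>2 + 2 * C8 * C7"
definition C6 :: real where "C6 = ehi * (Cd * cr * kr + 2 * Lc * C7) + 2 * C5"

lemma const_pos: "0 < A" "0 < ehi" "1 \<le> C4" "0 < C7" "1 < kr" "0 \<le> B3" "0 \<le> C8" "0 < C5" "0 < C6"
proof -
  show A: "0 < A" using const_bounds by (simp add: A_def)
  show ehi: "0 < ehi" using const_bounds by linarith
  have "0 \<le> 8 / (A * \<Lambda>2)" "0 \<le> (ehi * cr)\<^sup>2 / (2 * A)" using A const_bounds by auto
  thus C4: "1 \<le> C4" by (simp add: C4_def)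
  show C7: "0 < C7" using A C4 by (simp add: C7_def)
  have "0 \<le> sqrt (8 * C4 / (A * \<Lambda>2))" "0 \<le> sqrt C7" using A C4 C7 const_bounds by auto
  thus k: "1 < kr" unfolding kr_def using C4 by linarith
  show "0 \<le> B3" using A ehi const_bounds by (simp add: B3_def)
  show C8: "0 \<le> C8" using const_bounds by (simp add: C8_def)
  have "0 < kr / elo" "0 \<le> 2 * sqrt C7" "0 \<le> Cd * cr * kr\<^sup>2" "0 \<le> 2 * C8 * C7" using k C7 C8 const_bounds by auto
  thus C5: "0 < C5" unfolding C5_def by linarith
  have "0 \<le> ehi * (Cd * cr * kr + 2 * Lc * C7)" using ehi k C7 const_bounds by simp
  thus "0 < C6" unfolding C6_def using C5 by linarith
qed

end

text \<open>The deterministic part of the argument: \<open>gc\<close> and \<open>gd\<close> stand for the gradient of \<open>H\<close> minus its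
  value at \<open>(0, 1)\<close>, and \<open>r\<close> for \<open>sqrt (ln p / n)\<close>. The bound \<open>score\<close> does not cover the scale
  coordinate \<open>p\<close>, whose score has mean one, the derivative of \<open>d \<mapsto> ln d\<close> at the truth.\<close>

locale lasso_event = lasso_sample + lasso_constants +
  fixes gc gd :: "real \<Rightarrow> real \<Rightarrow> real"
    and K r \<eta> :: real
  assumes K: "1 \<le> K"
    and x_bound: "\<And>i k. i < n \<Longrightarrow> k < p \<Longrightarrow> \<bar>x i k\<bar> \<le> K"
    and x_intercept: "\<And>i. i < n \<Longrightarrow> x i 0 = 1"
    and x_centered: "\<And>j. 1 \<le> j \<Longrightarrow> j < p \<Longrightarrow> (\<Sum>i<n. x i j) = 0"
    and quad: "\<And>c \<tau>. a * (c\<^sup>2 + \<tau>\<^sup>2) \<le> h11 * c\<^sup>2 + 2 * h12 * c * \<tau> + h22 * \<tau>\<^sup>2"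
    and gc: "\<And>c \<tau>. \<bar>c\<bar> + \<bar>\<tau>\<bar> \<le> \<rho> \<Longrightarrow> \<bar>gc c \<tau> - (h11 * c + h12 * \<tau>)\<bar> \<le> Lc * (\<bar>c\<bar> + \<bar>\<tau>\<bar>)\<^sup>2"
    and gd: "\<And>c \<tau>. \<bar>c\<bar> + \<bar>\<tau>\<bar> \<le> \<rho> \<Longrightarrow> \<bar>gd c \<tau> - (h12 * c + h22 * \<tau>)\<bar> \<le> Lc * (\<bar>c\<bar> + \<bar>\<tau>\<bar>)\<^sup>2"
    and \<eta>: "0 < \<eta>" "\<eta> < 1"
    and r: "0 \<le> r" "r \<le> 1" "r \<le> cr * lam"
    and score: "\<And>j. j < p \<Longrightarrow> e0 * \<bar>grad (\<lambda>_. 0) j\<bar> \<le> (1 - \<eta>) * lam"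
    and score_p: "\<bar>grad (\<lambda>_. 0) p - 1\<bar> \<le> r"
    and e0_bounds: "elo \<le> e0" "e0 \<le> ehi"
    and S_ne: "S \<noteq> {}"
    and eig: "\<And>t. \<Lambda>2 * (\<Sum>j<p. (t j)\<^sup>2) - Cs * K\<^sup>2 * r * (\<Sum>j<p. \<bar>t j\<bar>)\<^sup>2 \<le> vX t"
begin

definition s :: real where "s = card S"
text \<open>Up to a constant, \<open>y\<close> is the perturbation of the stationarity conditions
  relative to \<open>lam\<close>, whereas \<open>m\<close> is the radius of localization.\<close>

definition y :: real where "y = K\<^sup>2 * lam * s / \<eta>"
definition m :: real where "m = kr * lam * s / \<eta>"
definition expected :: "(nat \<Rightarrow> real) \<Rightarrow> nat \<Rightarrow> real" where
  "expected t j = (\<Sum>i<n. if j < p then x i j * gc (xt i t) (t p) else gd (xt i t) (t p)) / n"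

lemma finite_S [simp]: "finite S" by (simp add: S_def)

lemma s_ge: "1 \<le> s"
  using S_ne by (simp add: s_def Suc_leI card_gt_0_iff)

lemma pos: "0 < A" "0 < ehi" "1 \<le> C4" "0 < C7" "1 < kr" "0 \<le> B3" "0 \<le> C8" "0 < C5" "0 < C6" "0 < y" "0 < m"
proof -
  show "0 < y" "0 < m" using K lam_pos s_ge \<eta> const_pos(5) by (auto simp: y_def m_def)
qed (rule const_pos)+

lemma K_le: "K \<le> K\<^sup>2" "1 \<le> K\<^sup>2"
proof -
  show "K \<le> K\<^sup>2" using K by (simp add: power2_eq_square)
  with K show "1 \<le> K\<^sup>2" by linarith
qed

lemma m_le: "K * m \<le> kr * y" "m \<le> kr * y" "m = kr * (lam * s / \<eta>)" "lam * s / \<eta> \<le> y" "lam * s \<le> lam * s / \<eta>"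
proof -
  have nn: "0 \<le> lam * s / \<eta>" using lam_pos s_ge \<eta> by simp
  show m: "m = kr * (lam * s / \<eta>)" by (simp add: m_def)
  have y: "y = K\<^sup>2 * (lam * s / \<eta>)" by (simp add: y_def)
  show ly: "lam * s / \<eta> \<le> y" unfolding y using mult_right_mono[OF K_le(2) nn] by simp
  show "m \<le> kr * y" unfolding m using ly pos(5) by (intro mult_left_mono) auto
  have "K * (lam * s / \<eta>) \<le> y" unfolding y by (rule mult_right_mono[OF K_le(1) nn])
  hence "kr * (K * (lam * s / \<eta>)) \<le> kr * y" using pos(5) by (intro mult_left_mono) auto
  thus "K * m \<le> kr * y" unfolding m by (simp add: mult_ac)
  have "0 \<le> lam * s" using lam_pos s_ge by simp
  thus "lam * s \<le> lam * s / \<eta>" using \<eta> mult_left_le[of \<eta> "lam * s"] by (simp add: pos_le_divide_eq)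
qed

lemma lam2_s_le: "lam\<^sup>2 * s \<le> (lam * s)\<^sup>2"
proof -
  have "lam\<^sup>2 * s * 1 \<le> lam\<^sup>2 * s * s" using s_ge by (intro mult_left_mono) auto
  thus ?thesis by (simp add: power2_eq_square mult_ac)
qed

lemma sqrt_mult_square: "0 \<le> z \<Longrightarrow> sqrt (c * z\<^sup>2) = sqrt c * z"
  by (simp add: real_sqrt_mult)

lemma xt_bound:
  assumes "i < n" "t \<in> l1_ball p m"
  shows "\<bar>xt i t\<bar> + \<bar>t p\<bar> \<le> K * m"
proof -
  have "\<bar>xt i t\<bar> \<le> (\<Sum>k<p. \<bar>x i k\<bar> * \<bar>t k\<bar>)"
    unfolding xt_def using sum_abs[of "\<lambda>k. x i k * t k" "{..<p}"] by (simp add: abs_mult)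
  also have "\<dots> \<le> (\<Sum>k<p. K * \<bar>t k\<bar>)"
    using x_bound[OF assms(1)] by (intro sum_mono mult_right_mono) auto
  finally have "\<bar>xt i t\<bar> \<le> K * (\<Sum>k<p. \<bar>t k\<bar>)" by (simp add: sum_distrib_left)
  moreover have "\<bar>t p\<bar> \<le> K * \<bar>t p\<bar>" using K mult_right_mono[of 1 K "\<bar>t p\<bar>"] by simp
  ultimately have "\<bar>xt i t\<bar> + \<bar>t p\<bar> \<le> K * (\<Sum>k\<le>p. \<bar>t k\<bar>)"
    unfolding sum_atMost_p by (simp add: distrib_left)
  also have "\<dots> \<le> K * m" using assms(2) K by (intro mult_left_mono) (auto simp: l1_ball_def)
  finally show ?thesis .
qed

lemma vX_sum: "vX t + (t p)\<^sup>2 = (\<Sum>i<n. (xt i t)\<^sup>2 + (t p)\<^sup>2) / n"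
  using n_pos by (simp add: vX_def sum.distrib add_divide_distrib)

text \<open>Interchanging the sums reduces everything to the two-dimensional function
  \<open>(gc, gd)\<close> at the pairs \<open>(xt i t, t p)\<close>.\<close>

lemma expected_pairing:
  "(\<Sum>j\<le>p. expected t j * w j) = (\<Sum>i<n. gc (xt i t) (t p) * xt i w + gd (xt i t) (t p) * w p) / n"
proof -
  have "(\<Sum>j<p. expected t j * w j) = (\<Sum>j<p. \<Sum>i<n. x i j * gc (xt i t) (t p) * w j) / n"
    by (simp add: expected_def sum_distrib_right sum_divide_distrib)
  also have "\<dots> = (\<Sum>i<n. gc (xt i t) (t p) * xt i w) / n"
  proof -
    have "(\<Sum>j<p. x i j * v * w j) = v * xt i w" for v i
      by (simp add: xt_def sum_distrib_left mult_ac)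
    thus ?thesis by (subst sum.swap) simp
  qed
  finally show ?thesis
    unfolding sum_atMost_p by (simp add: expected_def sum_distrib_right sum.distrib add_divide_distrib)
qed

lemma abs_sum_square_le: "(\<bar>c\<bar> + \<bar>d\<bar>)\<^sup>2 \<le> 2 * (c\<^sup>2 + d\<^sup>2)" for c d :: real
  using zero_le_power2[of "\<bar>c\<bar> - \<bar>d\<bar>"] by (simp add: power2_eq_square algebra_simps)

lemma pairing_expansion:
  assumes "\<bar>u\<bar> + \<bar>w\<bar> \<le> \<rho>"
  shows "\<bar>gc u w * u + gd u w * w - (h11 * u\<^sup>2 + 2 * h12 * u * w + h22 * w\<^sup>2)\<bar>
    \<le> Lc * (\<bar>u\<bar> + \<bar>w\<bar>)\<^sup>2 * (\<bar>u\<bar> + \<bar>w\<bar>)"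
proof -
  have "gc u w * u + gd u w * w - (h11 * u\<^sup>2 + 2 * h12 * u * w + h22 * w\<^sup>2)
      = (gc u w - (h11 * u + h12 * w)) * u + (gd u w - (h12 * u + h22 * w)) * w"
    by (simp add: power2_eq_square algebra_simps)
  hence "\<bar>gc u w * u + gd u w * w - (h11 * u\<^sup>2 + 2 * h12 * u * w + h22 * w\<^sup>2)\<bar>
      \<le> \<bar>gc u w - (h11 * u + h12 * w)\<bar> * \<bar>u\<bar> + \<bar>gd u w - (h12 * u + h22 * w)\<bar> * \<bar>w\<bar>"
    by (metis abs_mult abs_triangle_ineq)
  also have "\<dots> \<le> Lc * (\<bar>u\<bar> + \<bar>w\<bar>)\<^sup>2 * \<bar>u\<bar> + Lc * (\<bar>u\<bar> + \<bar>w\<bar>)\<^sup>2 * \<bar>w\<bar>"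
    using gc[OF assms] gd[OF assms] by (intro add_mono mult_right_mono) auto
  finally show ?thesis by (simp add: distrib_left)
qed

context
  assumes dev: "\<And>t j. t \<in> l1_ball p m \<Longrightarrow> j \<le> p \<Longrightarrow> \<bar>grad t j - grad (\<lambda>_. 0) j - expected t j\<bar> \<le> Cd * K\<^sup>2 * m * r"
    and small_\<rho>: "K * m \<le> \<rho>" and small_a: "2 * Lc * (K * m) \<le> a"
    and small_y: "B3 * kr\<^sup>2 * (y / \<eta>) \<le> 1" "y / \<eta> \<le> 1" "C5 * y \<le> 1"
    and small_m: "m < 1" and small_lam: "lam \<le> 1"
begin

lemma dev_pairing:
  assumes "t \<in> l1_ball p m" "(\<Sum>j\<le>p. \<bar>w j\<bar>) \<le> m"
  shows "\<bar>(\<Sum>j\<le>p. (grad t j - grad (\<lambda>_. 0) j) * w j) - (\<Sum>j\<le>p. expected t j * w j)\<bar> \<le> Cd * K\<^sup>2 * m * r * m"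
proof -
  have "\<bar>(\<Sum>j\<le>p. (grad t j - grad (\<lambda>_. 0) j) * w j) - (\<Sum>j\<le>p. expected t j * w j)\<bar>
      = \<bar>\<Sum>j\<le>p. (grad t j - grad (\<lambda>_. 0) j - expected t j) * w j\<bar>"
    by (simp add: left_diff_distrib sum_subtractf)
  also have "\<dots> \<le> (\<Sum>j\<le>p. \<bar>grad t j - grad (\<lambda>_. 0) j - expected t j\<bar> * \<bar>w j\<bar>)"
    using sum_abs[of "\<lambda>j. (grad t j - grad (\<lambda>_. 0) j - expected t j) * w j" "{..p}"] by (simp only: abs_mult)
  also have "\<dots> \<le> (\<Sum>j\<le>p. Cd * K\<^sup>2 * m * r * \<bar>w j\<bar>)"
    using dev[OF assms(1)] by (intro sum_mono mult_right_mono) auto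
  also have "\<dots> \<le> Cd * K\<^sup>2 * m * r * m"
    unfolding sum_distrib_left[symmetric] using assms(2) const_bounds r pos by (intro mult_left_mono) auto
  finally show ?thesis .
qed

text \<open>At the midpoint arguments \<open>(u, w)\<close> the quadratic form is at least
  \<open>a * (u^2 + w^2)\<close>, and \<open>small_a\<close> lets the cubic remainder take at most
  half of it. Returning to \<open>c = 2 * u\<close> and \<open>\<tau> = 2 * w\<close> gives
  \<open>a / 4\<close>.\<close>

lemma curvature:
  assumes "t \<in> l1_ball p m"
  shows "a / 4 * (vX t + (t p)\<^sup>2) - Cd * K\<^sup>2 * m * r * m
    \<le> (\<Sum>j\<le>p. (grad (\<lambda>k. 1/2 * t k) j - grad (\<lambda>_. 0) j) * t j)"
proof -
  define th where "th = (\<lambda>k. 1/2 * t k)"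
  have th: "th \<in> l1_ball p m"
  proof -
    have "(\<Sum>k\<le>p. \<bar>th k\<bar>) = 1/2 * (\<Sum>k\<le>p. \<bar>t k\<bar>)" by (simp add: th_def abs_mult sum_distrib_left)
    also have "\<dots> \<le> m" using assms pos by (auto simp: l1_ball_def)
    finally show ?thesis using assms by (simp add: l1_ball_def th_def)
  qed
  have xth: "xt i th = xt i t / 2" for i by (simp add: xt_def th_def sum_divide_distrib)
  have "a / 4 * (vX t + (t p)\<^sup>2) \<le> (\<Sum>j\<le>p. expected th j * t j)"
    unfolding expected_pairing vX_sum times_divide_eq_right sum_distrib_left
  proof (intro divide_right_mono sum_mono)
    fix i assume "i \<in> {..<n}"
    hence i: "i < n" by simp
    define c \<tau> where "c = xt i t" and "\<tau> = t p"
    have ct: "\<bar>c\<bar> + \<bar>\<tau>\<bar> \<le> K * m" using xt_bound[OF i assms] by (simp add: c_def \<tau>_def)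
    define u w where "u = c / 2" and "w = \<tau> / 2"
    have cu: "c = 2 * u" "\<tau> = 2 * w" by (simp_all add: u_def w_def)
    have uw: "\<bar>u\<bar> + \<bar>w\<bar> \<le> K * m / 2" using ct unfolding cu by simp
    have half: "\<bar>u\<bar> + \<bar>w\<bar> \<le> \<rho>" using uw small_\<rho> by linarith
    have "Lc * (\<bar>u\<bar> + \<bar>w\<bar>) \<le> Lc * (K * m / 2)" using uw const_bounds by (intro mult_left_mono) auto
    hence "Lc * (\<bar>u\<bar> + \<bar>w\<bar>) \<le> a / 4" using small_a by simp
    hence "Lc * (\<bar>u\<bar> + \<bar>w\<bar>) * (\<bar>u\<bar> + \<bar>w\<bar>)\<^sup>2 \<le> a / 4 * (2 * (u\<^sup>2 + w\<^sup>2))"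
      using abs_sum_square_le[of u w] const_bounds by (intro mult_mono) auto
    moreover have "Lc * (\<bar>u\<bar> + \<bar>w\<bar>) * (\<bar>u\<bar> + \<bar>w\<bar>)\<^sup>2 = Lc * (\<bar>u\<bar> + \<bar>w\<bar>)\<^sup>2 * (\<bar>u\<bar> + \<bar>w\<bar>)"
      "a / 4 * (2 * (u\<^sup>2 + w\<^sup>2)) = a * (u\<^sup>2 + w\<^sup>2) / 2" by simp_all
    ultimately have "Lc * (\<bar>u\<bar> + \<bar>w\<bar>)\<^sup>2 * (\<bar>u\<bar> + \<bar>w\<bar>) \<le> a * (u\<^sup>2 + w\<^sup>2) / 2" by linarith
    moreover have "h11 * u\<^sup>2 + 2 * h12 * u * w + h22 * w\<^sup>2 - Lc * (\<bar>u\<bar> + \<bar>w\<bar>)\<^sup>2 * (\<bar>u\<bar> + \<bar>w\<bar>)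
        \<le> gc u w * u + gd u w * w"
      using pairing_expansion[OF half] by (simp only: abs_le_iff) linarith
    ultimately have "a * (u\<^sup>2 + w\<^sup>2) / 2 \<le> gc u w * u + gd u w * w"
      using quad[of u w] by linarith
    hence "a / 4 * (c\<^sup>2 + \<tau>\<^sup>2) \<le> gc (c/2) (\<tau>/2) * c + gd (c/2) (\<tau>/2) * \<tau>"
      by (simp add: cu power2_eq_square algebra_simps)
    thus "a / 4 * ((xt i t)\<^sup>2 + (t p)\<^sup>2) \<le> gc (xt i th) (th p) * xt i t + gd (xt i th) (th p) * t p"
      unfolding xth by (simp add: c_def \<tau>_def th_def)
  qed simp
  moreover have "(\<Sum>j\<le>p. \<bar>t j\<bar>) \<le> m" using assms by (simp add: l1_ball_def)
  ultimately show ?thesis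
    using dev_pairing[OF th, of t] unfolding th_def by linarith
qed

text \<open>The constant \<open>kr\<close> must not depend on itself although the deviation bound
  grows with \<open>m\<close>. This works because all terms in \<open>W\<close> are multiples of
  \<open>kr^2 * (y / \<eta>) * lam^2 * s\<close>, and \<open>small_y\<close> makes them
  negligible.\<close>

lemma localization:
  assumes t: "t \<in> l1_ball p m" "0 < 1 + t p" "obj t \<le> obj (\<lambda>_. 0)"
  shows "norm1 t < m" "vX t + (t p)\<^sup>2 \<le> C7 * (lam\<^sup>2 * s)"
proof -
  define NN where "NN = (\<Sum>j\<in>{1..<p} - S. \<bar>t j\<bar>)"
  define NS where "NS = \<bar>t 0\<bar> + (\<Sum>j\<in>S. \<bar>t j\<bar>)"
  define T2 where "T2 = (\<Sum>j<p. (t j)\<^sup>2)"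
  define W where "W = K\<^sup>2 * lam * m\<^sup>2"
  define vx where "vx = vX t"
  define \<tau> where "\<tau> = t p"
  have nn: "0 \<le> vx" "0 \<le> T2" "0 \<le> NN" "0 \<le> NS" "0 \<le> W"
    using lam_pos by (auto simp: vx_def vX_def T2_def NN_def NS_def W_def sum_nonneg)
  have "\<eta> * lam * NN + e0 * (a / 4 / 2) * (vx + \<tau>\<^sup>2) \<le> 2 * lam * NS + e0 * r * \<bar>\<tau>\<bar> + e0 * (Cd * K\<^sup>2 * m * r * m / 2)"
    unfolding NN_def NS_def vx_def \<tau>_def
    by (rule basic_inequality[OF t(2,3) score score_p curvature[OF t(1)]]) (use \<eta> in auto)
  moreover have "A * (vx + \<tau>\<^sup>2) \<le> e0 * (a / 4 / 2) * (vx + \<tau>\<^sup>2)"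
    using e0_bounds const_bounds nn unfolding A_def by (intro mult_right_mono) auto
  moreover have "e0 * r * \<bar>\<tau>\<bar> \<le> (ehi * cr) * lam * \<bar>\<tau>\<bar>"
  proof (rule mult_right_mono)
    have "e0 * r \<le> ehi * (cr * lam)" using e0_bounds r const_bounds pos by (intro mult_mono) auto
    thus "e0 * r \<le> ehi * cr * lam" by simp
  qed simp
  moreover have "e0 * (Cd * K\<^sup>2 * m * r * m / 2) \<le> ehi * Cd * cr / 2 * W"
  proof -
    have "e0 * r \<le> ehi * (cr * lam)" using e0_bounds r const_bounds pos by (intro mult_mono) auto
    hence "e0 * r * (Cd * K\<^sup>2 * m * m / 2) \<le> ehi * (cr * lam) * (Cd * K\<^sup>2 * m * m / 2)"
      using const_bounds pos by (intro mult_right_mono) auto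
    thus ?thesis by (simp add: W_def power2_eq_square mult_ac)
  qed
  ultimately have main: "\<eta> * lam * NN + A * (vx + \<tau>\<^sup>2) \<le> 2 * lam * NS + (ehi * cr) * lam * \<bar>\<tau>\<bar> + (ehi * Cd * cr / 2) * W"
    by linarith
  have ball: "(\<Sum>k<p. \<bar>t k\<bar>) \<le> m" using t(1) by (auto simp: l1_ball_def sum_atMost_p)
  have eig': "\<Lambda>2 * T2 - Cs * cr * W \<le> vx"
  proof -
    have "Cs * K\<^sup>2 * r * (\<Sum>j<p. \<bar>t j\<bar>)\<^sup>2 \<le> Cs * K\<^sup>2 * (cr * lam) * m\<^sup>2"
      using ball r const_bounds K lam_pos by (intro mult_mono power_mono mult_nonneg_nonneg) (auto simp: sum_nonneg)
    thus ?thesis using eig[of t] by (simp add: T2_def vx_def W_def mult_ac)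
  qed
  have cs: "NS\<^sup>2 \<le> 2 * s * T2"
  proof -
    have 0: "0 \<notin> S" "insert 0 S \<subseteq> {..<p}" using p_pos by (auto simp: S_def)
    have "NS = (\<Sum>j\<in>insert 0 S. \<bar>t j\<bar>)" using 0 by (simp add: NS_def)
    hence "NS\<^sup>2 \<le> card (insert 0 S) * (\<Sum>j\<in>insert 0 S. (t j)\<^sup>2)"
      using sum_abs_squared_le[of "insert 0 S" t] by (simp del: sum.insert card_insert_disjoint)
    also have "\<dots> \<le> (2 * s) * T2"
    proof (rule mult_mono)
      show "real (card (insert 0 S)) \<le> 2 * s" using 0 s_ge by (simp add: s_def)
      show "(\<Sum>j\<in>insert 0 S. (t j)\<^sup>2) \<le> T2" unfolding T2_def using 0 by (intro sum_mono2) auto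
    qed (use s_ge in \<open>auto intro!: sum_nonneg\<close>)
    finally show ?thesis .
  qed
  have "\<eta> * lam * NN + A / 2 * (vx + \<tau>\<^sup>2) + A / 4 * \<Lambda>2 * T2
     \<le> (8 / (A * \<Lambda>2) + (ehi * cr)\<^sup>2 / (2 * A)) * (lam\<^sup>2 * s) + (ehi * Cd * cr / 2 + A * (Cs * cr) / 2) * W"
    by (rule rate_arithmetic[OF main eig' cs]) (use pos const_bounds s_ge in auto)
  also have "(ehi * Cd * cr / 2 + A * (Cs * cr) / 2) * W = (B3 * kr\<^sup>2 * (y / \<eta>)) * (lam\<^sup>2 * s)"
    using s_ge \<eta> by (simp add: B3_def W_def m_def y_def power2_eq_square)
  \<comment> \<open>This unit is the summand 1 in \<open>C4\<close>.\<close>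
  also have "\<dots> \<le> 1 * (lam\<^sup>2 * s)" using small_y s_ge by (intro mult_right_mono) auto
  finally have fin: "\<eta> * lam * NN + A / 2 * (vx + \<tau>\<^sup>2) + A / 4 * \<Lambda>2 * T2 \<le> C4 * (lam\<^sup>2 * s)"
    by (simp add: C4_def distrib_right)
  have nn2: "0 \<le> \<eta> * lam * NN" "0 \<le> A / 2 * (vx + \<tau>\<^sup>2)" "0 \<le> A / 4 * \<Lambda>2 * T2"
    using \<eta> lam_pos nn pos const_bounds by auto
  have "A / 2 * (vx + \<tau>\<^sup>2) \<le> C4 * (lam\<^sup>2 * s)" using fin nn2 by linarith
  hence W7: "vx + \<tau>\<^sup>2 \<le> C7 * (lam\<^sup>2 * s)" using pos by (simp add: C7_def field_simps)
  thus "vX t + (t p)\<^sup>2 \<le> C7 * (lam\<^sup>2 * s)" by (simp add: vx_def \<tau>_def)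
  have ls: "0 \<le> lam * s" using lam_pos s_ge by simp
  note s2 = lam2_s_le
  have "\<tau>\<^sup>2 \<le> C7 * (lam\<^sup>2 * s)" using W7 nn by linarith
  also have "\<dots> \<le> C7 * (lam * s)\<^sup>2" using s2 pos by (intro mult_left_mono) auto
  finally have "\<bar>\<tau>\<bar> \<le> sqrt (C7 * (lam * s)\<^sup>2)" by (metis real_sqrt_abs real_sqrt_le_mono)
  hence tau: "\<bar>\<tau>\<bar> \<le> sqrt C7 * (lam * s)" using ls by (simp add: real_sqrt_mult)
  have "A / 4 * \<Lambda>2 * T2 \<le> C4 * (lam\<^sup>2 * s)" using fin nn2 by linarith
  \<comment> \<open>The squared error is of order \<open>lam^2 * s\<close>; Cauchy-Schwarz on
    \<open>S\<close> and the intercept then costs a further \<open>sqrt s\<close> and yields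
    \<open>lam * s\<close>. The factor \<open>1 / \<eta>\<close> arises only from the coordinates
    outside \<open>S\<close>.\<close>
  hence "T2 \<le> 4 * C4 / (A * \<Lambda>2) * (lam\<^sup>2 * s)" using pos const_bounds by (simp add: field_simps)
  hence "2 * s * T2 \<le> 2 * s * (4 * C4 / (A * \<Lambda>2) * (lam\<^sup>2 * s))" using s_ge by (intro mult_left_mono) auto
  also have "\<dots> = 8 * C4 / (A * \<Lambda>2) * (lam * s)\<^sup>2" by (simp add: power2_eq_square)
  finally have "NS\<^sup>2 \<le> 8 * C4 / (A * \<Lambda>2) * (lam * s)\<^sup>2" using cs by linarith
  hence "\<bar>NS\<bar> \<le> sqrt (8 * C4 / (A * \<Lambda>2) * (lam * s)\<^sup>2)" by (metis real_sqrt_abs real_sqrt_le_mono)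
  hence NS: "NS \<le> sqrt (8 * C4 / (A * \<Lambda>2)) * (lam * s)" unfolding sqrt_mult_square[OF ls] by linarith
  have "\<eta> * lam * NN \<le> C4 * (lam\<^sup>2 * s)" using fin nn2 by linarith
  hence "lam * (\<eta> * NN) \<le> lam * (C4 * (lam * s))" by (simp add: power2_eq_square mult_ac)
  hence "\<eta> * NN \<le> C4 * (lam * s)" using lam_pos by simp
  hence NN: "NN \<le> C4 * (lam * s / \<eta>)" using \<eta> by (simp add: field_simps)
  have "norm1 t = NS + NN + \<bar>\<tau>\<bar>"
    unfolding norm1_def sum_atMost_p sum_lessThan_p NS_def NN_def \<tau>_def by simp
  also have "\<dots> \<le> sqrt (8 * C4 / (A * \<Lambda>2)) * (lam * s / \<eta>) + C4 * (lam * s / \<eta>) + sqrt C7 * (lam * s / \<eta>)"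
  proof -
    have "sqrt (8 * C4 / (A * \<Lambda>2)) * (lam * s) \<le> sqrt (8 * C4 / (A * \<Lambda>2)) * (lam * s / \<eta>)"
      using m_le(5) pos const_bounds by (intro mult_left_mono) auto
    moreover have "sqrt C7 * (lam * s) \<le> sqrt C7 * (lam * s / \<eta>)"
      using m_le(5) pos by (intro mult_left_mono) auto
    ultimately show ?thesis using NS NN tau by linarith
  qed
  also have "\<dots> = (kr - 1) * (lam * s / \<eta>)" unfolding kr_def by (simp add: algebra_simps)
  also have "\<dots> < m" unfolding m_le(3) using lam_pos s_ge \<eta> by (intro mult_strict_right_mono) auto
  finally show "norm1 t < m" .
qed

lemma optimum_exists: "\<exists>t\<in>admissible. \<forall>t'\<in>admissible. obj t \<le> obj t'"
  using minimizer_exists[OF localization(1) pos(11) small_m] by blast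

context
  fixes t
  assumes t: "t \<in> admissible" "\<And>t'. t' \<in> admissible \<Longrightarrow> obj t \<le> obj t'"
begin

lemma optimum_properties:
  "t \<in> l1_ball p m" "vX t + (t p)\<^sup>2 \<le> C7 * (lam\<^sup>2 * s)" "(\<Sum>j\<le>p. \<bar>t j\<bar>) \<le> m" "\<bar>t p\<bar> \<le> sqrt C7 * (lam * s / \<eta>)"
proof -
  have "(\<lambda>_. 0) \<in> admissible" by (simp add: admissible_def)
  hence le: "obj t \<le> obj (\<lambda>_. 0)" by (rule t(2))
  show ball: "t \<in> l1_ball p m"
    by (rule sublevel_in_ball[OF localization(1) pos(11) t(1) le])
  show W: "vX t + (t p)\<^sup>2 \<le> C7 * (lam\<^sup>2 * s)"
    using localization(2)[OF ball _ le] t(1) by (simp add: admissible_def)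
  show "(\<Sum>j\<le>p. \<bar>t j\<bar>) \<le> m" using ball by (simp add: l1_ball_def)
  have ls: "0 \<le> lam * s" using lam_pos s_ge by simp
  have "0 \<le> vX t" by (simp add: vX_def sum_nonneg)
  hence "(t p)\<^sup>2 \<le> C7 * (lam\<^sup>2 * s)" using W by linarith
  also have "\<dots> \<le> C7 * (lam * s)\<^sup>2"
    using lam2_s_le pos by (intro mult_left_mono) auto
  finally have "\<bar>t p\<bar> \<le> sqrt (C7 * (lam * s)\<^sup>2)" by (metis real_sqrt_abs real_sqrt_le_mono)
  hence "\<bar>t p\<bar> \<le> sqrt C7 * (lam * s)" using ls by (simp add: real_sqrt_mult)
  also have "\<dots> \<le> sqrt C7 * (lam * s / \<eta>)" using m_le(5) pos by (intro mult_left_mono) auto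
  finally show "\<bar>t p\<bar> \<le> sqrt C7 * (lam * s / \<eta>)" .
qed

lemma lam2_le: "lam\<^sup>2 * s \<le> lam * s / \<eta>" "K\<^sup>2 * m\<^sup>2 * r \<le> cr * kr\<^sup>2 * (lam * s / \<eta>)"
proof -
  have "lam * (lam * s) \<le> 1 * (lam * s)" using small_lam lam_pos s_ge by (intro mult_right_mono) auto
  thus l2: "lam\<^sup>2 * s \<le> lam * s / \<eta>" using m_le(5) by (simp add: power2_eq_square)
  have "K\<^sup>2 * m\<^sup>2 * r \<le> K\<^sup>2 * m\<^sup>2 * (cr * lam)" using r by (intro mult_left_mono) auto
  also have "\<dots> = cr * kr\<^sup>2 * (lam\<^sup>2 * s) * (y / \<eta>)" using \<eta> by (simp add: m_def y_def power2_eq_square)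
  also have "\<dots> \<le> cr * kr\<^sup>2 * (lam\<^sup>2 * s) * 1"
    using small_y const_bounds s_ge by (intro mult_left_mono) auto
  also have "\<dots> \<le> cr * kr\<^sup>2 * (lam * s / \<eta>)" using mult_left_mono[OF l2, of "cr * kr\<^sup>2"] const_bounds by simp
  finally show "K\<^sup>2 * m\<^sup>2 * r \<le> cr * kr\<^sup>2 * (lam * s / \<eta>)" .
qed

text \<open>Allows \<open>exp (risk t)\<close> to be replaced by \<open>e0\<close> in the
  stationarity conditions. Convexity encloses the increment between the linear terms with the
  gradients at 0 and at \<open>t\<close>, which differ only by deviation and quadratic
  terms.\<close>

lemma risk_difference: "\<bar>risk t - risk (\<lambda>_. 0)\<bar> \<le> C5 * (lam * s / \<eta>)"
proof -
  note P = optimum_properties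
  define z where "z = lam * s / \<eta>"
  have z: "0 \<le> z" using lam_pos s_ge \<eta> by (simp add: z_def)
  define G0 where "G0 = (\<Sum>j\<le>p. grad (\<lambda>_. 0) j * t j)"
  have G0: "\<bar>G0\<bar> \<le> (kr / elo + 2 * sqrt C7) * z"
  proof -
    have "\<bar>grad (\<lambda>_. 0) j\<bar> \<le> lam / elo" if "j < p" for j
    proof -
      have "elo * \<bar>grad (\<lambda>_. 0) j\<bar> \<le> e0 * \<bar>grad (\<lambda>_. 0) j\<bar>" using e0_bounds by (intro mult_right_mono) auto
      also have "\<dots> \<le> (1 - \<eta>) * lam" by (rule score[OF that])
      also have "\<dots> \<le> lam" using \<eta> lam_pos by (simp add: mult_le_cancel_right1)
      finally show ?thesis using const_bounds by (simp add: field_simps)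
    qed
    hence "(\<Sum>j<p. \<bar>grad (\<lambda>_. 0) j * t j\<bar>) \<le> (\<Sum>j<p. lam / elo * \<bar>t j\<bar>)"
      unfolding abs_mult by (intro sum_mono mult_right_mono) auto
    also have "\<dots> \<le> lam / elo * m"
      unfolding sum_distrib_left[symmetric] using P(3) lam_pos const_bounds
      by (intro mult_left_mono) (auto simp: sum_atMost_p)
    also have "\<dots> \<le> 1 / elo * m"
      using small_lam const_bounds pos by (intro mult_right_mono divide_right_mono) auto
    also have "\<dots> = kr / elo * z" by (simp add: m_le(3) z_def)
    finally have "\<bar>\<Sum>j<p. grad (\<lambda>_. 0) j * t j\<bar> \<le> kr / elo * z"
      using sum_abs[of "\<lambda>j. grad (\<lambda>_. 0) j * t j" "{..<p}"] by linarith
    moreover have "\<bar>grad (\<lambda>_. 0) p * t p\<bar> \<le> 2 * (sqrt C7 * z)"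
      unfolding abs_mult z_def using score_p r P(4) by (intro mult_mono) auto
    ultimately show ?thesis unfolding G0_def sum_atMost_p by (simp add: distrib_right)
  qed
  have low: "G0 \<le> risk t - risk (\<lambda>_. 0)"
    using risk_tangent[of "\<lambda>_. 0" t] by (simp add: G0_def)
  have "risk t - risk (\<lambda>_. 0) \<le> (\<Sum>j\<le>p. grad t j * t j)"
    using risk_tangent[of t "\<lambda>_. 0"] by (simp add: sum_negf)
  also have "\<dots> = G0 + (\<Sum>j\<le>p. (grad t j - grad (\<lambda>_. 0) j) * t j)"
    by (simp add: G0_def left_diff_distrib sum_subtractf)
  also have "\<dots> \<le> G0 + (Cd * K\<^sup>2 * m * r * m + (\<Sum>j\<le>p. expected t j * t j))"
    using dev_pairing[OF P(1,3)] by linarith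
  also have "(\<Sum>j\<le>p. expected t j * t j) \<le> 2 * C8 * (vX t + (t p)\<^sup>2)"
    unfolding expected_pairing vX_sum times_divide_eq_right sum_distrib_left
  proof (intro divide_right_mono sum_mono)
    fix i assume "i \<in> {..<n}"
    hence i: "i < n" by simp
    define u w where "u = xt i t" and "w = t p"
    define q where "q = (\<bar>u\<bar> + \<bar>w\<bar>)\<^sup>2"
    have uw: "\<bar>u\<bar> + \<bar>w\<bar> \<le> \<rho>" using xt_bound[OF i P(1)] small_\<rho> by (simp add: u_def w_def)
    have sq: "u\<^sup>2 \<le> q" "\<bar>u * w\<bar> \<le> q" "w\<^sup>2 \<le> q"
      by (simp_all add: q_def power2_eq_square abs_mult algebra_simps)
    have "h11 * u\<^sup>2 \<le> \<bar>h11\<bar> * q" "h22 * w\<^sup>2 \<le> \<bar>h22\<bar> * q"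
      using sq by (auto intro!: mult_mono)
    moreover have "2 * h12 * u * w \<le> 2 * \<bar>h12\<bar> * q"
    proof -
      have "h12 * (u * w) \<le> \<bar>h12\<bar> * \<bar>u * w\<bar>" by (metis abs_ge_self abs_mult)
      also have "\<dots> \<le> \<bar>h12\<bar> * q" using sq by (intro mult_left_mono) auto
      finally show ?thesis by simp
    qed
    moreover have "Lc * q * (\<bar>u\<bar> + \<bar>w\<bar>) \<le> Lc * q * \<bar>\<rho>\<bar>"
      using uw const_bounds by (intro mult_left_mono) (auto simp: q_def)
    moreover have "gc u w * u + gd u w * w \<le> (h11 * u\<^sup>2 + 2 * h12 * u * w + h22 * w\<^sup>2) + Lc * q * (\<bar>u\<bar> + \<bar>w\<bar>)"
      using pairing_expansion[OF uw] unfolding q_def by (simp only: abs_le_iff) linarith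
    ultimately have "gc u w * u + gd u w * w \<le> C8 * q"
      unfolding C8_def distrib_right by (simp add: mult_ac)
    also have "\<dots> \<le> C8 * (2 * (u\<^sup>2 + w\<^sup>2))"
      using abs_sum_square_le[of u w] pos by (intro mult_left_mono) (auto simp: q_def)
    also have "\<dots> = 2 * C8 * (u\<^sup>2 + w\<^sup>2)" by simp
    finally show "gc (xt i t) (t p) * xt i t + gd (xt i t) (t p) * t p \<le> 2 * C8 * ((xt i t)\<^sup>2 + (t p)\<^sup>2)"
      by (simp add: u_def w_def)
  qed simp
  also have "2 * C8 * (vX t + (t p)\<^sup>2) \<le> 2 * C8 * (C7 * z)"
  proof (rule mult_left_mono)
    have "vX t + (t p)\<^sup>2 \<le> C7 * (lam\<^sup>2 * s)" by (rule P(2))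
    also have "\<dots> \<le> C7 * z" unfolding z_def using lam2_le(1) pos by (intro mult_left_mono) auto
    finally show "vX t + (t p)\<^sup>2 \<le> C7 * z" .
  qed (use pos in auto)
  also have "Cd * K\<^sup>2 * m * r * m \<le> Cd * (cr * kr\<^sup>2 * z)"
    unfolding z_def using mult_left_mono[OF lam2_le(2), of Cd] const_bounds by (simp add: power2_eq_square mult_ac)
  finally have up: "risk t - risk (\<lambda>_. 0) \<le> G0 + (Cd * (cr * kr\<^sup>2 * z) + 2 * C8 * (C7 * z))" by simp
  have "0 \<le> Cd * (cr * kr\<^sup>2 * z)" "0 \<le> 2 * C8 * (C7 * z)" using const_bounds pos z by auto
  hence "\<bar>risk t - risk (\<lambda>_. 0)\<bar> \<le> \<bar>G0\<bar> + Cd * (cr * kr\<^sup>2 * z) + 2 * C8 * (C7 * z)"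
    using low up by linarith
  also have "\<dots> \<le> C5 * z" using G0 by (simp add: C5_def algebra_simps)
  finally show ?thesis by (simp add: z_def)
qed

lemma stationarity_expansion:
  assumes j: "1 \<le> j" "j < p"
  shows "\<exists>z w. \<bar>z\<bar> \<le> 1 \<and> z * ((1 + t p) * b j + t j) = \<bar>(1 + t p) * b j + t j\<bar> \<and>
    \<bar>w\<bar> \<le> (1 - \<eta> + C6 * y) * lam \<and>
    lam * z = w - e0 * h11 / n * (\<Sum>i<n. x i j * xt i t)"
proof -
  note P = optimum_properties
  obtain z where z: "\<bar>z\<bar> \<le> 1" "z * ((1 + t p) * b j + t j) = \<bar>(1 + t p) * b j + t j\<bar>"
    "exp (risk t) * grad t j = - lam * z"
    using minimizer_stationary[OF t j] by blast
  define DL where "DL = risk t - risk (\<lambda>_. 0)"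
  define \<theta> where "\<theta> = exp (- DL) - 1"
  have lsy: "0 \<le> lam * s / \<eta>" using lam_pos s_ge \<eta> by simp
  have C5y: "C5 * (lam * s / \<eta>) \<le> C5 * y" using m_le(4) pos by (intro mult_left_mono) auto
  have DL: "\<bar>DL\<bar> \<le> C5 * y" using risk_difference C5y unfolding DL_def by linarith
  have \<theta>: "\<bar>\<theta>\<bar> \<le> 2 * (C5 * y)"
    using abs_exp_minus_one_le[of "- DL"] DL small_y(3) unfolding \<theta>_def by simp
  have "e0 = exp (risk t) * exp (- DL)" by (simp add: e0_def DL_def flip: exp_add)
  hence eq: "e0 * grad t j = - lam * z * (1 + \<theta>)"
    using z(3) by (simp add: \<theta>_def mult_ac)
  define X where "X = (\<Sum>i<n. x i j * xt i t) / n"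
  have E: "\<bar>expected t j - h11 * X\<bar> \<le> 2 * K * Lc * (vX t + (t p)\<^sup>2)"
  proof -
    \<comment> \<open>Centering of column \<open>j\<close> removes the term with
      \<open>h12 * t p\<close>, so the scale error does not contribute to first order.\<close>
    have X': "h11 * X = (\<Sum>i<n. x i j * (h11 * xt i t + h12 * t p)) / n"
    proof -
      have "(\<Sum>i<n. x i j * (h11 * xt i t + h12 * t p)) = h11 * (\<Sum>i<n. x i j * xt i t) + h12 * t p * (\<Sum>i<n. x i j)"
        by (simp add: distrib_left sum.distrib sum_distrib_left mult_ac)
      thus ?thesis using x_centered[OF j] by (simp add: X_def)
    qed
    have "expected t j - h11 * X = (\<Sum>i<n. x i j * (gc (xt i t) (t p) - (h11 * xt i t + h12 * t p))) / n"
      unfolding X' expected_def using j by (simp add: right_diff_distrib sum_subtractf diff_divide_distrib)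
    hence "\<bar>expected t j - h11 * X\<bar> = \<bar>\<Sum>i<n. x i j * (gc (xt i t) (t p) - (h11 * xt i t + h12 * t p))\<bar> / n"
      by simp
    also have "\<dots> \<le> (\<Sum>i<n. \<bar>x i j * (gc (xt i t) (t p) - (h11 * xt i t + h12 * t p))\<bar>) / n"
      by (intro divide_right_mono sum_abs) auto
    also have "\<dots> \<le> (\<Sum>i<n. 2 * K * Lc * ((xt i t)\<^sup>2 + (t p)\<^sup>2)) / n"
    proof (intro divide_right_mono sum_mono)
      fix i assume "i \<in> {..<n}"
      hence i: "i < n" by simp
      have uw: "\<bar>xt i t\<bar> + \<bar>t p\<bar> \<le> \<rho>" using xt_bound[OF i P(1)] small_\<rho> by simp
      have "\<bar>x i j * (gc (xt i t) (t p) - (h11 * xt i t + h12 * t p))\<bar> \<le> K * (Lc * (\<bar>xt i t\<bar> + \<bar>t p\<bar>)\<^sup>2)"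
        unfolding abs_mult using x_bound[OF i j(2)] gc[OF uw] K by (intro mult_mono) auto
      also have "\<dots> \<le> K * (Lc * (2 * ((xt i t)\<^sup>2 + (t p)\<^sup>2)))"
        using abs_sum_square_le[of "xt i t" "t p"] K const_bounds by (intro mult_left_mono) auto
      finally show "\<bar>x i j * (gc (xt i t) (t p) - (h11 * xt i t + h12 * t p))\<bar> \<le> 2 * K * Lc * ((xt i t)\<^sup>2 + (t p)\<^sup>2)"
        by (simp add: mult_ac)
    qed simp
    also have "\<dots> = 2 * K * Lc * (vX t + (t p)\<^sup>2)"
      unfolding vX_sum by (simp add: sum_distrib_left)
    finally show ?thesis .
  qed
  define \<rho>j where "\<rho>j = grad t j - grad (\<lambda>_. 0) j - h11 * X"
  have \<rho>j: "\<bar>\<rho>j\<bar> \<le> (Cd * cr * kr + 2 * Lc * C7) * (y * lam)"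
  proof -
    have "\<bar>grad t j - grad (\<lambda>_. 0) j - expected t j\<bar> \<le> Cd * K\<^sup>2 * m * r" using dev[OF P(1)] j by simp
    also have "\<dots> \<le> Cd * K\<^sup>2 * m * (cr * lam)" using r const_bounds pos by (intro mult_left_mono) auto
    also have "\<dots> = Cd * cr * kr * (y * lam)" by (simp add: m_def y_def mult_ac)
    finally have 1: "\<bar>grad t j - grad (\<lambda>_. 0) j - expected t j\<bar> \<le> Cd * cr * kr * (y * lam)" .
    have "K * (lam * s) \<le> y"
    proof -
      have "K * (lam * s) \<le> K\<^sup>2 * (lam * s / \<eta>)"
        using K_le m_le(5) K lam_pos s_ge by (intro mult_mono) auto
      thus ?thesis by (simp add: y_def)
    qed
    hence "2 * Lc * C7 * (K * (lam * s) * lam) \<le> 2 * Lc * C7 * (y * lam)"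
      using const_bounds pos lam_pos by (intro mult_left_mono mult_right_mono) auto
    moreover have "2 * K * Lc * (vX t + (t p)\<^sup>2) \<le> 2 * K * Lc * (C7 * (lam\<^sup>2 * s))"
      using P(2) K const_bounds by (intro mult_left_mono) auto
    ultimately have "\<bar>expected t j - h11 * X\<bar> \<le> 2 * Lc * C7 * (y * lam)"
      using E by (simp add: power2_eq_square mult_ac)
    with 1 show ?thesis unfolding \<rho>j_def distrib_right by linarith
  qed
  \<comment> \<open>Three contributions: the score at the truth, the linearization error of the
    gradient, and the replacement of \<open>exp (risk t)\<close> by \<open>e0\<close>.\<close>
  define w where "w = - e0 * grad (\<lambda>_. 0) j - e0 * \<rho>j - lam * z * \<theta>"
  have "lam * z = w - e0 * h11 * X"
  proof -
    have "e0 * grad t j = e0 * grad (\<lambda>_. 0) j + e0 * h11 * X + e0 * \<rho>j"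
      by (simp add: \<rho>j_def algebra_simps)
    thus ?thesis using eq by (simp add: w_def algebra_simps)
  qed
  moreover have "\<bar>w\<bar> \<le> (1 - \<eta> + C6 * y) * lam"
  proof -
    have e0p: "0 < e0" by (simp add: e0_def)
    have "\<bar>e0 * \<rho>j\<bar> \<le> ehi * ((Cd * cr * kr + 2 * Lc * C7) * (y * lam))"
      unfolding abs_mult using \<rho>j e0_bounds e0p pos by (intro mult_mono) auto
    moreover have "\<bar>lam * z * \<theta>\<bar> \<le> lam * 1 * (2 * (C5 * y))"
      unfolding abs_mult using z(1) \<theta> lam_pos by (intro mult_mono) auto
    moreover have "\<bar>e0 * grad (\<lambda>_. 0) j\<bar> \<le> (1 - \<eta>) * lam"
      using score[OF j(2)] e0p by (simp add: abs_mult)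
    ultimately have "\<bar>w\<bar> \<le> (1 - \<eta>) * lam + ehi * ((Cd * cr * kr + 2 * Lc * C7) * (y * lam)) + lam * 1 * (2 * (C5 * y))"
      unfolding w_def by linarith
    also have "\<dots> = (1 - \<eta> + C6 * y) * lam" by (simp add: C6_def algebra_simps)
    finally show ?thesis .
  qed
  ultimately show ?thesis using z(1,2) by (intro exI[of _ z] exI[of _ w]) (simp add: X_def)
qed

text \<open>The condition \<open>irr\<close> is applied to \<open>v\<close>, the gradient of the quadratic approximation at \<open>t\<close>
  restricted to \<open>S\<close>. The residual \<open>u\<close> of the fit is orthogonal to the columns in \<open>S\<close>, so its
  squared norm involves only the coordinates outside \<open>S\<close>, and it would be negative if one of them
  were nonzero.\<close>

lemma optimum_zero_outside:
  assumes irr: "\<And>v V. 0 < V \<Longrightarrow> (\<And>j. j \<in> S \<Longrightarrow> \<bar>v j\<bar> \<le> V) \<Longrightarrow>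
      \<exists>c. (\<forall>j\<in>S. (\<Sum>i<n. x i j * (\<Sum>k\<in>S. x i k * c k)) = v j) \<and>
          (\<forall>j\<in>{1..<p} - S. \<bar>\<Sum>i<n. x i j * (\<Sum>k\<in>S. x i k * c k)\<bar> < \<eta>0 * V)"
    and \<eta>0: "(1 - \<eta> + C6 * y) + \<eta>0 * (2 - \<eta> + C6 * y) \<le> 1"
    and j0: "j0 \<in> {1..<p} - S"
  shows "t j0 = 0"
proof (rule ccontr)
  assume tj0: "t j0 \<noteq> 0"
  let ?N = "{1..<p} - S"
  define \<kappa> where "\<kappa> = e0 * h11 / n"
  have \<kappa>: "0 < \<kappa>" using n_pos const_bounds by (simp add: \<kappa>_def e0_def)
  have "\<forall>j\<in>{1..<p}. \<exists>zw. \<bar>fst zw\<bar> \<le> 1 \<and> fst zw * ((1 + t p) * b j + t j) = \<bar>(1 + t p) * b j + t j\<bar> \<and>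
    \<bar>snd zw\<bar> \<le> (1 - \<eta> + C6 * y) * lam \<and> lam * fst zw = snd zw - \<kappa> * (\<Sum>i<n. x i j * xt i t)"
    unfolding \<kappa>_def using stationarity_expansion by fastforce
  from bchoice[OF this] obtain zw where zw: "\<forall>j\<in>{1..<p}. \<bar>fst (zw j)\<bar> \<le> 1 \<and>
      fst (zw j) * ((1 + t p) * b j + t j) = \<bar>(1 + t p) * b j + t j\<bar> \<and>
      \<bar>snd (zw j)\<bar> \<le> (1 - \<eta> + C6 * y) * lam \<and> lam * fst (zw j) = snd (zw j) - \<kappa> * (\<Sum>i<n. x i j * xt i t)"
    by blast
  define z w where "z j = fst (zw j)" and "w j = snd (zw j)" for j
  have z: "\<bar>z j\<bar> \<le> 1" "z j * ((1 + t p) * b j + t j) = \<bar>(1 + t p) * b j + t j\<bar>"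
    "\<bar>w j\<bar> \<le> (1 - \<eta> + C6 * y) * lam" "lam * z j = w j - \<kappa> * (\<Sum>i<n. x i j * xt i t)"
    if "j \<in> {1..<p}" for j
    using zw that by (simp_all add: z_def w_def)
  \<comment> \<open>The perturbed score contributes \<open>(1 - \<eta> + C6 * y) * lam\<close> and
    the subgradient another \<open>lam\<close>.\<close>
  define V where "V = (2 - \<eta> + C6 * y) * lam"
  have V: "0 < V" using \<eta> pos lam_pos by (simp add: V_def add_pos_pos)
  define v where "v j = w j - lam * z j" for j
  have "\<bar>v j\<bar> \<le> V" if "j \<in> S" for j
  proof -
    have j: "j \<in> {1..<p}" using that by (simp add: S_def)
    have "\<bar>lam * z j\<bar> \<le> lam * 1" unfolding abs_mult using z(1)[OF j] lam_pos by (intro mult_mono) auto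
    thus ?thesis using z(3)[OF j] unfolding v_def V_def by (simp add: algebra_simps abs_le_iff) linarith
  qed
  then obtain c where c: "\<forall>j\<in>S. (\<Sum>i<n. x i j * (\<Sum>k\<in>S. x i k * c k)) = v j"
    "\<forall>j\<in>?N. \<bar>\<Sum>i<n. x i j * (\<Sum>k\<in>S. x i k * c k)\<bar> < \<eta>0 * V"
    using irr[OF V, of v] by blast
  \<comment> \<open>The intercept part \<open>t 0\<close> is subtracted so that \<open>u\<close>
    lies in the span of the penalized columns; inner products with those columns are unaffected
    because the columns are centered.\<close>
  define u where "u i = \<kappa> * (xt i t - t 0) - (\<Sum>k\<in>S. x i k * c k)" for i
  define P where "P j = (\<Sum>i<n. x i j * (\<Sum>k\<in>S. x i k * c k))" for j
  have xu: "(\<Sum>i<n. x i j * u i) = v j - P j" if j: "j \<in> {1..<p}" for j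
  proof -
    have "(\<Sum>i<n. x i j * u i) = \<kappa> * (\<Sum>i<n. x i j * xt i t) - \<kappa> * t 0 * (\<Sum>i<n. x i j) - P j"
      by (simp add: u_def P_def right_diff_distrib sum_subtractf sum_distrib_left mult_ac)
    thus ?thesis using z(4)[OF j] x_centered[of j] j by (simp add: v_def)
  qed
  have S0: "(\<Sum>i<n. x i j * u i) = 0" if "j \<in> S" for j
  proof -
    have "j \<in> {1..<p}" using that by (simp add: S_def)
    thus ?thesis using xu[of j] c(1) that by (simp add: P_def)
  qed
  have ui: "u i = (\<Sum>j\<in>?N. \<kappa> * t j * x i j) + (\<Sum>j\<in>S. (\<kappa> * t j - c j) * x i j)" if i: "i < n" for i
  proof -
    have "xt i t - t 0 = (\<Sum>j\<in>S. x i j * t j) + (\<Sum>j\<in>?N. x i j * t j)"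
      unfolding xt_def sum_lessThan_p using x_intercept[OF i] by simp
    hence "\<kappa> * (xt i t - t 0) = (\<Sum>j\<in>S. \<kappa> * t j * x i j) + (\<Sum>j\<in>?N. \<kappa> * t j * x i j)"
      by (simp add: distrib_left sum_distrib_left mult_ac)
    thus ?thesis by (simp add: u_def algebra_simps sum_subtractf)
  qed
  have "0 \<le> (\<Sum>i<n. u i * u i)" by (simp add: sum_nonneg)
  also have "(\<Sum>i<n. u i * u i) = (\<Sum>i<n. \<Sum>j\<in>?N. \<kappa> * t j * (x i j * u i)) + (\<Sum>i<n. \<Sum>j\<in>S. (\<kappa> * t j - c j) * (x i j * u i))"
    unfolding sum.distrib[symmetric]
  proof (rule sum.cong[OF refl])
    fix i assume "i \<in> {..<n}"
    hence i: "i < n" by simp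
    show "u i * u i = (\<Sum>j\<in>?N. \<kappa> * t j * (x i j * u i)) + (\<Sum>j\<in>S. (\<kappa> * t j - c j) * (x i j * u i))"
      by (subst (1) ui[OF i]) (simp only: distrib_right sum_distrib_right mult.assoc)
  qed
  also have "\<dots> = (\<Sum>j\<in>?N. \<kappa> * t j * (\<Sum>i<n. x i j * u i)) + (\<Sum>j\<in>S. (\<kappa> * t j - c j) * (\<Sum>i<n. x i j * u i))"
    by (subst sum.swap, subst (2) sum.swap) (simp add: sum_distrib_left)
  also have "\<dots> = \<kappa> * (\<Sum>j\<in>?N. t j * (v j - P j))"
    using S0 xu by (simp add: sum_distrib_left mult.assoc)
  finally have ge: "0 \<le> (\<Sum>j\<in>?N. t j * (v j - P j))" using \<kappa> by (simp add: zero_le_mult_iff)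
  define \<epsilon> where "\<epsilon> j = \<eta>0 * V - \<bar>P j\<bar>" for j
  have \<epsilon>: "0 < \<epsilon> j" if "j \<in> ?N" for j using c(2) that by (simp add: \<epsilon>_def P_def)
  \<comment> \<open>Outside \<open>S\<close> the sign condition reads
    \<open>t j * z j = |t j|\<close>, and \<open>\<eta>0\<close> states that score and
    irrepresentable term together do not exceed \<open>lam\<close>. The strictness in
    \<open>irr\<close> leaves the margin \<open>\<epsilon> j\<close>.\<close>
  have le: "t j * (v j - P j) \<le> - (\<bar>t j\<bar> * \<epsilon> j)" if j: "j \<in> ?N" for j
  proof -
    have j': "j \<in> {1..<p}" and bj: "b j = 0" using j by (auto simp: S_def)
    have zt: "t j * z j = \<bar>t j\<bar>" using z(2)[OF j'] bj by (simp add: mult.commute)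
    have "t j * w j \<le> \<bar>t j\<bar> * ((1 - \<eta> + C6 * y) * lam)"
      using mult_left_mono[OF z(3)[OF j'], of "\<bar>t j\<bar>"] abs_ge_self[of "t j * w j"] by (simp add: abs_mult)
    moreover have "- (t j * P j) \<le> \<bar>t j\<bar> * (\<eta>0 * V - \<epsilon> j)"
      using abs_ge_minus_self[of "t j * P j"] by (simp add: abs_mult \<epsilon>_def)
    moreover have "t j * (v j - P j) = t j * w j - lam * \<bar>t j\<bar> - t j * P j"
      unfolding v_def zt[symmetric] by (simp add: algebra_simps)
    ultimately have "t j * (v j - P j) \<le> \<bar>t j\<bar> * ((1 - \<eta> + C6 * y) * lam + \<eta>0 * V - lam) - \<bar>t j\<bar> * \<epsilon> j"
      by (simp add: algebra_simps)
    moreover have "(1 - \<eta> + C6 * y) * lam + \<eta>0 * V - lam \<le> 0"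
      using mult_right_mono[OF \<eta>0, of lam] lam_pos by (simp add: V_def algebra_simps)
    hence "\<bar>t j\<bar> * ((1 - \<eta> + C6 * y) * lam + \<eta>0 * V - lam) \<le> 0" by (simp add: mult_nonneg_nonpos)
    ultimately show ?thesis by linarith
  qed
  have "(\<Sum>j\<in>?N. t j * (v j - P j)) < (\<Sum>j\<in>?N. 0)"
  proof (rule sum_strict_mono_ex1)
    show "\<forall>j\<in>?N. t j * (v j - P j) \<le> 0"
    proof
      fix j assume j: "j \<in> ?N"
      have "0 \<le> \<bar>t j\<bar> * \<epsilon> j" using \<epsilon>[OF j] by simp
      thus "t j * (v j - P j) \<le> 0" using le[OF j] by linarith
    qed
    have "0 < \<bar>t j0\<bar> * \<epsilon> j0" using tj0 \<epsilon>[OF j0] by simp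
    thus "\<exists>j\<in>?N. t j * (v j - P j) < 0" using le[OF j0] j0 by force
  qed simp
  with ge show False by simp
qed

end

end

end

subsection \<open>Weak laws and quantiles\<close>

locale iid_sequence = prob_space M for M :: "'a measure" +
  fixes \<xi> :: "nat \<Rightarrow> 'a \<Rightarrow> real" and N :: "real measure"
  assumes indep: "indep_vars (\<lambda>_. borel) \<xi> UNIV"
    and law: "\<And>i. distr M borel (\<xi> i) = N"
begin

lemma rv [measurable]: "\<xi> i \<in> borel_measurable M"
  using indep by (auto simp: indep_vars_def)

lemma sets_N: "sets N = sets borel"
  using law[of 0] by (metis sets_distr)

lemma integrable_rv:
  fixes g :: "real \<Rightarrow> real"
  assumes "g \<in> borel_measurable borel" "integrable N g"
  shows "integrable M (\<lambda>\<omega>. g (\<xi> i \<omega>))"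
  using assms integrable_distr_eq[of "\<xi> i" M borel g] by (simp add: law)

lemma integral_rv:
  fixes g :: "real \<Rightarrow> real"
  assumes "g \<in> borel_measurable borel"
  shows "expectation (\<lambda>\<omega>. g (\<xi> i \<omega>)) = (\<integral>t. g t \<partial>N)"
  using assms integral_distr[of "\<xi> i" M borel g] by (simp add: law)

lemma expectation_square_sum:
  fixes g :: "real \<Rightarrow> real"
  assumes g[measurable]: "g \<in> borel_measurable borel" and g1: "integrable N g" "(\<integral>t. g t \<partial>N) = 0"
    and g2: "integrable N (\<lambda>t. (g t)\<^sup>2)"
  shows "integrable M (\<lambda>\<omega>. (\<Sum>i<n. g (\<xi> i \<omega>))\<^sup>2)"
    "expectation (\<lambda>\<omega>. (\<Sum>i<n. g (\<xi> i \<omega>))\<^sup>2) = n * (\<integral>t. (g t)\<^sup>2 \<partial>N)"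
proof -
  define Y where "Y i \<omega> = g (\<xi> i \<omega>)" for i \<omega>
  have Yi: "integrable M (Y i)" for i unfolding Y_def by (rule integrable_rv[OF g g1(1)])
  have E1: "expectation (Y i) = 0" for i unfolding Y_def using integral_rv[OF g] g1 by simp
  have sq: "integrable M (\<lambda>\<omega>. Y i \<omega> * Y i \<omega>)" "expectation (\<lambda>\<omega>. Y i \<omega> * Y i \<omega>) = (\<integral>t. (g t)\<^sup>2 \<partial>N)" for i
    using integrable_rv[of "\<lambda>t. (g t)\<^sup>2" i] integral_rv[of "\<lambda>t. (g t)\<^sup>2" i] g2
    by (simp_all add: Y_def power2_eq_square)
  have cross: "integrable M (\<lambda>\<omega>. Y i \<omega> * Y j \<omega>)" "expectation (\<lambda>\<omega>. Y i \<omega> * Y j \<omega>) = 0" if "i \<noteq> j" for i j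
  proof -
    have iv: "indep_vars (\<lambda>_. borel) Y {i, j}"
      unfolding Y_def by (rule indep_vars_compose2[OF indep_vars_subset[OF indep]]) auto
    show "integrable M (\<lambda>\<omega>. Y i \<omega> * Y j \<omega>)"
      using indep_vars_integrable[OF _ iv] Yi that by simp
    show "expectation (\<lambda>\<omega>. Y i \<omega> * Y j \<omega>) = 0"
      using indep_vars_lebesgue_integral[OF _ iv] Yi that E1 by simp
  qed
  have prod_int: "integrable M (\<lambda>\<omega>. Y i \<omega> * Y j \<omega>)" for i j
    using sq cross by (cases "i = j") auto
  have eq: "(\<Sum>i<n. g (\<xi> i \<omega>))\<^sup>2 = (\<Sum>i<n. \<Sum>j<n. Y i \<omega> * Y j \<omega>)" for \<omega>
    by (simp add: Y_def power2_eq_square sum_product)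
  show "integrable M (\<lambda>\<omega>. (\<Sum>i<n. g (\<xi> i \<omega>))\<^sup>2)"
    unfolding eq by (intro Bochner_Integration.integrable_sum prod_int)
  have "expectation (\<lambda>\<omega>. (\<Sum>i<n. g (\<xi> i \<omega>))\<^sup>2) = (\<Sum>i<n. \<Sum>j<n. expectation (\<lambda>\<omega>. Y i \<omega> * Y j \<omega>))"
    unfolding eq using prod_int by (simp add: Bochner_Integration.integral_sum)
  also have "\<dots> = (\<Sum>i<n. \<Sum>j<n. if j = i then (\<integral>t. (g t)\<^sup>2 \<partial>N) else 0)"
    using sq cross by (intro sum.cong) auto
  finally show "expectation (\<lambda>\<omega>. (\<Sum>i<n. g (\<xi> i \<omega>))\<^sup>2) = n * (\<integral>t. (g t)\<^sup>2 \<partial>N)" by simp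
qed

lemma chebyshev_mean:
  fixes g :: "real \<Rightarrow> real"
  assumes g[measurable]: "g \<in> borel_measurable borel" and g1: "integrable N g"
    and g2: "integrable N (\<lambda>t. (g t)\<^sup>2)" and n: "0 < n" and \<delta>: "0 < \<delta>"
  shows "prob {\<omega>\<in>space M. \<delta> \<le> \<bar>(\<Sum>i<n. g (\<xi> i \<omega>)) / n - (\<integral>t. g t \<partial>N)\<bar>} \<le> (\<integral>t. (g t)\<^sup>2 \<partial>N) / (n * \<delta>\<^sup>2)"
proof -
  define \<mu> where "\<mu> = (\<integral>t. g t \<partial>N)"
  have PN: "prob_space N" using prob_space_distr[OF rv, of 0] law by simp
  have c: "(\<lambda>t. g t - \<mu>) \<in> borel_measurable borel" by measurable
  have i1: "integrable N (\<lambda>t. g t - \<mu>)" using g1 PN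
    by (simp add: prob_space.finite_measure finite_measure.integrable_const)
  have z: "(\<integral>t. g t - \<mu> \<partial>N) = 0" using g1 PN
    by (simp add: prob_space.finite_measure finite_measure.integrable_const prob_space.prob_space \<mu>_def)
  have sq: "(g t - \<mu>)\<^sup>2 = (g t)\<^sup>2 - 2 * \<mu> * g t + \<mu>\<^sup>2" for t by (simp add: power2_eq_square algebra_simps)
  have i2: "integrable N (\<lambda>t. (g t - \<mu>)\<^sup>2)" unfolding sq using g1 g2 PN
    by (simp add: prob_space.finite_measure finite_measure.integrable_const)
  have "(\<integral>t. (g t - \<mu>)\<^sup>2 \<partial>N) = (\<integral>t. (g t)\<^sup>2 \<partial>N) - \<mu>\<^sup>2"
    unfolding sq using g1 g2 PN
    by (simp add: prob_space.finite_measure finite_measure.integrable_const prob_space.prob_space \<mu>_def power2_eq_square)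
  hence le: "(\<integral>t. (g t - \<mu>)\<^sup>2 \<partial>N) \<le> (\<integral>t. (g t)\<^sup>2 \<partial>N)" by simp
  note E = expectation_square_sum[OF c i1 z i2, of n]
  have eqv: "(\<Sum>i<n. g (\<xi> i \<omega>)) / n - \<mu> = (\<Sum>i<n. g (\<xi> i \<omega>) - \<mu>) / n" for \<omega>
    using n by (simp add: sum_subtractf diff_divide_distrib)
  have "{\<omega>\<in>space M. \<delta> \<le> \<bar>(\<Sum>i<n. g (\<xi> i \<omega>)) / n - \<mu>\<bar>}
      \<subseteq> {\<omega>\<in>space M. (n * \<delta>)\<^sup>2 \<le> (\<Sum>i<n. g (\<xi> i \<omega>) - \<mu>)\<^sup>2}"
  proof safe
    fix \<omega> assume "\<delta> \<le> \<bar>(\<Sum>i<n. g (\<xi> i \<omega>)) / n - \<mu>\<bar>"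
    hence "n * \<delta> \<le> \<bar>\<Sum>i<n. g (\<xi> i \<omega>) - \<mu>\<bar>" unfolding eqv using n by (simp add: field_simps)
    thus "(n * \<delta>)\<^sup>2 \<le> (\<Sum>i<n. g (\<xi> i \<omega>) - \<mu>)\<^sup>2"
      using \<delta> by (metis abs_ge_zero abs_le_square_iff abs_of_nonneg less_imp_le mult_nonneg_nonneg of_nat_0_le_iff)
  qed
  hence "prob {\<omega>\<in>space M. \<delta> \<le> \<bar>(\<Sum>i<n. g (\<xi> i \<omega>)) / n - \<mu>\<bar>}
      \<le> prob {\<omega>\<in>space M. (n * \<delta>)\<^sup>2 \<le> (\<Sum>i<n. g (\<xi> i \<omega>) - \<mu>)\<^sup>2}"
    by (intro finite_measure_mono) measurable
  also have "\<dots> \<le> expectation (\<lambda>\<omega>. (\<Sum>i<n. g (\<xi> i \<omega>) - \<mu>)\<^sup>2) / (n * \<delta>)\<^sup>2"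
    using n \<delta> E(1) by (intro integral_Markov_inequality_measure[where A = "{}"]) auto
  also have "\<dots> = (\<integral>t. (g t - \<mu>)\<^sup>2 \<partial>N) / (n * \<delta>\<^sup>2)"
    unfolding E(2) using n \<delta> by (simp add: power2_eq_square)
  also have "\<dots> \<le> (\<integral>t. (g t)\<^sup>2 \<partial>N) / (n * \<delta>\<^sup>2)"
    using le by (intro divide_right_mono) auto
  finally show ?thesis by (simp add: \<mu>_def)
qed

text \<open>Truncation at a fixed level reduces the weak law for integrable variables to Chebyshev's
  inequality for bounded ones.\<close>

lemma weak_law:
  fixes g :: "real \<Rightarrow> real"
  assumes g[measurable]: "g \<in> borel_measurable borel" and g1: "integrable N g"
  shows "(\<lambda>n. prob {\<omega>\<in>space M. 1 \<le> \<bar>(\<Sum>i<n. g (\<xi> i \<omega>)) / n - (\<integral>t. g t \<partial>N)\<bar>}) \<longlonglongrightarrow> 0"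
proof -
  have PN: "prob_space N" using prob_space_distr[OF rv, of 0] law by simp
  note [measurable_cong] = sets_N
  define lo where "lo B t = g t * indicator {t. \<bar>g t\<bar> \<le> B} t" for B t
  define hi where "hi B t = \<bar>g t\<bar> * indicator {t. B < \<bar>g t\<bar>} t" for B t
  have [measurable]: "lo B \<in> borel_measurable borel" "hi B \<in> borel_measurable borel" for B
    unfolding lo_def[abs_def] hi_def[abs_def] by measurable
  have hi_nonneg: "0 \<le> hi B t" for B t by (simp add: hi_def)
  have hi_int: "integrable N (hi B)" for B
    by (rule Bochner_Integration.integrable_bound[OF g1]) (auto simp: hi_def indicator_def)
  have lo_int: "integrable N (lo B)" for B
    by (rule Bochner_Integration.integrable_bound[OF g1]) (auto simp: lo_def indicator_def)
  have lo2_int: "integrable N (\<lambda>t. (lo B t)\<^sup>2)" for B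
  proof (rule finite_measure.integrable_const_bound[where B = "B\<^sup>2"])
    have "\<bar>lo B t\<bar>\<^sup>2 \<le> B\<^sup>2" for t
      by (cases "\<bar>g t\<bar> \<le> B") (auto simp: lo_def intro: power_mono[of "\<bar>g t\<bar>" B 2, simplified])
    thus "AE t in N. norm ((lo B t)\<^sup>2) \<le> B\<^sup>2" by simp
  qed (use PN in \<open>auto simp: prob_space.finite_measure\<close>)
  have hi_lim: "(\<lambda>k. \<integral>t. hi (real k) t \<partial>N) \<longlonglongrightarrow> (\<integral>t. 0 \<partial>N)"
  proof (rule integral_dominated_convergence[where w = "\<lambda>t. \<bar>g t\<bar>"])
    show "AE t in N. (\<lambda>k. hi (real k) t) \<longlonglongrightarrow> 0"
    proof (rule AE_I2)
      fix t
      have "eventually (\<lambda>k. \<bar>g t\<bar> \<le> real k) sequentially"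
        using eventually_ge_at_top[of "nat \<lceil>\<bar>g t\<bar>\<rceil>"] by eventually_elim linarith
      hence "eventually (\<lambda>k. hi (real k) t = 0) sequentially"
        by eventually_elim (simp add: hi_def)
      thus "(\<lambda>k. hi (real k) t) \<longlonglongrightarrow> 0" by (rule tendsto_eventually)
    qed
  qed (use g1 in \<open>auto simp: hi_def indicator_def\<close>)
  show ?thesis
  proof (rule LIMSEQ_I)
    fix \<epsilon> :: real assume \<epsilon>: "0 < \<epsilon>"
    obtain k where k: "(\<integral>t. hi (real k) t \<partial>N) < min (1/3) (\<epsilon> / 9)"
    proof -
      have "eventually (\<lambda>k. (\<integral>t. hi (real k) t \<partial>N) < min (1/3) (\<epsilon> / 9)) sequentially"
        using hi_lim \<epsilon> by (intro order_tendstoD(2)[where y = 0]) auto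
      thus ?thesis using that by (auto simp: eventually_sequentially)
    qed
    define B where "B = real k"
    define v where "v = (\<integral>t. (lo B t)\<^sup>2 \<partial>N)"
    have v: "0 \<le> v" by (simp add: v_def)
    have bound: "prob {\<omega>\<in>space M. 1 \<le> \<bar>(\<Sum>i<n. g (\<xi> i \<omega>)) / n - (\<integral>t. g t \<partial>N)\<bar>} \<le> v / (n * (1/3)\<^sup>2) + \<epsilon> / 3"
      if n: "0 < n" for n
    proof -
      let ?A = "{\<omega>\<in>space M. 1/3 \<le> \<bar>(\<Sum>i<n. lo B (\<xi> i \<omega>)) / n - (\<integral>t. lo B t \<partial>N)\<bar>}"
      let ?C = "{\<omega>\<in>space M. 1/3 \<le> (\<Sum>i<n. hi B (\<xi> i \<omega>)) / n}"
      have split: "\<bar>g t - lo B t\<bar> = hi B t" for t by (auto simp: lo_def hi_def indicator_def)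
      have "{\<omega>\<in>space M. 1 \<le> \<bar>(\<Sum>i<n. g (\<xi> i \<omega>)) / n - (\<integral>t. g t \<partial>N)\<bar>} \<subseteq> ?A \<union> ?C"
      proof (rule subsetI, rule ccontr)
        fix \<omega> assume *: "\<omega> \<in> {\<omega>\<in>space M. 1 \<le> \<bar>(\<Sum>i<n. g (\<xi> i \<omega>)) / n - (\<integral>t. g t \<partial>N)\<bar>}" "\<omega> \<notin> ?A \<union> ?C"
        have "\<bar>(\<Sum>i<n. g (\<xi> i \<omega>)) / n - (\<Sum>i<n. lo B (\<xi> i \<omega>)) / n\<bar> = \<bar>\<Sum>i<n. g (\<xi> i \<omega>) - lo B (\<xi> i \<omega>)\<bar> / n"
          by (simp add: sum_subtractf diff_divide_distrib[symmetric])
        also have "\<dots> \<le> (\<Sum>i<n. hi B (\<xi> i \<omega>)) / n"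
          unfolding split[symmetric] by (intro divide_right_mono sum_abs) auto
        also have "\<dots> < 1/3"
        proof (rule ccontr)
          assume "\<not> (\<Sum>i<n. hi B (\<xi> i \<omega>)) / n < 1/3"
          hence "1/3 \<le> (\<Sum>i<n. hi B (\<xi> i \<omega>)) / n" by linarith
          thus False using * by blast
        qed
        finally have 1: "\<bar>(\<Sum>i<n. g (\<xi> i \<omega>)) / n - (\<Sum>i<n. lo B (\<xi> i \<omega>)) / n\<bar> < 1/3" .
        have "\<bar>(\<integral>t. g t \<partial>N) - (\<integral>t. lo B t \<partial>N)\<bar> = \<bar>\<integral>t. g t - lo B t \<partial>N\<bar>"
          using g1 lo_int by simp
        also have "\<dots> \<le> (\<integral>t. hi B t \<partial>N)" unfolding split[symmetric] by (rule integral_abs_bound)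
        finally have 2: "\<bar>(\<integral>t. g t \<partial>N) - (\<integral>t. lo B t \<partial>N)\<bar> < 1/3" using k by (simp add: B_def)
        have 3: "\<bar>(\<Sum>i<n. lo B (\<xi> i \<omega>)) / n - (\<integral>t. lo B t \<partial>N)\<bar> < 1/3" using * by auto
        have "\<bar>(\<Sum>i<n. g (\<xi> i \<omega>)) / n - (\<integral>t. g t \<partial>N)\<bar> < 1" using 1 2 3 by linarith
        thus False using * by auto
      qed
      hence "prob {\<omega>\<in>space M. 1 \<le> \<bar>(\<Sum>i<n. g (\<xi> i \<omega>)) / n - (\<integral>t. g t \<partial>N)\<bar>} \<le> prob (?A \<union> ?C)"
        by (intro finite_measure_mono) measurable
      also have "\<dots> \<le> prob ?A + prob ?C" by (intro measure_Un_le) measurable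
      also have "prob ?A \<le> v / (n * (1/3)\<^sup>2)"
        unfolding v_def using lo_int lo2_int n by (intro chebyshev_mean) auto
      also have "prob ?C \<le> \<epsilon> / 3"
      proof -
        have ii: "integrable M (\<lambda>\<omega>. hi B (\<xi> i \<omega>))" for i using hi_int by (intro integrable_rv) auto
        have "prob ?C \<le> expectation (\<lambda>\<omega>. (\<Sum>i<n. hi B (\<xi> i \<omega>)) / n) / (1/3)"
          using ii by (intro integral_Markov_inequality_measure[where A = "{}"])
            (auto intro!: sum_nonneg divide_nonneg_nonneg hi_nonneg)
        also have "expectation (\<lambda>\<omega>. (\<Sum>i<n. hi B (\<xi> i \<omega>)) / n) = (\<integral>t. hi B t \<partial>N)"
          using ii n by (simp add: integral_rv Bochner_Integration.integral_sum)
        finally show ?thesis using k by (simp add: B_def)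
      qed
      finally show ?thesis by simp
    qed
    have "(\<lambda>n. v / (real n * (1/3)\<^sup>2)) \<longlonglongrightarrow> 0" by real_asymp
    hence "eventually (\<lambda>n. v / (real n * (1/3)\<^sup>2) < \<epsilon> / 3) sequentially"
      using \<epsilon> by (intro order_tendstoD(2)[where y = 0]) auto
    hence "eventually (\<lambda>n. prob {\<omega>\<in>space M. 1 \<le> \<bar>(\<Sum>i<n. g (\<xi> i \<omega>)) / n - (\<integral>t. g t \<partial>N)\<bar>} < \<epsilon>) sequentially"
      using eventually_gt_at_top[of 0]
    proof eventually_elim
      case (elim n)
      with bound[of n] \<epsilon> show ?case by linarith
    qed
    thus "\<exists>no. \<forall>n\<ge>no. norm (prob {\<omega>\<in>space M. 1 \<le> \<bar>(\<Sum>i<n. g (\<xi> i \<omega>)) / n - (\<integral>t. g t \<partial>N)\<bar>} - 0) < \<epsilon>"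
      by (auto simp: eventually_sequentially)
  qed
qed

text \<open>The uniform deviation bound lives on the product space; independence identifies the
  joint law of the first \<open>n\<close> noise variables with the product measure.\<close>

lemma emeasure_vimage_PiM:
  assumes "0 < n" "E \<in> sets (PiM {..<n} (\<lambda>_. N))"
  shows "{\<omega>\<in>space M. (\<lambda>i\<in>{..<n}. \<xi> i \<omega>) \<in> E} \<in> sets M"
    "emeasure M {\<omega>\<in>space M. (\<lambda>i\<in>{..<n}. \<xi> i \<omega>) \<in> E} = emeasure (PiM {..<n} (\<lambda>_. N)) E"
proof -
  have "indep_vars (\<lambda>_. borel) \<xi> {..<n}" by (rule indep_vars_subset[OF indep]) simp
  hence D: "distr M (PiM {..<n} (\<lambda>_. borel)) (\<lambda>\<omega>. \<lambda>i\<in>{..<n}. \<xi> i \<omega>) = PiM {..<n} (\<lambda>_. N)"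
    using assms(1) law by (subst (asm) indep_vars_iff_distr_eq_PiM) auto
  have E: "E \<in> sets (PiM {..<n} (\<lambda>_. borel))"
    using assms(2) D by (metis sets_distr)
  have m: "(\<lambda>\<omega>. \<lambda>i\<in>{..<n}. \<xi> i \<omega>) \<in> measurable M (PiM {..<n} (\<lambda>_. borel))" by measurable
  have eq: "{\<omega>\<in>space M. (\<lambda>i\<in>{..<n}. \<xi> i \<omega>) \<in> E} = (\<lambda>\<omega>. \<lambda>i\<in>{..<n}. \<xi> i \<omega>) -` E \<inter> space M" by blast
  show "{\<omega>\<in>space M. (\<lambda>i\<in>{..<n}. \<xi> i \<omega>) \<in> E} \<in> sets M"
    unfolding eq using m E by (rule measurable_sets)
  show "emeasure M {\<omega>\<in>space M. (\<lambda>i\<in>{..<n}. \<xi> i \<omega>) \<in> E} = emeasure (PiM {..<n} (\<lambda>_. N)) E"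
    unfolding D[symmetric] eq using m E by (rule emeasure_distr[symmetric])
qed

end

context prob_space
begin

text \<open>Right-continuity of the distribution function: the infimum in \<open>quantile\<close> is
  attained. The limits of the distribution function make the set of candidates nonempty and bounded
  below.\<close>

lemma prob_le_quantile:
  assumes Z: "Z \<in> borel_measurable M" and u: "0 < u" "u < 1"
  shows "u \<le> prob {\<omega>\<in>space M. Z \<omega> \<le> quantile M Z u}"
proof -
  interpret D: real_distribution "distr M borel Z" by (rule real_distribution_distr[OF Z])
  let ?F = "cdf (distr M borel Z)"
  define T where "T = {t. u \<le> ?F t}"
  have "eventually (\<lambda>t. u < ?F t) at_top"
    using D.cdf_lim_at_top_prob u by (intro order_tendstoD(1)) auto
  hence "\<exists>t. u < ?F t" by (rule eventually_happens'[rotated]) simp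
  hence ne: "T \<noteq> {}" by (auto simp: T_def intro: less_imp_le)
  have "eventually (\<lambda>t. ?F t < u) at_bot"
    using D.cdf_lim_at_bot u by (intro order_tendstoD(2)) auto
  then obtain t0 where t0: "?F t0 < u" by (auto simp: eventually_at_bot_linorder)
  have bdd: "bdd_below T"
  proof (rule bdd_belowI[of _ t0])
    fix t assume "t \<in> T"
    hence "?F t0 < ?F t" using t0 by (simp add: T_def)
    thus "t0 \<le> t" using D.cdf_nondecreasing[of t t0] by linarith
  qed
  have "u \<le> ?F s" if s: "Inf T < s" for s
  proof -
    obtain t where "t \<in> T" "t < s" using cInf_lessD[OF ne s] by blast
    thus ?thesis using D.cdf_nondecreasing[of t s] by (simp add: T_def)
  qed
  hence "eventually (\<lambda>s. u \<le> ?F s) (at_right (Inf T))"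
    by (auto simp: eventually_at_filter)
  moreover have "(?F \<longlongrightarrow> ?F (Inf T)) (at_right (Inf T))"
    using D.cdf_is_right_cont by (simp add: continuous_within)
  ultimately have "u \<le> ?F (Inf T)"
    by (intro tendsto_lowerbound) auto
  also have "?F (Inf T) = prob {\<omega>\<in>space M. Z \<omega> \<le> Inf T}"
    using Z by (simp add: cdf_def measure_distr vimage_def Int_def conj_commute)
  finally show ?thesis by (simp add: quantile_def T_def)
qed

text \<open>Together with the lower bound on the tuning parameter this makes \<open>lam\<close>
  nonnegative.\<close>

lemma quantile_nonneg:
  assumes Z: "Z \<in> borel_measurable M" "\<And>\<omega>. 0 \<le> Z \<omega>" and u: "0 < u" "u < 1"
  shows "0 \<le> quantile M Z u"
proof (rule ccontr)
  assume neg: "\<not> 0 \<le> quantile M Z u"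
  have "{\<omega>\<in>space M. Z \<omega> \<le> quantile M Z u} = {}"
  proof -
    have "\<not> Z \<omega> \<le> quantile M Z u" for \<omega> using Z(2)[of \<omega>] neg by linarith
    thus ?thesis by simp
  qed
  with prob_le_quantile[OF Z(1) u] u show False by (simp only: measure_empty)
qed

end

subsection \<open>Design matrices\<close>

lemma mult_mat_vec_index_sum:
  assumes "A \<in> carrier_mat n p" "v \<in> carrier_vec p" "i < n"
  shows "(A *\<^sub>v v) $ i = (\<Sum>k<p. A $$ (i, k) * v $ k)"
  using assms by (auto simp: scalar_prod_def lessThan_atLeast0 intro!: sum.cong)

text \<open>Rayleigh's principle: the minimum of the form on the unit sphere is attained by
  compactness, and stationarity of the minimizer makes the minimal value an eigenvalue.\<close>

lemma symmetric_quadratic_form_ge: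
  fixes A :: "real mat" and t :: "nat \<Rightarrow> real"
  assumes A: "A \<in> carrier_mat p p" and sym: "transpose_mat A = A" and ev: "smallest_eigenvalue A k"
  shows "k * (\<Sum>j<p. (t j)\<^sup>2) \<le> (\<Sum>i<p. \<Sum>j<p. A $$ (i, j) * t i * t j)"
proof -
  define bil where "bil u w = (\<Sum>i<p. \<Sum>j<p. A $$ (i, j) * u i * w j)" for u w :: "nat \<Rightarrow> real"
  define nrm where "nrm u = (\<Sum>j<p. (u j)\<^sup>2)" for u :: "nat \<Rightarrow> real"
  have symA: "A $$ (i, j) = A $$ (j, i)" if "i < p" "j < p" for i j
    using arg_cong[OF sym, of "\<lambda>B. B $$ (i, j)"] A that by simp
  have bil_sym: "bil u w = bil w u" for u w
  proof -
    have "bil u w = (\<Sum>j<p. \<Sum>i<p. A $$ (i, j) * u i * w j)" unfolding bil_def by (rule sum.swap)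
    also have "\<dots> = bil w u" unfolding bil_def using symA by (intro sum.cong) (auto simp: mult_ac)
    finally show ?thesis .
  qed
  have p: "0 < p"
  proof (rule ccontr)
    assume "\<not> 0 < p"
    hence "p = 0" by simp
    moreover obtain v where "eigenvector A v k"
      using ev by (auto simp: smallest_eigenvalue_def eigenvalue_def)
    hence "v \<in> carrier_vec p" "v \<noteq> 0\<^sub>v p" using A by (auto simp: eigenvector_def)
    ultimately show False by auto
  qed
  define U where "U = {u \<in> l1_ball p p. u p = 0 \<and> nrm u = 1}"
  have co: "continuous_on B (\<lambda>t :: nat \<Rightarrow> real. t k)" for B k
    by (rule continuous_on_subset[OF continuous_on_product_coordinates]) simp
  have "compact U"
  proof -
    have "closed {u :: nat \<Rightarrow> real. u p = 0 \<and> nrm u = 1}"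
      unfolding nrm_def by (intro closed_Collect_conj closed_Collect_eq continuous_on_sum continuous_on_power continuous_on_const co)
    hence "compact (l1_ball p p \<inter> {u. u p = 0 \<and> nrm u = 1})" by (rule compact_Int_closed[OF compact_l1_ball])
    moreover have "l1_ball p p \<inter> {u. u p = 0 \<and> nrm u = 1} = U" unfolding U_def by blast
    ultimately show ?thesis by simp
  qed
  moreover have "(\<lambda>j. if j = 0 then 1 else 0) \<in> U"
  proof -
    have "(\<Sum>k\<le>p. \<bar>if k = 0 then 1 else 0 :: real\<bar>) = (\<Sum>k\<le>p. if k = 0 then 1 else 0)" by (intro sum.cong) auto
    hence 1: "(\<Sum>k\<le>p. \<bar>if k = 0 then 1 else 0 :: real\<bar>) = 1" by simp
    have "nrm (\<lambda>j. if j = 0 then 1 else 0) = (\<Sum>j<p. if j = 0 then 1 else 0)"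
      unfolding nrm_def by (intro sum.cong) auto
    hence "nrm (\<lambda>j. if j = 0 then 1 else 0) = 1" using p by simp
    thus ?thesis using p 1 by (simp add: U_def l1_ball_def)
  qed
  moreover have "continuous_on U (\<lambda>u. bil u u)" unfolding bil_def by (intro continuous_intros co)
  ultimately obtain u0 where u0: "u0 \<in> U" "\<And>u. u \<in> U \<Longrightarrow> bil u0 u0 \<le> bil u u"
    using continuous_attains_inf[of U "\<lambda>u. bil u u"] by blast
  define k0 where "k0 = bil u0 u0"
  have k0_le: "k0 * nrm u \<le> bil u u" for u
  proof (cases "nrm u = 0")
    case True
    hence "\<forall>j<p. u j = 0" by (simp add: nrm_def sum_nonneg_eq_0_iff)
    hence "bil u u = 0" by (simp add: bil_def)
    thus ?thesis using True by simp
  next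
    case False
    hence pos: "0 < nrm u" by (simp add: nrm_def order_less_le sum_nonneg)
    define r where "r = sqrt (nrm u)"
    have r: "0 < r" "r\<^sup>2 = nrm u" using pos by (auto simp: r_def)
    define w where "w j = (if j < p then u j / r else 0)" for j
    have nw: "nrm w = 1"
    proof -
      have "nrm w = nrm u / r\<^sup>2" by (simp add: nrm_def w_def power_divide sum_divide_distrib)
      thus ?thesis using r pos by simp
    qed
    have "\<bar>w j\<bar> \<le> 1" if "j < p" for j
    proof -
      have "(w j)\<^sup>2 \<le> nrm w" unfolding nrm_def using that by (intro member_le_sum) auto
      thus ?thesis using nw by (simp add: abs_square_le_1)
    qed
    hence "(\<Sum>j<p. \<bar>w j\<bar>) \<le> (\<Sum>j<p. 1)" by (intro sum_mono) auto
    hence "(\<Sum>j\<le>p. \<bar>w j\<bar>) \<le> p" by (simp add: lessThan_Suc_atMost[symmetric] w_def)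
    hence "w \<in> U" using nw by (simp add: U_def l1_ball_def w_def)
    hence "k0 \<le> bil w w" using u0(2) by (simp add: k0_def)
    also have "\<dots> = bil u u / r\<^sup>2"
      by (simp add: bil_def w_def sum_divide_distrib power2_eq_square)
    finally show ?thesis unfolding r(2) using pos by (simp add: pos_le_divide_eq)
  qed
  have stat: "bil u0 w = k0 * (\<Sum>j<p. u0 j * w j)" for w
  proof -
    define b where "b = bil u0 w - k0 * (\<Sum>j<p. u0 j * w j)"
    define c where "c = bil w w - k0 * nrm w"
    have c: "0 \<le> c" using k0_le[of w] by (simp add: c_def)
    have "0 \<le> 2 * s * b + s\<^sup>2 * c" for s
    proof -
      have 1: "nrm (\<lambda>j. u0 j + s * w j) = 1 + 2 * s * (\<Sum>j<p. u0 j * w j) + s\<^sup>2 * nrm w"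
        using u0(1) by (simp add: U_def nrm_def power2_sum power_mult_distrib sum.distrib sum_distrib_left mult_ac)
      have 2: "bil (\<lambda>j. u0 j + s * w j) (\<lambda>j. u0 j + s * w j) = k0 + s * bil u0 w + s * bil w u0 + s\<^sup>2 * bil w w"
        by (simp add: k0_def bil_def algebra_simps power2_eq_square sum.distrib sum_distrib_left)
      show ?thesis
        using k0_le[of "\<lambda>j. u0 j + s * w j"] unfolding 1 2 bil_sym[of w u0]
        by (simp add: b_def c_def algebra_simps)
    qed
    note nonneg = this
    \<comment> \<open>With \<open>s = - q\<close> the nonnegative quadratic
      \<open>2 * s * b + s^2 * c\<close> becomes \<open>- q^2 * (c + 2)\<close>, which forces
      \<open>b = 0\<close>; the added 1 avoids division by zero.\<close>
    define q where "q = b / (c + 1)"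
    have b: "b = q * (c + 1)" using c by (simp add: q_def)
    have "0 \<le> - (q\<^sup>2 * (c + 2))" using nonneg[of "- q"] unfolding b by (simp add: power2_eq_square algebra_simps)
    hence "q = 0" using c by (simp add: mult_le_0_iff)
    hence "b = 0" by (simp add: b)
    thus ?thesis by (simp add: b_def)
  qed
  define v0 where "v0 = vec p u0"
  have "A *\<^sub>v v0 = k0 \<cdot>\<^sub>v v0"
  proof (rule eq_vecI)
    fix j assume "j < dim_vec (k0 \<cdot>\<^sub>v v0)"
    hence j: "j < p" by (simp add: v0_def)
    have "(A *\<^sub>v v0) $ j = (\<Sum>i<p. A $$ (j, i) * u0 i)"
      using mult_mat_vec_index_sum[OF A _ j, of v0] by (simp add: v0_def)
    also have "\<dots> = (\<Sum>i<p. A $$ (i, j) * u0 i)" using symA j by (intro sum.cong) auto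
    also have "\<dots> = bil u0 (\<lambda>l. if l = j then 1 else 0)"
      unfolding bil_def using j by (intro sum.cong) (auto simp: if_distrib cong: if_cong)
    also have "\<dots> = k0 * u0 j" unfolding stat using j by (simp add: if_distrib cong: if_cong)
    finally show "(A *\<^sub>v v0) $ j = (k0 \<cdot>\<^sub>v v0) $ j" using j by (simp add: v0_def)
  qed (use A in \<open>simp add: v0_def\<close>)
  moreover have "v0 \<noteq> 0\<^sub>v p"
  proof
    assume z: "v0 = 0\<^sub>v p"
    have "u0 j = 0" if "j < p" for j using arg_cong[OF z, of "\<lambda>w. w $ j"] that by (simp add: v0_def)
    hence "nrm u0 = 0" by (simp add: nrm_def)
    thus False using u0(1) by (simp add: U_def)
  qed
  ultimately have "eigenvalue A k0"
    using A unfolding eigenvalue_def eigenvector_def by (intro exI[of _ v0]) (auto simp: v0_def)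
  hence "k \<le> k0" using ev by (simp add: smallest_eigenvalue_def)
  hence "k * nrm t \<le> k0 * nrm t" by (intro mult_right_mono) (auto simp: nrm_def sum_nonneg)
  also have "\<dots> \<le> bil t t" by (rule k0_le)
  finally show ?thesis by (simp add: nrm_def bil_def)
qed

lemma abs_le_linf_mat:
  assumes "A \<in> carrier_mat n p" "i < n" "j < p"
  shows "\<bar>A $$ (i, j)\<bar> \<le> linf_mat A"
proof -
  have "finite (elements_mat A)" by (simp add: elements_mat_def)
  moreover have "A $$ (i, j) \<in> elements_mat A" using assms by auto
  ultimately show ?thesis unfolding linf_mat_def by (intro Max_ge) auto
qed

lemma finite_set_vec: "finite (set\<^sub>v v)"
  by (simp add: vec_set_def)

lemma abs_le_linf_vec: "j < dim_vec v \<Longrightarrow> \<bar>v $ j\<bar> \<le> linf_vec v"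
  unfolding linf_vec_def using finite_set_vec[of v] by (intro Max_ge) (auto simp: vec_set_def)

lemma linf_vec_le: "0 \<le> B \<Longrightarrow> (\<And>j. j < dim_vec v \<Longrightarrow> \<bar>v $ j\<bar> \<le> B) \<Longrightarrow> linf_vec v \<le> B"
  unfolding linf_vec_def using finite_set_vec[of v] by (subst Max_le_iff) (auto simp: vec_set_def)

lemma linf_vec_nonneg: "0 \<le> linf_vec v"
  unfolding linf_vec_def using finite_set_vec[of v] by (intro Max_ge) auto

lemma bij_betw_pick:
  assumes "finite S"
  shows "bij_betw (pick S) {..<card S} S"
proof (rule bij_betw_imageI)
  show inj: "inj_on (pick S) {..<card S}"
  proof (rule inj_onI, rule ccontr)
    fix a b assume ab: "a \<in> {..<card S}" "b \<in> {..<card S}" "pick S a = pick S b" "a \<noteq> b"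
    hence "a < b \<or> b < a" by linarith
    thus False using pick_mono_le[of b S a] pick_mono_le[of a S b] ab
      by (metis lessThan_iff less_irrefl)
  qed
  have "pick S ` {..<card S} \<subseteq> S" by (intro image_subsetI pick_in_set_le) simp
  thus "pick S ` {..<card S} = S"
    using assms inj by (intro card_subset_eq) (auto simp: card_image)
qed

lemma submatrix_cols:
  assumes "X \<in> carrier_mat n p" "S \<subseteq> {..<p}"
  shows "submatrix X UNIV S \<in> carrier_mat n (card S)"
    "i < n \<Longrightarrow> a < card S \<Longrightarrow> submatrix X UNIV S $$ (i, a) = X $$ (i, pick S a)"
proof -
  have dims: "dim_row X = n" "dim_col X = p" using assms(1) by auto
  have S: "{j. j < dim_col X \<and> j \<in> S} = S" using assms(2) unfolding dims by blast
  have R: "{i. i < dim_row X \<and> i \<in> UNIV} = {..<n}" unfolding dims by blast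
  show "submatrix X UNIV S \<in> carrier_mat n (card S)"
    by (rule carrier_matI) (simp_all only: dim_submatrix S R card_lessThan)
  assume "i < n" "a < card S"
  hence "i < card {i. i < dim_row X \<and> i \<in> UNIV}" "a < card {j. j < dim_col X \<and> j \<in> S}"
    by (simp_all only: S R card_lessThan)
  from submatrix_index[OF this] show "submatrix X UNIV S $$ (i, a) = X $$ (i, pick S a)"
    by (simp only: pick_UNIV)
qed

text \<open>Connects the predicate \<open>invertible_mat\<close> with the elimination algorithm
  \<open>mat_inverse\<close>, which returns \<open>None\<close> on singular input; thus
  \<open>the\<close> is applied to a proper value.\<close>

lemma invertible_mat_inverse:
  fixes A :: "real mat"
  assumes A: "A \<in> carrier_mat s s" and inv: "invertible_mat A"
  shows "the (mat_inverse A) \<in> carrier_mat s s" "A * the (mat_inverse A) = 1\<^sub>m s"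
proof -
  obtain B where B: "A * B = 1\<^sub>m (dim_row A)" "B * A = 1\<^sub>m (dim_row B)"
    using inv by (auto simp: invertible_mat_def inverts_mat_def)
  have "dim_row B = s" using arg_cong[OF B(2), of dim_col] A by simp
  moreover have "dim_col B = s" using arg_cong[OF B(1), of dim_col] A by simp
  ultimately have "A \<in> Units (ring_mat TYPE(real) s ())"
    using A B by (auto simp: Units_def ring_mat_def intro!: bexI[of _ B])
  then obtain C where "mat_inverse A = Some C" using mat_inverse(1)[OF A, where b = "()"] by (cases "mat_inverse A") auto
  with mat_inverse(2)[OF A this] show "the (mat_inverse A) \<in> carrier_mat s s" "A * the (mat_inverse A) = 1\<^sub>m s" by auto
qed

text \<open>Apply the condition to \<open>v / V\<close> and rescale. The coefficients
  \<open>c\<close> solve the normal equations on \<open>S\<close> with right-hand side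
  \<open>v\<close>.\<close>

lemma irrepresentable_solution:
  assumes irr: "irrepresentable X S \<eta>0" and X: "X \<in> carrier_mat n p" and S: "S \<subseteq> {1..<p}"
    and V: "0 < V" and v: "\<And>j. j \<in> S \<Longrightarrow> \<bar>v j\<bar> \<le> V"
  shows "\<exists>c. (\<forall>j\<in>S. (\<Sum>i<n. X $$ (i, j) * (\<Sum>k\<in>S. X $$ (i, k) * c k)) = v j) \<and>
    (\<forall>j\<in>{1..<p} - S. \<bar>\<Sum>i<n. X $$ (i, j) * (\<Sum>k\<in>S. X $$ (i, k) * c k)\<bar> < \<eta>0 * V)"
proof -
  define s where "s = card S"
  define Oc where "Oc = {1..<p} - S"
  have fin: "finite S" "finite Oc" using S finite_subset by (auto simp: Oc_def)
  define XS where "XS = submatrix X UNIV S"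
  define XO where "XO = submatrix X UNIV Oc"
  define A where "A = transpose_mat XS * XS"
  define B where "B = the (mat_inverse A)"
  have SO: "S \<subseteq> {..<p}" "Oc \<subseteq> {..<p}" using S by (auto simp: Oc_def)
  note XS = submatrix_cols[OF X SO(1), folded XS_def s_def] and XO = submatrix_cols[OF X SO(2), folded XO_def]
  have A: "A \<in> carrier_mat s s" using XS by (simp add: A_def)
  have I: "invertible_mat A" "\<And>\<tau>. \<tau> \<in> carrier_vec s \<Longrightarrow> linf_vec \<tau> \<le> 1 \<Longrightarrow> linf_vec ((transpose_mat XO * XS * B) *\<^sub>v \<tau>) < \<eta>0"
    using irr X by (auto simp: irrepresentable_def cols_in_def cols_out_def Let_def XS_def XO_def A_def B_def Oc_def s_def)
  have B: "B \<in> carrier_mat s s" "A * B = 1\<^sub>m s"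
    using invertible_mat_inverse[OF A I(1)] by (simp_all add: B_def)
  define \<tau> where "\<tau> = vec s (\<lambda>a. v (pick S a) / V)"
  define w where "w = B *\<^sub>v \<tau>"
  have \<tau>: "\<tau> \<in> carrier_vec s" by (simp add: \<tau>_def)
  have w: "w \<in> carrier_vec s" unfolding w_def by (rule mult_mat_vec_carrier[OF B(1) \<tau>])
  have \<tau>1: "linf_vec \<tau> \<le> 1"
  proof (rule linf_vec_le)
    fix a assume "a < dim_vec \<tau>"
    hence "a < s" by (simp add: \<tau>_def)
    moreover from this have "\<bar>v (pick S a)\<bar> \<le> V" by (intro v pick_in_set_le) (simp add: s_def)
    ultimately show "\<bar>\<tau> $ a\<bar> \<le> 1" using V by (simp add: \<tau>_def)
  qed simp
  have idx: "card {a \<in> S. a < pick S b} = b" if "b < s" for b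
    using that by (intro card_pick_le) (simp add: s_def)
  \<comment> \<open>The number of elements of \<open>S\<close> below \<open>k\<close> inverts
    \<open>pick S\<close>, so matrix positions become column indices.\<close>
  define c where "c k = V * w $ (card {a \<in> S. a < k})" for k
  define y where "y = XS *\<^sub>v w"
  have y: "y \<in> carrier_vec n" using XS(1) w by (simp add: y_def)
  have yi: "(\<Sum>k\<in>S. X $$ (i, k) * c k) = V * y $ i" if i: "i < n" for i
  proof -
    have "(\<Sum>k\<in>S. X $$ (i, k) * c k) = (\<Sum>b<s. X $$ (i, pick S b) * c (pick S b))"
      using sum.reindex_bij_betw[OF bij_betw_pick[OF fin(1)], of "\<lambda>k. X $$ (i, k) * c k"] by (simp add: s_def)
    also have "\<dots> = (\<Sum>b<s. V * (XS $$ (i, b) * w $ b))"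
      using XS(2)[OF i] idx by (intro sum.cong) (auto simp: c_def)
    also have "\<dots> = V * y $ i"
      using mult_mat_vec_index_sum[OF XS(1) w i] by (simp add: y_def sum_distrib_left)
    finally show ?thesis .
  qed
  have XtS: "transpose_mat XS \<in> carrier_mat s n" and XtO: "transpose_mat XO \<in> carrier_mat (card Oc) n"
    using XS(1) XO(1) by auto
  have Sy: "transpose_mat XS *\<^sub>v y = \<tau>"
  proof -
    have "transpose_mat XS *\<^sub>v y = A *\<^sub>v w"
      unfolding y_def A_def by (rule assoc_mult_mat_vec[OF XtS XS(1) w, symmetric])
    also have "\<dots> = (A * B) *\<^sub>v \<tau>" unfolding w_def by (rule assoc_mult_mat_vec[OF A B(1) \<tau>, symmetric])
    finally show ?thesis using B \<tau> by simp
  qed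
  have Oy: "transpose_mat XO *\<^sub>v y = (transpose_mat XO * XS * B) *\<^sub>v \<tau>"
  proof -
    have "(transpose_mat XO * XS * B) *\<^sub>v \<tau> = (transpose_mat XO * XS) *\<^sub>v w"
      unfolding w_def using XtO XS(1) by (intro assoc_mult_mat_vec[OF _ B(1) \<tau>]) auto
    also have "\<dots> = transpose_mat XO *\<^sub>v y"
      unfolding y_def by (rule assoc_mult_mat_vec[OF XtO XS(1) w])
    finally show ?thesis ..
  qed
  have pS: "\<exists>b<s. pick S b = j" if "j \<in> S" for j
  proof -
    have "j \<in> pick S ` {..<s}"
      using bij_betw_imp_surj_on[OF bij_betw_pick[OF fin(1)]] that by (simp only: s_def)
    thus ?thesis by blast
  qed
  have pO: "\<exists>b<card Oc. pick Oc b = j" if "j \<in> Oc" for j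
  proof -
    have "j \<in> pick Oc ` {..<card Oc}"
      using bij_betw_imp_surj_on[OF bij_betw_pick[OF fin(2)]] that by (simp only:)
    thus ?thesis by blast
  qed
  have "(\<Sum>i<n. X $$ (i, j) * (\<Sum>k\<in>S. X $$ (i, k) * c k)) = v j" if j: "j \<in> S" for j
  proof -
    obtain b where b: "b < s" "pick S b = j" using pS[OF j] by blast
    have "(\<Sum>i<n. X $$ (i, j) * (\<Sum>k\<in>S. X $$ (i, k) * c k)) = (\<Sum>i<n. V * (transpose_mat XS $$ (b, i) * y $ i))"
      using yi XS b by (intro sum.cong) auto
    also have "\<dots> = V * (transpose_mat XS *\<^sub>v y) $ b"
      using mult_mat_vec_index_sum[OF XtS y b(1)] by (simp add: sum_distrib_left)
    also have "\<dots> = v j" unfolding Sy using b V by (simp add: \<tau>_def)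
    finally show ?thesis .
  qed
  moreover have "\<bar>\<Sum>i<n. X $$ (i, j) * (\<Sum>k\<in>S. X $$ (i, k) * c k)\<bar> < \<eta>0 * V" if j: "j \<in> Oc" for j
  proof -
    obtain b where b: "b < card Oc" "pick Oc b = j" using pO[OF j] by blast
    have "(\<Sum>i<n. X $$ (i, j) * (\<Sum>k\<in>S. X $$ (i, k) * c k)) = (\<Sum>i<n. V * (transpose_mat XO $$ (b, i) * y $ i))"
      using yi XO b by (intro sum.cong) auto
    also have "\<dots> = V * (transpose_mat XO *\<^sub>v y) $ b"
      using mult_mat_vec_index_sum[OF XtO y b(1)] by (simp add: sum_distrib_left)
    finally have "\<bar>\<Sum>i<n. X $$ (i, j) * (\<Sum>k\<in>S. X $$ (i, k) * c k)\<bar> = V * \<bar>(transpose_mat XO *\<^sub>v y) $ b\<bar>"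
      using V by (simp add: abs_mult)
    also have "\<bar>(transpose_mat XO *\<^sub>v y) $ b\<bar> \<le> linf_vec (transpose_mat XO *\<^sub>v y)"
      using XtO b by (intro abs_le_linf_vec) auto
    also have "\<dots> < \<eta>0" unfolding Oy by (rule I(2)[OF \<tau> \<tau>1])
    finally show ?thesis using V by (simp add: mult.commute)
  qed
  ultimately show ?thesis unfolding Oc_def by blast
qed

subsection \<open>Exp-Lasso minimizers for the linear model\<close>

lemma (in convex_noise) expected_incr:
  assumes "\<bar>\<Sum>k<p. x k * t k\<bar> + \<bar>t p\<bar> \<le> M0" "j \<le> p"
  shows "(\<integral>u. incr p x j u t \<partial>N) =
    (if j < p then x j * (hc (\<Sum>k<p. x k * t k) (t p) - hc 0 0) else hd (\<Sum>k<p. x k * t k) (t p) - hd 0 0)"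
proof -
  define c \<tau> where "c = (\<Sum>k<p. x k * t k)" and "\<tau> = t p"
  have ct: "\<bar>c\<bar> + \<bar>\<tau>\<bar> \<le> M0" using assms(1) by (simp add: c_def \<tau>_def)
  have lin: "lin p x u t = \<tau> * u - c" for u by (simp add: lin_eq c_def \<tau>_def mult.commute)
  note i = h_perturbed_int[OF ct] ht_perturbed_int[OF ct] h_int ht_int
  show ?thesis
  proof (cases "j < p")
    case True
    have "(\<integral>u. incr p x j u t \<partial>N) = (\<integral>u. (h (u + (\<tau> * u - c)) - h u) * (- x j) \<partial>N)"
      using True by (simp add: incr_def lin feat_def)
    also have "\<dots> = (\<integral>u. h (u + (\<tau> * u - c)) - h u \<partial>N) * (- x j)" by (rule integral_mult_left_zero)
    also have "\<dots> = x j * (hc c \<tau> - hc 0 0)" using i by (simp add: hc_def algebra_simps)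
    finally show ?thesis using True by (simp add: c_def \<tau>_def)
  next
    case False
    hence "(\<integral>u. incr p x j u t \<partial>N) = (\<integral>u. h (u + (\<tau> * u - c)) * u - h u * u \<partial>N)"
      by (simp add: incr_def lin feat_def left_diff_distrib)
    also have "\<dots> = hd c \<tau> - hd 0 0" using i by (simp add: hd_def)
    finally show ?thesis using False by (simp add: c_def \<tau>_def)
  qed
qed

locale lasso_matrix_sample =
  lasso_sample "nll f" "deriv (nll f)" n p "\<lambda>i k. X $$ (i, k)" e "\<lambda>k. \<beta> $ k" lam
  for f :: "real \<Rightarrow> real" and n p :: nat and X :: "real mat" and e :: "nat \<Rightarrow> real"
    and \<beta> :: "real vec" and lam :: real +
  assumes X: "X \<in> carrier_mat n p" and \<beta>: "\<beta> \<in> carrier_vec p"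
begin

definition reparam :: "real vec \<Rightarrow> real \<Rightarrow> nat \<Rightarrow> real" where
  "reparam b \<sigma> k = (if k < p then (b $ k - \<beta> $ k) / \<sigma> else if k = p then 1 / \<sigma> - 1 else 0)"

lemma S_eq: "S = active_set \<beta>"
  using \<beta> by (auto simp: S_def active_set_def)

lemma reparam_admissible: "0 < \<sigma> \<Longrightarrow> reparam b \<sigma> \<in> admissible"
  by (simp add: admissible_def reparam_def)

lemma objective_reparam:
  assumes b: "b \<in> carrier_vec p" and \<sigma>: "0 < \<sigma>"
  shows "exp_lasso_objective f X (response X \<beta> 1 e) lam (b, \<sigma>) = obj (reparam b \<sigma>)"
proof -
  define t where "t = reparam b \<sigma>"
  have tp: "1 + t p = 1 / \<sigma>" by (simp add: t_def reparam_def)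
  have dims: "dim_row X = n" "dim_col X = p" using X by auto
  have res: "(response X \<beta> 1 e $ i - (X *\<^sub>v b) $ i) / \<sigma> = e i + lin p (\<lambda>k. X $$ (i, k)) (e i) t"
    if i: "i < n" for i
  proof -
    have "response X \<beta> 1 e $ i = (\<Sum>k<p. X $$ (i, k) * \<beta> $ k) + e i"
      using i mult_mat_vec_index_sum[OF X \<beta> i] by (simp add: response_def dims del: index_mult_mat_vec)
    moreover have "(X *\<^sub>v b) $ i = (\<Sum>k<p. X $$ (i, k) * b $ k)" by (rule mult_mat_vec_index_sum[OF X b i])
    moreover have "(\<Sum>k<p. X $$ (i, k) * t k) = ((\<Sum>k<p. X $$ (i, k) * b $ k) - (\<Sum>k<p. X $$ (i, k) * \<beta> $ k)) / \<sigma>"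
      by (simp add: t_def reparam_def right_diff_distrib diff_divide_distrib sum_subtractf sum_divide_distrib)
    ultimately show ?thesis using \<sigma> by (simp add: lin_eq t_def reparam_def field_simps)
  qed
  have "emp_risk f X (response X \<beta> 1 e) b \<sigma> = (\<Sum>i<n. nll f (e i + lin p (\<lambda>k. X $$ (i, k)) (e i) t) + ln \<sigma>) / n"
    unfolding emp_risk_def dims using res by simp
  also have "\<dots> = risk t + ln \<sigma>"
    using n_pos by (simp add: risk_def sum.distrib add_divide_distrib)
  finally have 1: "exp (emp_risk f X (response X \<beta> 1 e) b \<sigma>) = exp (risk t) * \<sigma>"
    using \<sigma> by (simp add: exp_add)
  have 2: "(\<Sum>j\<in>{1..<p}. \<bar>b $ j\<bar>) = pen t * \<sigma>"
    unfolding pen_def tp sum_distrib_right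
  proof (rule sum.cong[OF refl])
    fix j assume "j \<in> {1..<p}"
    hence "1 / \<sigma> * \<beta> $ j + t j = b $ j / \<sigma>" by (simp add: t_def reparam_def diff_divide_distrib)
    thus "\<bar>b $ j\<bar> = \<bar>1 / \<sigma> * \<beta> $ j + t j\<bar> * \<sigma>" using \<sigma> by simp
  qed
  show ?thesis
    unfolding exp_lasso_objective_def obj_def t_def[symmetric] tp using 1 2 by (simp add: dims algebra_simps)
qed

lemma reparam_surj:
  assumes "t \<in> admissible"
  obtains b \<sigma> where "b \<in> carrier_vec p" "0 < \<sigma>" "t = reparam b \<sigma>"
proof
  define \<sigma> where "\<sigma> = 1 / (1 + t p)"
  show \<sigma>: "0 < 1 / (1 + t p)" using assms by (simp add: admissible_def)
  show "vec p (\<lambda>k. \<beta> $ k + \<sigma> * t k) \<in> carrier_vec p" by simp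
  show "t = reparam (vec p (\<lambda>k. \<beta> $ k + \<sigma> * t k)) (1 / (1 + t p))"
    using assms \<sigma> by (auto simp: reparam_def fun_eq_iff admissible_def \<sigma>_def)
qed

lemma minimizer_iff:
  "exp_lasso_minimizer f X (response X \<beta> 1 e) lam (b, \<sigma>) \<longleftrightarrow>
    b \<in> carrier_vec p \<and> 0 < \<sigma> \<and> (\<forall>t'\<in>admissible. obj (reparam b \<sigma>) \<le> obj t')"
proof -
  have dims: "dim_col X = p" using X by auto
  have "(\<forall>b' \<sigma>'. b' \<in> carrier_vec p \<and> 0 < \<sigma>' \<longrightarrow> obj (reparam b \<sigma>) \<le> obj (reparam b' \<sigma>')) \<longleftrightarrow>
      (\<forall>t'\<in>admissible. obj (reparam b \<sigma>) \<le> obj t')"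
    using reparam_admissible reparam_surj by metis
  moreover have "exp_lasso_minimizer f X (response X \<beta> 1 e) lam (b, \<sigma>) \<longleftrightarrow>
    b \<in> carrier_vec p \<and> 0 < \<sigma> \<and>
    (\<forall>b' \<sigma>'. b' \<in> carrier_vec p \<and> 0 < \<sigma>' \<longrightarrow> obj (reparam b \<sigma>) \<le> obj (reparam b' \<sigma>'))"
    unfolding exp_lasso_minimizer_def is_arg_min_def dims
    by (auto simp: objective_reparam not_less) (metis objective_reparam not_less)+
  ultimately show ?thesis by blast
qed

text \<open>The estimator is a minimizer only if one exists, so existence has to be established on
  the good event before anything can be said about it.\<close>

lemma minimizer_zero_outside:
  assumes opt: "\<exists>t\<in>admissible. \<forall>t'\<in>admissible. obj t \<le> obj t'"
    and zero: "\<And>t j. t \<in> admissible \<Longrightarrow> (\<And>t'. t' \<in> admissible \<Longrightarrow> obj t \<le> obj t') \<Longrightarrow> j \<in> {1..<p} - S \<Longrightarrow> t j = 0"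
    and min: "\<exists>z. exp_lasso_minimizer f X (response X \<beta> 1 e) lam z \<Longrightarrow>
      exp_lasso_minimizer f X (response X \<beta> 1 e) lam (\<beta>h, \<sigma>h)"
    and j: "j \<in> {1..<p} - active_set \<beta>"
  shows "\<beta>h $ j = 0"
proof -
  obtain t where t: "t \<in> admissible" "\<forall>t'\<in>admissible. obj t \<le> obj t'" using opt by blast
  obtain b \<sigma> where "b \<in> carrier_vec p" "0 < \<sigma>" "t = reparam b \<sigma>" using reparam_surj[OF t(1)] .
  hence "exp_lasso_minimizer f X (response X \<beta> 1 e) lam (b, \<sigma>)" using t(2) by (simp add: minimizer_iff)
  hence "exp_lasso_minimizer f X (response X \<beta> 1 e) lam (\<beta>h, \<sigma>h)" using min by blast
  hence m: "\<beta>h \<in> carrier_vec p" "0 < \<sigma>h" "\<forall>t'\<in>admissible. obj (reparam \<beta>h \<sigma>h) \<le> obj t'"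
    by (simp_all add: minimizer_iff)
  have "reparam \<beta>h \<sigma>h j = 0"
    using zero[OF reparam_admissible[OF m(2)]] m(3) j S_eq by simp
  moreover have "\<beta> $ j = 0" "j < p" using j \<beta> by (auto simp: active_set_def)
  ultimately show ?thesis using m(2) by (simp add: reparam_def)
qed

text \<open>The error matrix contributes at most its largest entry times the squared
  \<open>l1\<close> norm; the remaining form is bounded below by the smallest eigenvalue.\<close>

lemma vX_ge:
  assumes Sg: "Sg \<in> carrier_mat p p" "transpose_mat Sg = Sg" "smallest_eigenvalue Sg k"
  shows "k * (\<Sum>j<p. (t j)\<^sup>2) - linf_mat (sample_cov X - Sg) * (\<Sum>j<p. \<bar>t j\<bar>)\<^sup>2 \<le> vX t"
proof -
  define D where "D = sample_cov X - Sg"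
  have Xt: "transpose_mat X \<in> carrier_mat p n" using X by simp
  have scd: "sample_cov X \<in> carrier_mat p p" using X by (auto simp: sample_cov_def)
  have D: "D \<in> carrier_mat p p" unfolding D_def by (rule minus_carrier_mat[OF Sg(1)])
  have sc: "sample_cov X $$ (j, k) = (\<Sum>i<n. X $$ (i, j) * X $$ (i, k)) / n" if "j < p" "k < p" for j k
    using that X by (auto simp: sample_cov_def scalar_prod_def lessThan_atLeast0 intro!: sum.cong)
  have Dij: "D $$ (j, k) = sample_cov X $$ (j, k) - Sg $$ (j, k)" if "j < p" "k < p" for j k
    unfolding D_def using that Sg(1) scd by (intro index_minus_mat) auto
  have "vX t = (\<Sum>j<p. \<Sum>k<p. sample_cov X $$ (j, k) * t j * t k)"
  proof -
    have "(\<Sum>i<n. (xt i t)\<^sup>2) = (\<Sum>i<n. \<Sum>j<p. \<Sum>k<p. X $$ (i, j) * X $$ (i, k) * (t j * t k))"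
      unfolding xt_def power2_eq_square sum_product by (intro sum.cong refl) simp
    also have "\<dots> = (\<Sum>j<p. \<Sum>i<n. \<Sum>k<p. X $$ (i, j) * X $$ (i, k) * (t j * t k))"
      by (rule sum.swap)
    also have "\<dots> = (\<Sum>j<p. \<Sum>k<p. \<Sum>i<n. X $$ (i, j) * X $$ (i, k) * (t j * t k))"
      by (rule sum.cong[OF refl], rule sum.swap)
    finally have "vX t = (\<Sum>j<p. \<Sum>k<p. (\<Sum>i<n. X $$ (i, j) * X $$ (i, k)) / n * (t j * t k))"
      by (simp add: vX_def sum_divide_distrib sum_distrib_right)
    also have "\<dots> = (\<Sum>j<p. \<Sum>k<p. sample_cov X $$ (j, k) * t j * t k)"
      by (intro sum.cong refl) (simp add: sc)
    finally show ?thesis .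
  qed
  also have "\<dots> = (\<Sum>j<p. \<Sum>k<p. Sg $$ (j, k) * t j * t k) + (\<Sum>j<p. \<Sum>k<p. D $$ (j, k) * t j * t k)"
    unfolding sum.distrib[symmetric] by (intro sum.cong refl) (simp add: Dij algebra_simps)
  finally have eq: "vX t = (\<Sum>j<p. \<Sum>k<p. Sg $$ (j, k) * t j * t k) + (\<Sum>j<p. \<Sum>k<p. D $$ (j, k) * t j * t k)" .
  have "\<bar>\<Sum>j<p. \<Sum>k<p. D $$ (j, k) * t j * t k\<bar> \<le> (\<Sum>j<p. \<Sum>k<p. \<bar>D $$ (j, k) * t j * t k\<bar>)"
    by (rule order_trans[OF sum_abs]) (intro sum_mono sum_abs)
  also have "\<dots> \<le> (\<Sum>j<p. \<Sum>k<p. linf_mat D * (\<bar>t j\<bar> * \<bar>t k\<bar>))"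
  proof (intro sum_mono)
    fix j k assume "j \<in> {..<p}" "k \<in> {..<p}"
    hence "\<bar>D $$ (j, k)\<bar> \<le> linf_mat D" by (intro abs_le_linf_mat[OF D]) auto
    hence "\<bar>D $$ (j, k)\<bar> * (\<bar>t j\<bar> * \<bar>t k\<bar>) \<le> linf_mat D * (\<bar>t j\<bar> * \<bar>t k\<bar>)" by (intro mult_right_mono) auto
    thus "\<bar>D $$ (j, k) * t j * t k\<bar> \<le> linf_mat D * (\<bar>t j\<bar> * \<bar>t k\<bar>)" by (simp add: abs_mult mult_ac)
  qed
  also have "\<dots> = linf_mat D * (\<Sum>j<p. \<bar>t j\<bar>)\<^sup>2"
    unfolding power2_eq_square sum_product by (simp only: sum_distrib_left)
  finally have "\<bar>\<Sum>j<p. \<Sum>k<p. D $$ (j, k) * t j * t k\<bar> \<le> linf_mat D * (\<Sum>j<p. \<bar>t j\<bar>)\<^sup>2" .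
  moreover have "k * (\<Sum>j<p. (t j)\<^sup>2) \<le> (\<Sum>j<p. \<Sum>k<p. Sg $$ (j, k) * t j * t k)"
    by (rule symmetric_quadratic_form_ge[OF Sg])
  ultimately show ?thesis unfolding eq D_def by linarith
qed

text \<open>The factor \<open>e0\<close> in the stationarity conditions is exactly the exponential
  factor of \<open>lambda_star\<close>; this makes the quantile free of the unknown
  parameters.\<close>

lemma score_le_lambda_star:
  assumes "j < p"
  shows "e0 * \<bar>grad (\<lambda>_. 0) j\<bar> \<le> lambda_star f X e"
proof -
  have dims: "dim_row X = n" "dim_col X = p" using X by auto
  define F where "F = vec p (\<lambda>j. 1 / n * (\<Sum>i<n. deriv (nll f) (e i) * X $$ (i, j)))"
  have "\<bar>grad (\<lambda>_. 0) j\<bar> = \<bar>F $ j\<bar>"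
    using assms by (simp add: grad_def F_def feat_def sum_negf)
  also have "\<dots> \<le> linf_vec F" using assms by (intro abs_le_linf_vec) (simp add: F_def)
  finally have "e0 * \<bar>grad (\<lambda>_. 0) j\<bar> \<le> e0 * linf_vec F" by (intro mult_left_mono) (simp_all add: e0_def)
  also have "\<dots> = lambda_star f X e"
    by (simp add: lambda_star_def dims F_def e0_def risk_def nll_def sum_negf mult.commute)
  finally show ?thesis .
qed

lemma e0_eq: "e0 = exp ((\<Sum>i<n. nll f (e i)) / n)"
  by (simp add: e0_def risk_def)

lemma grad_zero_p: "grad (\<lambda>_. 0) p = (\<Sum>i<n. deriv (nll f) (e i) * e i) / n"
  by (simp add: grad_def feat_def)

end

lemma lambda_star_nonneg: "0 \<le> lambda_star f X e"
  unfolding lambda_star_def by (intro mult_nonneg_nonneg linf_vec_nonneg) simp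

lemma borel_measurable_lambda_star:
  assumes "\<And>i. \<xi> i \<in> borel_measurable M" "deriv (nll f) \<in> borel_measurable borel" "f \<in> borel_measurable borel"
  shows "(\<lambda>\<omega>. lambda_star f X (\<lambda>i. \<xi> i \<omega>)) \<in> borel_measurable M"
proof -
  note [measurable] = assms
  \<comment> \<open>Writes the maximum over a set of values as a maximum over the fixed indices
    \<open>{..p}\<close>; index \<open>p\<close> supplies the inserted 0.\<close>
  have eq: "linf_vec (vec p F) = Max ((\<lambda>j. if j < p then \<bar>F j\<bar> else 0) ` {..p})" for p and F :: "nat \<Rightarrow> real"
  proof -
    have "insert 0 (abs ` set\<^sub>v (vec p F)) = (\<lambda>j. if j < p then \<bar>F j\<bar> else 0) ` {..p}"
      by (force simp: vec_set_def image_iff)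
    thus ?thesis by (simp add: linf_vec_def)
  qed
  show ?thesis
    unfolding lambda_star_def eq by measurable
qed

subsection \<open>Variable selection\<close>

lemma irrepresentable_threshold:
  fixes \<eta> R c1 :: real
  assumes \<eta>: "0 < \<eta>" "\<eta> < 1" and R: "0 < R" "R < 1" and c1: "0 < c1" "c1 \<le> 1 - \<eta>"
  shows "(1 - \<eta> + c1 * R * \<eta>) + \<eta> * (1 - R) / (2 - \<eta> * (1 + R)) * (2 - \<eta> + c1 * R * \<eta>) \<le> 1"
proof -
  have "\<eta> * (1 + R) \<le> 1 + R" using \<eta> R by (simp add: mult_left_le_one_le)
  moreover have "1 + R < 2" using R by simp
  ultimately have d: "0 < 2 - \<eta> * (1 + R)" by (metis diff_gt_0_iff_gt order_le_less_trans)
  \<comment> \<open>This product is the difference of the two sides of the next inequality. Its sign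
    is where \<open>c1 \<le> 1 - \<eta>\<close> enters.\<close>
  have "0 \<le> 2 * R * (1 - \<eta> - c1 + c1 * \<eta> * R)" using \<eta> R c1 by (intro mult_nonneg_nonneg) auto
  hence "(1 - R) * (2 - \<eta> + c1 * R * \<eta>) \<le> (1 - c1 * R) * (2 - \<eta> * (1 + R))"
    by (simp add: algebra_simps)
  hence "\<eta> * ((1 - R) * (2 - \<eta> + c1 * R * \<eta>)) \<le> \<eta> * ((1 - c1 * R) * (2 - \<eta> * (1 + R)))"
    using \<eta> by (intro mult_left_mono) auto
  hence "\<eta> * (1 - R) / (2 - \<eta> * (1 + R)) * (2 - \<eta> + c1 * R * \<eta>) \<le> \<eta> * (1 - c1 * R)"
    using d by (simp add: field_simps)
  thus ?thesis by (simp add: algebra_simps)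
qed

theorem theorem4p1:
  fixes M :: "'a measure" and \<xi> :: "nat \<Rightarrow> 'a \<Rightarrow> real"
    and f G :: "real \<Rightarrow> real"
    and p :: "nat \<Rightarrow> nat" and X Sig :: "nat \<Rightarrow> real mat" and \<beta>s :: "nat \<Rightarrow> real vec"
    and Kx smax \<alpha> \<eta> lam :: "nat \<Rightarrow> real" and \<Lambda>x LH :: real
    and \<beta>h :: "nat \<Rightarrow> 'a \<Rightarrow> real vec" and \<sigma>h :: "nat \<Rightarrow> 'a \<Rightarrow> real"
  defines "S \<equiv> \<lambda>n. active_set (\<beta>s n)"
    and "s \<equiv> \<lambda>n. real (card (active_set (\<beta>s n)))"
    and "rt \<equiv> \<lambda>n. sqrt (ln (real (p n)) / real n)"
    and "q \<equiv> \<lambda>n. quantile M (\<lambda>\<omega>. lambda_star f (X n) (\<lambda>i. \<xi> i \<omega>)) (1 - \<alpha> n)"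
    and "y \<equiv> \<lambda>n \<omega>. response (X n) (\<beta>s n) 1 (\<lambda>i. \<xi> i \<omega>)"
  assumes prob: "prob_space M"
    and X_dim: "\<And>n. n \<ge> 1 \<Longrightarrow> X n \<in> carrier_mat n (p n)"
    and X_intercept: "\<And>n i. n \<ge> 1 \<Longrightarrow> i < n \<Longrightarrow> X n $$ (i, 0) = 1"
    and \<beta>s_dim: "\<And>n. n \<ge> 1 \<Longrightarrow> \<beta>s n \<in> carrier_vec (p n)"
    and s_ge: "\<And>n. n \<ge> 1 \<Longrightarrow> s n \<ge> 1"
    \<comment> \<open>the estimator: random vectors that minimize the objective whenever a minimizer exists\<close>
    and \<beta>h_rv: "\<And>n j. n \<ge> 1 \<Longrightarrow> j < p n \<Longrightarrow> (\<lambda>\<omega>. \<beta>h n \<omega> $ j) \<in> borel_measurable M"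
    and \<beta>h_min: "\<And>n \<omega>. n \<ge> 1 \<Longrightarrow> \<omega> \<in> space M \<Longrightarrow>
          \<exists>z. exp_lasso_minimizer f (X n) (y n \<omega>) (lam n) z \<Longrightarrow>
          exp_lasso_minimizer f (X n) (y n \<omega>) (lam n) (\<beta>h n \<omega>, \<sigma>h n \<omega>)"
    \<comment> \<open>(1)\<close>
    and noise_indep: "prob_space.indep_vars M (\<lambda>_. borel) \<xi> UNIV"
    and noise_density: "\<And>i. distributed M lborel (\<xi> i) (\<lambda>t. ennreal (f t))"
    and f_pos: "\<And>t. f t > 0"
    and l_convex: "convex_on UNIV (nll f)"
    and l_diff: "\<And>t. nll f differentiable (at t)"
    and l_int: "integrable (noise_law f) (nll f)"
    and ld_int: "integrable (noise_law f) (\<lambda>t. (deriv (nll f) t)\<^sup>2)"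
    and ldx_int: "integrable (noise_law f) (\<lambda>t. (deriv (nll f) t * t)\<^sup>2)"
    \<comment> \<open>(2)\<close>
    and Kx_ge: "\<And>n. n \<ge> 1 \<Longrightarrow> Kx n \<ge> 1"
    and X_bound: "\<And>n i j. n \<ge> 1 \<Longrightarrow> i < n \<Longrightarrow> j < p n \<Longrightarrow> \<bar>X n $$ (i, j)\<bar> \<le> Kx n"
    \<comment> \<open>(3)\<close>
    and G_pos: "\<And>t. G t > 0"
    and G_int: "integrable (noise_law f) (\<lambda>t. (G t)\<^sup>2)"
    and Gx_int: "integrable (noise_law f) (\<lambda>t. (G t)\<^sup>2 * t ^ 4)"
    and G_lip: "\<And>n. n \<ge> 1 \<Longrightarrow> \<exists>M0>0. \<forall>m. 0 < m \<and> m \<le> M0 \<longrightarrow>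
          (AE t in noise_law f. \<forall>u v. max \<bar>u\<bar> \<bar>v\<bar> \<le> (Kx n + \<bar>t\<bar>) * m \<longrightarrow>
             \<bar>deriv (nll f) (t + u) - deriv (nll f) (t + v)\<bar> \<le> G t * \<bar>u - v\<bar>)"
    \<comment> \<open>(4)\<close>
    and H_hessian: "\<exists>\<delta>>0. (\<forall>z. dist01 z < \<delta> \<longrightarrow> (\<exists>A. has_hessian (Hfun f) A z)) \<and>
          continuous_on {z. dist01 z < \<delta>} (hessian (Hfun f))"
    and H_posdef: "positive_definite (hessian (Hfun f) (vector [0, 1]))"
    and H_lip: "\<exists>\<delta>>0. \<forall>z. dist01 z < \<delta> \<longrightarrow>
          linf_mat2 (hessian (Hcal f) z - hessian (Hcal f) (vector [0, 1])) \<le> LH * dist01 z"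
    \<comment> \<open>(5)\<close>
    and p_lim: "filterlim p at_top sequentially"
    and logp_lim: "(\<lambda>n. ln (real (p n)) / real n) \<longlonglongrightarrow> 0"
    \<comment> \<open>(6)\<close>
    and Sig_dim: "\<And>n. n \<ge> 1 \<Longrightarrow> Sig n \<in> carrier_mat (p n) (p n)"
    and Sig_sym: "\<And>n. n \<ge> 1 \<Longrightarrow> transpose_mat (Sig n) = Sig n"
    and \<Lambda>x_pos: "\<Lambda>x > 0"
    and Sig_eig: "\<And>n. n \<ge> 1 \<Longrightarrow> smallest_eigenvalue (Sig n) (\<Lambda>x\<^sup>2)"
    and Sig_approx: "(\<lambda>n. linf_mat (sample_cov (X n) - Sig n)) \<in> O(\<lambda>n. (Kx n)\<^sup>2 * rt n)"
    \<comment> \<open>(7)\<close>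
    and \<alpha>: "(\<exists>a. 0 < a \<and> a < 1/2 \<and> (\<forall>n\<ge>1. \<alpha> n = a)) \<or> (\<forall>n\<ge>1. \<alpha> n = 1 / real (p n))"
    and q_rate: "q \<in> \<Theta>(rt)"
    \<comment> \<open>(8)\<close>
    and smax_ge: "\<And>n. n \<ge> 1 \<Longrightarrow> smax n \<ge> 1"
    and s_le: "\<And>n. n \<ge> 1 \<Longrightarrow> s n \<le> smax n"
    and smax_rate: "smax \<in> o(\<lambda>n. \<Lambda>x\<^sup>2 * sqrt (real n / ln (real (p n))) / (Kx n)\<^sup>2)"
    \<comment> \<open>(9)\<close>
    and X_centered: "\<And>n j. n \<ge> 1 \<Longrightarrow> 1 \<le> j \<Longrightarrow> j < p n \<Longrightarrow> (\<Sum>i<n. X n $$ (i, j)) = 0"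
    \<comment> \<open>(10)\<close>
    and \<eta>_range: "\<And>n. n \<ge> 1 \<Longrightarrow> 0 < \<eta> n \<and> \<eta> n < 1"
    and \<eta>_away: "(\<lambda>_. 1) \<in> O(\<lambda>n. 1 - \<eta> n)"
    and \<eta>_rate: "(\<lambda>n. smax n * rt n * (Kx n)\<^sup>2 / \<Lambda>x\<^sup>2) \<in> o(\<lambda>n. (\<eta> n)\<^sup>2)"
    and lam_rate: "lam \<in> \<Theta>(rt)"
    and lam_ge: "\<And>n. n \<ge> 1 \<Longrightarrow> lam n \<ge> q n / (1 - \<eta> n)"
  shows "\<exists>r :: nat \<Rightarrow> real. (\<forall>n. r n > 0) \<and>
     r \<in> O(\<lambda>n. (Kx n)\<^sup>2 * lam n * s n / (\<eta> n)\<^sup>2) \<and>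
     (\<lambda>n. (Kx n)\<^sup>2 * lam n * s n / (\<eta> n)\<^sup>2) \<in> o(\<lambda>_. 1) \<and>
     ((\<forall>\<^sub>F n in sequentially.
         irrepresentable (X n) (S n) (\<eta> n * (1 - r n) / (2 - \<eta> n * (1 + r n)))) \<longrightarrow>
      (\<exists>e. e \<longlonglongrightarrow> 0 \<and> (\<forall>n\<ge>1.
         measure M {\<omega> \<in> space M. \<forall>j\<in>{1..<p n} - S n. \<beta>h n \<omega> $ j = 0} \<ge> 1 - \<alpha> n + e n)))"
proof -
  interpret prob_space M by (rule prob)
  have p2: "2 \<le> p n" if "n \<ge> 1" for n
  proof -
    have "active_set (\<beta>s n) \<noteq> {}" using s_ge[OF that] by (auto simp: s_def)
    thus ?thesis using \<beta>s_dim[OF that] by (auto simp: active_set_def)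
  qed
  have xi_meas: "\<xi> i \<in> borel_measurable M" for i
    using noise_indep by (auto simp: indep_vars_def)
  have law: "distr M borel (\<xi> i) = noise_law f" for i
  proof -
    have "distr M borel (\<xi> i) = distr M lborel (\<xi> i)" by (rule distr_cong) auto
    thus ?thesis using distributed_distr_eq_density[OF noise_density[of i]] by (simp add: noise_law_def)
  qed
  have prob_noise: "prob_space (noise_law f)"
    using prob_space_distr[OF xi_meas, of 0] law by simp
  \<comment> \<open>One \<open>M0\<close> must serve all \<open>n\<close>. The condition for
    \<open>n = 1\<close> provides it, as the range with 1 in place of \<open>Kx 1\<close> is
    smaller.\<close>
  obtain M0 where M0: "0 < M0" "AE t in noise_law f. \<forall>u v. max \<bar>u\<bar> \<bar>v\<bar> \<le> (1 + \<bar>t\<bar>) * M0 \<longrightarrow>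
             \<bar>deriv (nll f) (t + u) - deriv (nll f) (t + v)\<bar> \<le> G t * \<bar>u - v\<bar>"
  proof -
    obtain M0 where M0: "0 < M0" "\<forall>m. 0 < m \<and> m \<le> M0 \<longrightarrow>
          (AE t in noise_law f. \<forall>u v. max \<bar>u\<bar> \<bar>v\<bar> \<le> (Kx 1 + \<bar>t\<bar>) * m \<longrightarrow>
             \<bar>deriv (nll f) (t + u) - deriv (nll f) (t + v)\<bar> \<le> G t * \<bar>u - v\<bar>)"
      using G_lip[of 1] by auto
    have K1: "(1 + \<bar>t\<bar>) * M0 \<le> (Kx 1 + \<bar>t\<bar>) * M0" for t
      using Kx_ge[of 1] M0(1) by (intro mult_right_mono) auto
    have "AE t in noise_law f. \<forall>u v. max \<bar>u\<bar> \<bar>v\<bar> \<le> (Kx 1 + \<bar>t\<bar>) * M0 \<longrightarrow>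
             \<bar>deriv (nll f) (t + u) - deriv (nll f) (t + v)\<bar> \<le> G t * \<bar>u - v\<bar>"
      using M0 by auto
    hence "AE t in noise_law f. \<forall>u v. max \<bar>u\<bar> \<bar>v\<bar> \<le> (1 + \<bar>t\<bar>) * M0 \<longrightarrow>
             \<bar>deriv (nll f) (t + u) - deriv (nll f) (t + v)\<bar> \<le> G t * \<bar>u - v\<bar>"
    proof eventually_elim
      case (elim t)
      thus ?case using K1[of t] by (meson order_trans)
    qed
    with M0(1) show ?thesis using that by blast
  qed
  interpret smooth: smooth_noise f G M0 LH
    by (intro smooth_noise.intro convex_noise.intro smooth_noise_axioms.intro)
      (fact prob_noise f_pos l_convex l_diff l_int ld_int ldx_int G_pos G_int Gx_int M0 H_hessian H_posdef H_lip)+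
  interpret iid: iid_sequence M \<xi> "noise_law f"
    by unfold_locales (use noise_indep law in auto)

  \<comment> \<open>Constants and rates\<close>
  obtain h11 h12 h22 a Lc \<rho> where a: "0 < a" "0 < h11" "0 \<le> Lc" "0 < \<rho>" "\<rho> < M0"
    and quad: "\<And>c \<tau>. a * (c\<^sup>2 + \<tau>\<^sup>2) \<le> h11 * c\<^sup>2 + 2 * h12 * c * \<tau> + h22 * \<tau>\<^sup>2"
    and hc: "\<And>c \<tau>. \<bar>c\<bar> + \<bar>\<tau>\<bar> \<le> \<rho> \<Longrightarrow> \<bar>smooth.hc c \<tau> - smooth.hc 0 0 - (h11 * c + h12 * \<tau>)\<bar> \<le> Lc * (\<bar>c\<bar> + \<bar>\<tau>\<bar>)\<^sup>2"
    and hd: "\<And>c \<tau>. \<bar>c\<bar> + \<bar>\<tau>\<bar> \<le> \<rho> \<Longrightarrow> \<bar>smooth.hd c \<tau> - smooth.hd 0 0 - (h12 * c + h22 * \<tau>)\<bar> \<le> Lc * (\<bar>c\<bar> + \<bar>\<tau>\<bar>)\<^sup>2"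
    by (rule smooth.gradient_expansion, rule that)
  define El where "El = (\<integral>t. nll f t \<partial>noise_law f)"
  \<comment> \<open>With \<open>n * (rt n)^2 = ln p\<close> the exponential factor becomes
    \<open>p\<close> to the power -3, which beats the union bound of order
    \<open>p^2\<close>.\<close>
  define c0 where "c0 = smooth.v + 3"
  define Cd where "Cd = 2 * c0 + 1 + smooth.v"
  have Cd: "0 \<le> Cd" using smooth.v_nonneg by (simp add: Cd_def c0_def)
  have rt_sq: "n * (rt n)\<^sup>2 = ln (p n)" if "n \<ge> 1" for n
    using that p2[OF that] by (simp add: rt_def)
  have rt_pos: "0 < rt n" if "n \<ge> 1" for n
    using that p2[OF that] by (simp add: rt_def)
  have rt_lim: "rt \<longlonglongrightarrow> 0"
    unfolding rt_def using tendsto_real_sqrt[OF logp_lim] by simp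
  have rt_ev: "eventually (\<lambda>n. 0 < rt n) sequentially"
    using eventually_ge_at_top[of 1] by eventually_elim (rule rt_pos)
  have rt1_ev: "eventually (\<lambda>n. rt n < 1) sequentially"
    by (rule order_tendstoD(2)[OF rt_lim]) simp
  have \<alpha>01: "0 < \<alpha> n \<and> \<alpha> n < 1" if "n \<ge> 1" for n
    using \<alpha> that p2[OF that] by (fastforce simp: field_simps)
  have ls_meas: "(\<lambda>\<omega>. lambda_star f (X n) (\<lambda>i. \<xi> i \<omega>)) \<in> borel_measurable M" for n
    by (rule borel_measurable_lambda_star[OF xi_meas smooth.h_meas smooth.f_meas])
  have q_nonneg: "0 \<le> q n" if "n \<ge> 1" for n
    unfolding q_def using \<alpha>01[OF that] lambda_star_nonneg by (intro quantile_nonneg ls_meas) auto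
  have E1: "1 - \<alpha> n \<le> prob {\<omega>\<in>space M. lambda_star f (X n) (\<lambda>i. \<xi> i \<omega>) \<le> q n}" if "n \<ge> 1" for n
    unfolding q_def using \<alpha>01[OF that] by (intro prob_le_quantile ls_meas) auto
  have lam_nonneg: "0 \<le> lam n" if "n \<ge> 1" for n
    using lam_ge[OF that] q_nonneg[OF that] \<eta>_range[OF that] by (intro order_trans[OF _ lam_ge[OF that]]) auto
  obtain cr where cr: "0 < cr" "eventually (\<lambda>n. rt n \<le> cr * lam n) sequentially"
  proof -
    have "rt \<in> O(lam)" using lam_rate by (simp add: bigtheta_def bigomega_iff_bigo)
    then obtain c where c: "0 < c" "eventually (\<lambda>n. norm (rt n) \<le> c * norm (lam n)) sequentially"
      by (rule landau_o.bigE)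
    have "eventually (\<lambda>n. rt n \<le> c * lam n) sequentially"
      using c(2) eventually_ge_at_top[of 1]
      by eventually_elim (use lam_nonneg in auto)
    with c(1) that show ?thesis by blast
  qed
  have lam_pos: "eventually (\<lambda>n. 0 < lam n) sequentially"
    using cr(2) eventually_ge_at_top[of 1]
  proof eventually_elim
    case (elim n)
    hence "0 < cr * lam n" using rt_pos[of n] by linarith
    thus ?case using cr(1) by (simp add: zero_less_mult_iff)
  qed
  obtain Cs where Cs: "0 < Cs" "eventually (\<lambda>n. linf_mat (sample_cov (X n) - Sig n) \<le> Cs * (Kx n)\<^sup>2 * rt n) sequentially"
  proof -
    obtain c where c: "0 < c" "eventually (\<lambda>n. norm (linf_mat (sample_cov (X n) - Sig n)) \<le> c * norm ((Kx n)\<^sup>2 * rt n)) sequentially"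
      using Sig_approx by (rule landau_o.bigE)
    have "eventually (\<lambda>n. linf_mat (sample_cov (X n) - Sig n) \<le> c * (Kx n)\<^sup>2 * rt n) sequentially"
      using c(2) eventually_ge_at_top[of 1]
    proof eventually_elim
      case (elim n)
      thus ?case using rt_pos[of n] by (simp add: mult.assoc abs_mult)
    qed
    with c(1) that show ?thesis by blast
  qed
  obtain c1 where c1: "0 < c1" "eventually (\<lambda>n. c1 \<le> 1 - \<eta> n) sequentially"
  proof -
    obtain c where c: "0 < c" "eventually (\<lambda>n. norm (1 :: real) \<le> c * norm (1 - \<eta> n)) sequentially"
      using \<eta>_away by (rule landau_o.bigE)
    have "eventually (\<lambda>n. 1 / c \<le> 1 - \<eta> n) sequentially"
      using c(2) eventually_ge_at_top[of 1]
    proof eventually_elim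
      case (elim n)
      thus ?case using c(1) \<eta>_range[of n] by (simp add: field_simps)
    qed
    with c(1) that[of "1 / c"] show ?thesis by simp
  qed

  \<comment> \<open>The sequence \<open>r_n\<close> and its order\<close>
  define Y where "Y n = (Kx n)\<^sup>2 * lam n * s n / (\<eta> n)\<^sup>2" for n
  have Y_o: "Y \<in> o(\<lambda>_. 1)"
  proof -
    have "lam \<in> O(rt)" using lam_rate by (simp add: bigtheta_def)
    then obtain c where c: "0 < c" "eventually (\<lambda>n. norm (lam n) \<le> c * norm (rt n)) sequentially"
      by (rule landau_o.bigE)
    have "(\<lambda>n. (Kx n)\<^sup>2 * lam n * s n) \<in> O(\<lambda>n. smax n * rt n * (Kx n)\<^sup>2 / \<Lambda>x\<^sup>2)"
    proof (rule bigoI[where c = "c * \<Lambda>x\<^sup>2"])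
      show "eventually (\<lambda>n. norm ((Kx n)\<^sup>2 * lam n * s n) \<le> c * \<Lambda>x\<^sup>2 * norm (smax n * rt n * (Kx n)\<^sup>2 / \<Lambda>x\<^sup>2)) sequentially"
        using c(2) eventually_ge_at_top[of 1]
      proof eventually_elim
        case (elim n)
        have s: "0 \<le> s n" "s n \<le> smax n" using s_ge[of n] s_le[of n] elim by auto
        have "norm ((Kx n)\<^sup>2 * lam n * s n) = (Kx n)\<^sup>2 * (norm (lam n) * s n)" using s by (simp add: abs_mult)
        also have "\<dots> \<le> (Kx n)\<^sup>2 * ((c * norm (rt n)) * smax n)"
          using elim s c(1) by (intro mult_left_mono mult_mono) auto
        also have "\<dots> = c * \<Lambda>x\<^sup>2 * norm (smax n * rt n * (Kx n)\<^sup>2 / \<Lambda>x\<^sup>2)"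
          using s \<Lambda>x_pos by (simp add: abs_mult)
        finally show ?case .
      qed
    qed
    also have "(\<lambda>n. smax n * rt n * (Kx n)\<^sup>2 / \<Lambda>x\<^sup>2) \<in> o(\<lambda>n. (\<eta> n)\<^sup>2)" by (rule \<eta>_rate)
    finally have o: "(\<lambda>n. (Kx n)\<^sup>2 * lam n * s n) \<in> o(\<lambda>n. (\<eta> n)\<^sup>2)" .
    have "(\<lambda>n. (Kx n)\<^sup>2 * lam n * s n / (\<eta> n)\<^sup>2) \<longlonglongrightarrow> 0"
      by (rule smalloD_tendsto[OF o])
    thus ?thesis by (intro smalloI_tendsto) (auto simp: Y_def)
  qed
  have Y_lim: "Y \<longlonglongrightarrow> 0" using smalloD_tendsto[OF Y_o] by simp
  define elo ehi where "elo = exp (El - 1)" and "ehi = exp (El + 1)"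
  interpret const: lasso_constants h11 h12 h22 a Lc \<rho> Cd Cs cr "\<Lambda>x\<^sup>2" elo ehi
    by unfold_locales (use a Cd Cs(1) cr(1) \<Lambda>x_pos in \<open>auto simp: elo_def ehi_def\<close>)
  \<comment> \<open>Chosen so that \<open>c1 * R0 n * \<eta> n\<close> equals the relative
    perturbation \<open>C6 * y\<close>, as \<open>irrepresentable_threshold\<close>
    requires.\<close>
  define R0 where "R0 n = const.C6 / c1 * Y n" for n
  \<comment> \<open>The value 1 secures positivity at the finitely many indices where
    \<open>R0\<close> may fail to be positive.\<close>
  define R where "R n = (if 0 < R0 n then R0 n else 1)" for n
  have s_pos: "1 \<le> s n" if "n \<ge> 1" for n using s_ge[OF that] .
  have Y_pos: "eventually (\<lambda>n. 0 < Y n) sequentially"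
    using lam_pos eventually_ge_at_top[of 1]
  proof eventually_elim
    case (elim n)
    thus ?case using Kx_ge[of n] s_pos[of n] \<eta>_range[of n] by (simp add: Y_def)
  qed
  have R_eq: "eventually (\<lambda>n. R n = R0 n) sequentially"
    using Y_pos by eventually_elim (use const.const_pos c1 in \<open>simp add: R_def R0_def\<close>)
  have R_pos: "0 < R n" for n by (simp add: R_def)
  have R_O: "R \<in> O(Y)"
  proof -
    have "R0 \<in> O(Y)"
      by (rule bigoI[where c = "\<bar>const.C6 / c1\<bar>"]) (simp add: R0_def abs_mult)
    thus ?thesis by (subst landau_o.big.in_cong[OF R_eq])
  qed
  have small: "eventually (\<lambda>n. C * Y n \<le> d) sequentially" if "0 < d" for C d
  proof -
    have "(\<lambda>n. C * Y n) \<longlonglongrightarrow> C * 0" by (intro tendsto_intros Y_lim)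
    from order_tendstoD(2)[OF this, of d] that show ?thesis by (auto elim: eventually_mono)
  qed
  have final: "\<exists>e. e \<longlonglongrightarrow> 0 \<and> (\<forall>n\<ge>1.
         measure M {\<omega> \<in> space M. \<forall>j\<in>{1..<p n} - S n. \<beta>h n \<omega> $ j = 0} \<ge> 1 - \<alpha> n + e n)"
    if irr: "\<forall>\<^sub>F n in sequentially. irrepresentable (X n) (S n) (\<eta> n * (1 - R n) / (2 - \<eta> n * (1 + R n)))"
  proof -

    \<comment> \<open>Exceptional events and their probabilities\<close>
    define T where "T n = {\<omega> \<in> space M. \<forall>j\<in>{1..<p n} - S n. \<beta>h n \<omega> $ j = 0}" for n
    \<comment> \<open>Outside \<open>bad3\<close> the factor \<open>e0\<close> lies between
      \<open>elo\<close> and \<open>ehi\<close>; outside \<open>bad4\<close> the scale score is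
      within \<open>rt n\<close> of its mean one.\<close>
    define bad3 where "bad3 n = {\<omega>\<in>space M. 1 \<le> \<bar>(\<Sum>i<n. nll f (\<xi> i \<omega>)) / n - El\<bar>}" for n
    define bad4 where "bad4 n = {\<omega>\<in>space M. rt n \<le> \<bar>(\<Sum>i<n. deriv (nll f) (\<xi> i \<omega>) * \<xi> i \<omega>) / n - 1\<bar>}" for n
    define \<delta>2 where "\<delta>2 n = 4 * (real (p n) + 1)\<^sup>2 * exp (n * (rt n)\<^sup>2 * (smooth.v - c0)) + smooth.tail (1 / rt n)" for n
    define \<delta> where "\<delta> n = \<delta>2 n + prob (bad3 n) + prob (bad4 n)" for n
    have meas: "T n \<in> events" "bad3 n \<in> events" "bad4 n \<in> events" if n: "n \<ge> 1" for n
    proof -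
      note [measurable] = xi_meas smooth.h_meas
      show "bad3 n \<in> events" "bad4 n \<in> events" unfolding bad3_def bad4_def by measurable
      have "{\<omega>\<in>space M. \<beta>h n \<omega> $ j = 0} \<in> events" if "j \<in> {1..<p n} - S n" for j
      proof -
        have [measurable]: "(\<lambda>\<omega>. \<beta>h n \<omega> $ j) \<in> borel_measurable M" using \<beta>h_rv[OF n] that by simp
        show ?thesis by measurable
      qed
      thus "T n \<in> events" unfolding T_def by (intro sets.sets_Collect_finite_All) auto
    qed
    have score_mean: "(\<integral>t. deriv (nll f) t * t \<partial>noise_law f) = 1"
      using smooth.hd_origin by (simp add: smooth.hd_def)
    have \<delta>_lim: "\<delta> \<longlonglongrightarrow> 0"
    proof -
      have p_real: "filterlim (\<lambda>n. real (p n)) at_top sequentially"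
        by (rule filterlim_compose[OF filterlim_real_sequentially p_lim])
      have "((\<lambda>x::real. 4 * (x + 1)\<^sup>2 * exp (- 3 * ln x)) \<longlongrightarrow> 0) at_top" by real_asymp
      from filterlim_compose[OF this p_real]
      have "(\<lambda>n. 4 * (real (p n) + 1)\<^sup>2 * exp (- 3 * ln (real (p n)))) \<longlonglongrightarrow> 0" .
      moreover have "eventually (\<lambda>n. 4 * (real (p n) + 1)\<^sup>2 * exp (- 3 * ln (real (p n)))
          = 4 * (real (p n) + 1)\<^sup>2 * exp (n * (rt n)\<^sup>2 * (smooth.v - c0))) sequentially"
        using eventually_ge_at_top[of 1]
      proof eventually_elim
        case (elim n)
        show ?case unfolding rt_sq[OF elim] by (simp add: c0_def mult.commute)
      qed
      ultimately have 1: "(\<lambda>n. 4 * (real (p n) + 1)\<^sup>2 * exp (n * (rt n)\<^sup>2 * (smooth.v - c0))) \<longlonglongrightarrow> 0"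
        by (rule Lim_transform_eventually)
      have 2: "(\<lambda>n. smooth.tail (1 / rt n)) \<longlonglongrightarrow> 0"
        by (rule smooth.tail_tendsto[OF rt_lim rt_ev])
      have 3: "(\<lambda>n. prob (bad3 n)) \<longlonglongrightarrow> 0"
        unfolding bad3_def El_def by (rule iid.weak_law[OF smooth.nll_meas l_int])
      define w where "w = (\<integral>t. (deriv (nll f) t * t)\<^sup>2 \<partial>noise_law f)"
      have "((\<lambda>x::real. w / ln x) \<longlongrightarrow> 0) at_top" by real_asymp
      from filterlim_compose[OF this p_real] have w: "(\<lambda>n. w / ln (real (p n))) \<longlonglongrightarrow> 0" .
      \<comment> \<open>Chebyshev's inequality at deviation \<open>rt n\<close> gives
        \<open>w / ln p\<close>, since \<open>n * (rt n)^2 = ln p\<close>.\<close>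
      have 4: "(\<lambda>n. prob (bad4 n)) \<longlonglongrightarrow> 0"
      proof (rule tendsto_sandwich[OF _ _ tendsto_const w])
        show "eventually (\<lambda>n. prob (bad4 n) \<le> w / ln (real (p n))) sequentially"
          using eventually_ge_at_top[of 1]
        proof eventually_elim
          case (elim n)
          have hm: "(\<lambda>t. deriv (nll f) t * t) \<in> borel_measurable borel" using smooth.h_meas by measurable
          have "prob (bad4 n) \<le> w / (n * (rt n)\<^sup>2)"
            using iid.chebyshev_mean[OF hm smooth.ht_int ldx_int, of n "rt n"] rt_pos[OF elim] elim
            unfolding score_mean by (simp add: bad4_def w_def)
          thus ?case unfolding rt_sq[OF elim] .
        qed
      qed simp
      show ?thesis unfolding \<delta>_def[abs_def] \<delta>2_def
        using tendsto_add[OF tendsto_add[OF tendsto_add[OF 1 2] 3] 4] by simp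
    qed
    have sm_ev: "eventually (\<lambda>n. const.kr * Y n \<le> \<rho>) sequentially"
      "eventually (\<lambda>n. 2 * Lc * const.kr * Y n \<le> a) sequentially"
      "eventually (\<lambda>n. const.B3 * const.kr\<^sup>2 * Y n \<le> 1) sequentially"
      "eventually (\<lambda>n. 1 * Y n \<le> 1) sequentially"
      "eventually (\<lambda>n. const.C5 * Y n \<le> 1) sequentially"
      "eventually (\<lambda>n. const.kr * Y n \<le> 1 / 2) sequentially"
      "eventually (\<lambda>n. const.C6 / c1 * Y n \<le> 1 / 2) sequentially"
      by (rule small, use a in simp)+

    \<comment> \<open>The deterministic argument outside the exceptional events, for one large
      \<open>n\<close>\<close>
    have main: "eventually (\<lambda>n. 1 - \<alpha> n - \<delta> n \<le> prob (T n)) sequentially"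
      using eventually_ge_at_top[of 1] lam_pos cr(2) Cs(2) c1(2) R_eq irr rt1_ev sm_ev
    proof eventually_elim
      case (elim n)
      note n = elim(1) and lam0 = elim(2) and rt_cr = elim(3) and Cs_le = elim(4) and c1_le = elim(5)
        and R_R0 = elim(6) and irr_n = elim(7) and rt1 = elim(8)
      note sm = elim(9-15)
      have n0: "0 < n" using n by simp
      define m where "m = const.kr * lam n * s n / \<eta> n"
      have \<eta>n: "0 < \<eta> n" "\<eta> n < 1" using \<eta>_range[OF n] by auto
      have K: "1 \<le> Kx n" by (rule Kx_ge[OF n])
      have m0: "0 < m" using lam0 s_pos[OF n] \<eta>n const.const_pos by (simp add: m_def)
      have Yn: "Y n = (Kx n)\<^sup>2 * lam n * s n / \<eta> n / \<eta> n" by (simp add: Y_def power2_eq_square)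
      have Y0: "0 < Y n" using lam0 s_pos[OF n] \<eta>n K by (simp add: Y_def)
      define y' where "y' = (Kx n)\<^sup>2 * lam n * s n / \<eta> n"
      have y'Y: "y' = Y n * \<eta> n" "y' \<le> Y n" "0 < y'"
      proof -
        show "y' = Y n * \<eta> n" using \<eta>n by (simp add: y'_def Yn)
        thus "y' \<le> Y n" "0 < y'" using Y0 \<eta>n by (simp_all add: mult_left_le)
      qed
      have Km: "Kx n * m \<le> const.kr * Y n"
      proof -
        have "Kx n * (lam n * s n / \<eta> n) \<le> (Kx n)\<^sup>2 * (lam n * s n / \<eta> n)"
          using K lam0 s_pos[OF n] \<eta>n by (intro mult_right_mono) (auto simp: power2_eq_square)
        hence "Kx n * (lam n * s n / \<eta> n) \<le> Y n" using y'Y(2) by (simp add: y'_def)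
        hence "const.kr * (Kx n * (lam n * s n / \<eta> n)) \<le> const.kr * Y n"
          using const.const_pos by (intro mult_left_mono) auto
        thus ?thesis by (simp add: m_def mult_ac)
      qed
      have KmM: "Kx n * m \<le> M0" "Kx n * m \<le> \<rho>" using Km sm(1) a(5) by linarith+
      have x_bound: "\<And>i k. i < n \<Longrightarrow> k < p n \<Longrightarrow> \<bar>X n $$ (i, k)\<bar> \<le> Kx n" by (rule X_bound[OF n])
      obtain E where E: "E \<in> sets (PiM {..<n} (\<lambda>_. noise_law f))"
        "emeasure (PiM {..<n} (\<lambda>_. noise_law f)) E \<le> ennreal (\<delta>2 n)"
        "\<And>w t j. w \<in> space (PiM {..<n} (\<lambda>_. noise_law f)) - E \<Longrightarrow> t \<in> l1_ball (p n) m \<Longrightarrow> j \<le> p n \<Longrightarrow>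
          \<bar>(\<Sum>i<n. smooth.incr (p n) (\<lambda>k. X n $$ (i, k)) j (w i) t
             - (\<integral>u. smooth.incr (p n) (\<lambda>k. X n $$ (i, k)) j u t \<partial>noise_law f)) / n\<bar>
          \<le> (Kx n)\<^sup>2 * m * rt n * (2 * c0 + 1 + smooth.v)"
      proof -
        have "\<exists>E\<in>sets (PiM {..<n} (\<lambda>_. noise_law f)).
          emeasure (PiM {..<n} (\<lambda>_. noise_law f)) E \<le> ennreal (\<delta>2 n) \<and>
          (\<forall>w\<in>space (PiM {..<n} (\<lambda>_. noise_law f)) - E. \<forall>t\<in>l1_ball (p n) m. \<forall>j\<le>p n.
            \<bar>(\<Sum>i<n. smooth.incr (p n) (\<lambda>k. X n $$ (i, k)) j (w i) t
               - (\<integral>u. smooth.incr (p n) (\<lambda>k. X n $$ (i, k)) j u t \<partial>noise_law f)) / n\<bar>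
            \<le> (Kx n)\<^sup>2 * m * rt n * (2 * c0 + 1 + smooth.v))"
          unfolding \<delta>2_def by (rule smooth.uniform_deviation[OF m0 x_bound K KmM(1) n0 rt_pos[OF n]])
        thus ?thesis by (elim bexE conjE) (rule that, assumption+, blast)
      qed
      define bad2 where "bad2 = {\<omega>\<in>space M. (\<lambda>i\<in>{..<n}. \<xi> i \<omega>) \<in> E}"
      have bad2: "bad2 \<in> events" "prob bad2 \<le> \<delta>2 n"
      proof -
        show "bad2 \<in> events" unfolding bad2_def by (rule iid.emeasure_vimage_PiM(1)[OF n0 E(1)])
        have "ennreal (prob bad2) \<le> ennreal (\<delta>2 n)"
          using E(2) iid.emeasure_vimage_PiM(2)[OF n0 E(1)] unfolding bad2_def by (simp add: emeasure_eq_measure)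
        moreover have "0 \<le> \<delta>2 n" using smooth.tail_nonneg by (simp add: \<delta>2_def)
        ultimately show "prob bad2 \<le> \<delta>2 n" by simp
      qed
      \<comment> \<open>The event on the left has probability at least
        \<open>1 - \<alpha> n\<close>, so this inclusion and the union bound give the claim for this
        \<open>n\<close>.\<close>
      have "{\<omega>\<in>space M. lambda_star f (X n) (\<lambda>i. \<xi> i \<omega>) \<le> q n} \<subseteq> T n \<union> bad2 \<union> bad3 n \<union> bad4 n"
      proof (rule subsetI, rule ccontr)
        fix \<omega> assume \<omega>1: "\<omega> \<in> {\<omega>\<in>space M. lambda_star f (X n) (\<lambda>i. \<xi> i \<omega>) \<le> q n}"
          and \<omega>2: "\<omega> \<notin> T n \<union> bad2 \<union> bad3 n \<union> bad4 n"
        have \<omega>: "\<omega> \<in> space M" and ls: "lambda_star f (X n) (\<lambda>i. \<xi> i \<omega>) \<le> q n" using \<omega>1 by auto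
        interpret LS: lasso_matrix_sample f n "p n" "X n" "\<lambda>i. \<xi> i \<omega>" "\<beta>s n" "lam n"
          using n0 p2[OF n] lam0 smooth.nll_tangent smooth.nll_has_deriv X_dim[OF n] \<beta>s_dim[OF n]
          by unfold_locales auto
        have S_eq: "LS.S = S n" by (simp add: LS.S_eq S_def)
        interpret LE: lasso_event "nll f" "deriv (nll f)" n "p n" "\<lambda>i k. X n $$ (i, k)" "\<lambda>i. \<xi> i \<omega>"
          "\<lambda>k. \<beta>s n $ k" "lam n" h11 h12 h22 a Lc \<rho> Cd Cs cr "\<Lambda>x\<^sup>2" elo ehi
          "\<lambda>c \<tau>. smooth.hc c \<tau> - smooth.hc 0 0" "\<lambda>c \<tau>. smooth.hd c \<tau> - smooth.hd 0 0" "Kx n" "rt n" "\<eta> n"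
        proof (unfold_locales)
          show "1 \<le> Kx n" by fact
          show "\<bar>X n $$ (i, k)\<bar> \<le> Kx n" if "i < n" "k < p n" for i k using x_bound that .
          show "X n $$ (i, 0) = 1" if "i < n" for i using X_intercept[OF n that] .
          show "(\<Sum>i<n. X n $$ (i, j)) = 0" if "1 \<le> j" "j < p n" for j using X_centered[OF n that] .
          show "a * (c\<^sup>2 + \<tau>\<^sup>2) \<le> h11 * c\<^sup>2 + 2 * h12 * c * \<tau> + h22 * \<tau>\<^sup>2" for c \<tau> by (rule quad)
          show "\<bar>smooth.hc c \<tau> - smooth.hc 0 0 - (h11 * c + h12 * \<tau>)\<bar> \<le> Lc * (\<bar>c\<bar> + \<bar>\<tau>\<bar>)\<^sup>2"
            if "\<bar>c\<bar> + \<bar>\<tau>\<bar> \<le> \<rho>" for c \<tau> using hc[OF that] .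
          show "\<bar>smooth.hd c \<tau> - smooth.hd 0 0 - (h12 * c + h22 * \<tau>)\<bar> \<le> Lc * (\<bar>c\<bar> + \<bar>\<tau>\<bar>)\<^sup>2"
            if "\<bar>c\<bar> + \<bar>\<tau>\<bar> \<le> \<rho>" for c \<tau> using hd[OF that] .
          show "0 < \<eta> n" "\<eta> n < 1" by fact+
          show "0 \<le> rt n" "rt n \<le> 1" "rt n \<le> cr * lam n" using rt_pos[OF n] rt1 rt_cr by auto
          show "LS.e0 * \<bar>LS.grad (\<lambda>_. 0) j\<bar> \<le> (1 - \<eta> n) * lam n" if "j < p n" for j
          proof -
            have "q n \<le> (1 - \<eta> n) * lam n" using lam_ge[OF n] \<eta>n by (simp add: field_simps)
            thus ?thesis using LS.score_le_lambda_star[OF that] ls by linarith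
          qed
          show "\<bar>LS.grad (\<lambda>_. 0) (p n) - 1\<bar> \<le> rt n"
            using \<omega>2 \<omega> unfolding LS.grad_zero_p by (simp add: bad4_def)
          have "\<bar>(\<Sum>i<n. nll f (\<xi> i \<omega>)) / n - El\<bar> \<le> 1" using \<omega>2 \<omega> by (simp add: bad3_def)
          hence "El - 1 \<le> (\<Sum>i<n. nll f (\<xi> i \<omega>)) / n" "(\<Sum>i<n. nll f (\<xi> i \<omega>)) / n \<le> El + 1" by linarith+
          thus "elo \<le> LS.e0" "LS.e0 \<le> ehi" unfolding LS.e0_eq elo_def ehi_def by simp_all
          show "LS.S \<noteq> {}" unfolding S_eq S_def using s_ge[OF n] by (auto simp: s_def)
          show "\<Lambda>x\<^sup>2 * (\<Sum>j<p n. (t j)\<^sup>2) - Cs * (Kx n)\<^sup>2 * rt n * (\<Sum>j<p n. \<bar>t j\<bar>)\<^sup>2 \<le> LS.vX t" for t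
            using LS.vX_ge[OF Sig_dim[OF n] Sig_sym[OF n] Sig_eig[OF n], of t]
              mult_right_mono[OF Cs_le, of "(\<Sum>j<p n. \<bar>t j\<bar>)\<^sup>2"] by simp
        qed
        have LE_s: "LE.s = s n" by (simp add: LE.s_def S_eq S_def s_def)
        have LE_m: "LE.m = m" and LE_y: "LE.y = y'" by (simp_all add: LE.m_def LE.y_def LE_s m_def y'_def)
        have dev: "\<bar>LS.grad t j - LS.grad (\<lambda>_. 0) j - LE.expected t j\<bar> \<le> Cd * (Kx n)\<^sup>2 * LE.m * rt n"
          if t: "t \<in> l1_ball (p n) LE.m" and j: "j \<le> p n" for t j
        proof -
          define w where "w = (\<lambda>i\<in>{..<n}. \<xi> i \<omega>)"
          have "w \<in> space (PiM {..<n} (\<lambda>_. noise_law f))" by (auto simp: w_def space_PiM)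
          moreover have "w \<notin> E" using \<omega>2 \<omega> by (simp add: bad2_def w_def)
          ultimately have w: "w \<in> space (PiM {..<n} (\<lambda>_. noise_law f)) - E" by blast
          have ex: "(\<integral>u. smooth.incr (p n) (\<lambda>k. X n $$ (i, k)) j u t \<partial>noise_law f)
              = (if j < p n then X n $$ (i, j) * (smooth.hc (LS.xt i t) (t (p n)) - smooth.hc 0 0)
                 else smooth.hd (LS.xt i t) (t (p n)) - smooth.hd 0 0)" if "i < n" for i
          proof -
            have "\<bar>LS.xt i t\<bar> + \<bar>t (p n)\<bar> \<le> M0" using LE.xt_bound[OF that t] KmM(1) unfolding LE_m by linarith
            thus ?thesis unfolding LS.xt_def by (intro smooth.expected_incr j)
          qed
          have "LS.grad t j - LS.grad (\<lambda>_. 0) j = (\<Sum>i<n. smooth.incr (p n) (\<lambda>k. X n $$ (i, k)) j (w i) t) / n"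
            by (simp add: LS.grad_def smooth.incr_def w_def left_diff_distrib sum_subtractf diff_divide_distrib)
          moreover have "LE.expected t j = (\<Sum>i<n. \<integral>u. smooth.incr (p n) (\<lambda>k. X n $$ (i, k)) j u t \<partial>noise_law f) / n"
            unfolding LE.expected_def using ex by simp
          ultimately have "LS.grad t j - LS.grad (\<lambda>_. 0) j - LE.expected t j
            = (\<Sum>i<n. smooth.incr (p n) (\<lambda>k. X n $$ (i, k)) j (w i) t
               - (\<integral>u. smooth.incr (p n) (\<lambda>k. X n $$ (i, k)) j u t \<partial>noise_law f)) / n"
            by (simp add: sum_subtractf diff_divide_distrib)
          thus ?thesis using E(3)[OF w t[unfolded LE_m] j] unfolding LE_m Cd_def by (simp add: mult_ac)
        qed
        have small_a: "2 * Lc * (Kx n * LE.m) \<le> a"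
          using mult_left_mono[OF Km, of "2 * Lc"] a(3) sm(2) unfolding LE_m by (simp add: mult_ac)
        have small_y: "const.B3 * const.kr\<^sup>2 * (LE.y / \<eta> n) \<le> 1" "LE.y / \<eta> n \<le> 1" "const.C5 * LE.y \<le> 1"
        proof -
          have yY: "LE.y / \<eta> n = Y n" using y'Y(1) \<eta>n by (simp add: LE_y)
          show "const.B3 * const.kr\<^sup>2 * (LE.y / \<eta> n) \<le> 1" "LE.y / \<eta> n \<le> 1" unfolding yY using sm(3,4) by simp_all
          have "const.C5 * y' \<le> const.C5 * Y n" using y'Y(2) const.const_pos by (intro mult_left_mono) auto
          thus "const.C5 * LE.y \<le> 1" using sm(5) unfolding LE_y by linarith
        qed
        have small_m: "LE.m < 1" using LE.m_le(2) mult_left_mono[OF y'Y(2), of const.kr] const.const_pos sm(6)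
          unfolding LE_y by linarith
        have small_lam: "lam n \<le> 1"
        proof -
          have "lam n * 1 \<le> lam n * LE.s" using lam0 LE.s_ge by (intro mult_left_mono) auto
          also have "\<dots> \<le> LE.y" using LE.m_le(4,5) by linarith
          finally show ?thesis using y'Y(2) sm(4) unfolding LE_y by simp
        qed
        have small_\<rho>: "Kx n * LE.m \<le> \<rho>" using KmM(2) unfolding LE_m .
        define \<eta>0 where "\<eta>0 = \<eta> n * (1 - R n) / (2 - \<eta> n * (1 + R n))"
        have "R n < 1" using sm(7) unfolding R_R0 R0_def by linarith
        have thr: "(1 - \<eta> n + const.C6 * LE.y) + \<eta>0 * (2 - \<eta> n + const.C6 * LE.y) \<le> 1"
        proof -
          have "c1 * R n * \<eta> n = const.C6 * LE.y"
            using c1(1) unfolding R_R0 R0_def LE_y y'Y(1) by simp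
          with irrepresentable_threshold[OF \<eta>n R_pos \<open>R n < 1\<close> c1(1) c1_le] show ?thesis unfolding \<eta>0_def by simp
        qed
        have S_sub: "S n \<subseteq> {1..<p n}" using \<beta>s_dim[OF n] by (auto simp: S_def active_set_def)
        have sol: "\<exists>c. (\<forall>j\<in>LS.S. (\<Sum>i<n. X n $$ (i, j) * (\<Sum>k\<in>LS.S. X n $$ (i, k) * c k)) = v j) \<and>
          (\<forall>j\<in>{1..<p n} - LS.S. \<bar>\<Sum>i<n. X n $$ (i, j) * (\<Sum>k\<in>LS.S. X n $$ (i, k) * c k)\<bar> < \<eta>0 * V)"
          if "0 < V" "\<And>j. j \<in> LS.S \<Longrightarrow> \<bar>v j\<bar> \<le> V" for v V
          unfolding S_eq
          by (rule irrepresentable_solution[OF irr_n[folded \<eta>0_def] X_dim[OF n] S_sub that(1)])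
            (use that(2) S_eq in auto)
        have "\<beta>h n \<omega> $ j = 0" if "j \<in> {1..<p n} - S n" for j
        proof (rule LS.minimizer_zero_outside)
          show "\<exists>t\<in>LS.admissible. \<forall>t'\<in>LS.admissible. LS.obj t \<le> LS.obj t'"
            by (rule LE.optimum_exists[OF dev small_\<rho> small_a small_y small_m small_lam])
          show "t j = 0" if "t \<in> LS.admissible" "\<And>t'. t' \<in> LS.admissible \<Longrightarrow> LS.obj t \<le> LS.obj t'" "j \<in> {1..<p n} - LS.S" for t j
            by (rule LE.optimum_zero_outside[OF dev small_\<rho> small_a small_y small_m small_lam that(1,2) sol thr that(3)])
          show "exp_lasso_minimizer f (X n) (response (X n) (\<beta>s n) 1 (\<lambda>i. \<xi> i \<omega>)) (lam n) (\<beta>h n \<omega>, \<sigma>h n \<omega>)"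
            if "\<exists>z. exp_lasso_minimizer f (X n) (response (X n) (\<beta>s n) 1 (\<lambda>i. \<xi> i \<omega>)) (lam n) z"
            using \<beta>h_min[OF n \<omega>] that by (simp add: y_def)
          show "j \<in> {1..<p n} - active_set (\<beta>s n)" using that by (simp add: S_def)
        qed
        thus False using \<omega>2 \<omega> by (simp add: T_def)
      qed
      hence "prob {\<omega>\<in>space M. lambda_star f (X n) (\<lambda>i. \<xi> i \<omega>) \<le> q n} \<le> prob (T n \<union> bad2 \<union> bad3 n \<union> bad4 n)"
        using meas[OF n] bad2(1) by (intro finite_measure_mono) auto
      moreover have "prob (T n \<union> bad2 \<union> bad3 n \<union> bad4 n) \<le> prob (T n \<union> bad2 \<union> bad3 n) + prob (bad4 n)"
        "prob (T n \<union> bad2 \<union> bad3 n) \<le> prob (T n \<union> bad2) + prob (bad3 n)"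
        "prob (T n \<union> bad2) \<le> prob (T n) + prob bad2"
        using meas[OF n] bad2(1) by (auto intro!: measure_Un_le)
      ultimately show ?case using E1[OF n] bad2(2) by (simp add: \<delta>_def)
    qed
    \<comment> \<open>The minimum with 0 makes the lower bound true for every \<open>n\<close>, also
      for those where the asymptotic estimate is not yet available, and the sandwich by
      \<open>- \<delta> n\<close> gives the limit.\<close>
    define err where "err n = min 0 (prob (T n) - (1 - \<alpha> n))" for n
    have "err \<longlonglongrightarrow> 0"
    proof (rule tendsto_sandwich[of "\<lambda>n. min 0 (- \<delta> n)" _ _ "\<lambda>_. 0"])
      show "eventually (\<lambda>n. min 0 (- \<delta> n) \<le> err n) sequentially"
        using main by eventually_elim (auto simp: err_def)
      have "(\<lambda>n. min 0 (- \<delta> n)) \<longlonglongrightarrow> min 0 (- 0)" by (intro tendsto_intros \<delta>_lim)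
      thus "(\<lambda>n. min 0 (- \<delta> n)) \<longlonglongrightarrow> 0" by simp
    qed (auto simp: err_def)
    moreover have "1 - \<alpha> n + err n \<le> prob (T n)" for n by (simp add: err_def)
    ultimately show ?thesis unfolding T_def by blast
  qed
  show ?thesis
    using R_pos R_O Y_o final by (intro exI[of _ R]) (simp add: Y_def[abs_def])
qed

end
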